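(* Let $G$ be a discrete, non-elementary, torsion-free subgroup of ${\rm Sp}(n,1)$. Let $g$ be a loxodromic element of $G$ with axis the geodesic $\gamma$. Suppose that $M_g<\sqrt3-1$, and let $r>0$ be defined by $$\cosh(2r)=\frac{2(1-M_g)}{M_g^2}.$$ Then the canonical tube $T_r(\gamma)$ is precisely invariant under $\langle g\rangle$ in $G$. In particular, the canonical collar $C_r(\gamma')$ of width $r$ about $\gamma'=\gamma/\langle g\rangle$ is embedded in the manifold $\mathcal M={\bf H}^n_{\mathbb H}/G$.
   Context: Let $\mathbb H$ be the quaternions, $n$ a positive integer, and $\mathbb H^{n,1}$ the right quaternionic vector space of column vectors with $n+1$ quaternionic entries, with the Hermitian form $\langle {\bf z},{\bf w}\rangle=\overline{w}_1z_1+\cdots+\overline{w}_{n-1}z_{n-1}-(\overline{w}_nz_{n+1}+\overline{w}_{n+1}z_n)$. ${\rm Sp}(n,1)$ is the group of linear automorphisms (matrices acting on the left) preserving this form. Let $V_0=\{{\bf z}\ne 0:\langle {\bf z},{\bf z}\rangle=0\}$, $V_-=\{{\bf z}:\langle {\bf z},{\bf z}\rangle<0\}$, and let $\mathbb P$ be the right projection ${\bf z}\mapsto[{\bf z}]$, where ${\bf z}\sim{\bf z}\lambda$ for $\lambda\in\mathbb H\setminus\{0\}$. Quaternionic hyperbolic space is ${\bf H}^n_{\mathbb H}=\mathbb P(V_-)$, with boundary $\partial{\bf H}^n_{\mathbb H}=\mathbb P(V_0)$ and Bergman metric $\rho$ given by $\cosh^2\frac{\rho(z,w)}{2}=\frac{\langle{\bf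 z},{\bf w}\rangle\langle{\bf w},{\bf z}\rangle}{\langle{\bf z},{\bf z}\rangle\langle{\bf w},{\bf w}\rangle}$ for any lifts ${\bf z},{\bf w}$ of $z,w$; ${\rm Sp}(n,1)$ acts by isometries. An element $g\in{\rm Sp}(n,1)$ is loxodromic if it has exactly two fixed points in ${\bf H}^n_{\mathbb H}\cup\partial{\bf H}^n_{\mathbb H}$, and both lie in $\partial{\bf H}^n_{\mathbb H}$; its axis is the geodesic joining them. Such $g$ is conjugate in ${\rm Sp}(n,1)$ to ${\rm diag}(\lambda_1,\ldots,\lambda_{n-1},\lambda_n,\overline{\lambda}_n^{-1})$ with $\lambda_i\in\mathbb H$, $|\lambda_i|=1$ for $1\le i\le n-1$, and $|\lambda_n|>1$. Define the conjugacy invariants $$\delta(g)=\max_{1\le i\le n-1}|\lambda_i-1|,\qquad M_g=2\delta(g)+|\lambda_n-1|+|\overline{\lambda}_n^{-1}-1|$$ (a maximum over an empty index set is $0$). The condition $M_g<\sqrt3-1$ is equivalent to $2(1-M_g)/M_g^2>1$. A subgroup of ${\rm Sp}(n,1)$ is elementary if it has a finite orbit in ${\bf H}^n_{\mathbb H}\cup\partial{\bf H}^n_{\mathbb H}$. For a geodesic $\gamma$ and $r>0$, the tube $T_r(\gamma)$ is the set of points of ${\bf H}^n_{\mathbb H}$ at distance less than $r$ from $\gamma$. If $\gamma$ is the axis of $g\in G$, then $g$ maps $T_r(\gamma)$ to itself, and $T_r(\gamma)$ is called precisely invariant under the subgroup $\langle g\rangle$ of $G$ if $h(T_r(\gamma))\cap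 T_r(\gamma)=\emptyset$ for all $h\in G\setminus\langle g\rangle$. The collar of width $r$ about $\gamma'=\gamma/\langle g\rangle$ is $C_r(\gamma')=T_r(\gamma)/\langle g\rangle$; it is embedded in $\mathcal M$ if the natural map $T_r(\gamma)/\langle g\rangle\to\mathcal M$ is injective. The tube and collar are called canonical when $r$ is given by $\cosh(2r)=2(1-M_g)/M_g^2$.
   Formalization: The claims for ⟨g⟩ are proved when g is not a proper power in G; if g = k^m with k in G, m ≥ 2, then k is not in ⟨g⟩ but preserves the tube, so they fail. For arbitrary g both claims are proved with the stabiliser of γ in G in place of ⟨g⟩. *)

theory Defs
  imports "HOL-Analysis.Analysis" "HOL-Algebra.Generated_Groups"
begin

section \<open>Quaternions\<close>

text \<open>\<open>Quat a b c d\<close> is the quaternion \<open>a + b i + c j + d k\<close>.\<close>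

datatype quat = Quat (qRe: real) (qI: real) (qJ: real) (qK: real)

lemma quat_eq_iff: "x = y \<longleftrightarrow> qRe x = qRe y \<and> qI x = qI y \<and> qJ x = qJ y \<and> qK x = qK y"
  by (cases x; cases y) auto

definition qcnj :: "quat \<Rightarrow> quat" where
  "qcnj x = Quat (qRe x) (- qI x) (- qJ x) (- qK x)"

lemma qcnj_simps [simp]:
  "qRe (qcnj x) = qRe x" "qI (qcnj x) = - qI x" "qJ (qcnj x) = - qJ x" "qK (qcnj x) = - qK x"
  by (simp_all add: qcnj_def)

instantiation quat :: real_vector
begin

definition "0 = Quat 0 0 0 0"
definition "x + y = Quat (qRe x + qRe y) (qI x + qI y) (qJ x + qJ y) (qK x + qK y)"
definition "- x = Quat (- qRe x) (- qI x) (- qJ x) (- qK x)"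
definition "x - y = Quat (qRe x - qRe y) (qI x - qI y) (qJ x - qJ y) (qK x - qK y)"
definition "r *\<^sub>R x = Quat (r * qRe x) (r * qI x) (r * qJ x) (r * qK x)"

instance
  by standard
    (simp_all add: quat_eq_iff zero_quat_def plus_quat_def uminus_quat_def minus_quat_def
      scaleR_quat_def algebra_simps)

end

lemma quat_vector_simps [simp]:
  "qRe 0 = 0" "qI 0 = 0" "qJ 0 = 0" "qK 0 = 0"
  "qRe (x + y) = qRe x + qRe y" "qI (x + y) = qI x + qI y"
  "qJ (x + y) = qJ x + qJ y" "qK (x + y) = qK x + qK y"
  "qRe (- x) = - qRe x" "qI (- x) = - qI x" "qJ (- x) = - qJ x" "qK (- x) = - qK x"
  "qRe (x - y) = qRe x - qRe y" "qI (x - y) = qI x - qI y"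
  "qJ (x - y) = qJ x - qJ y" "qK (x - y) = qK x - qK y"
  "qRe (r *\<^sub>R x) = r * qRe x" "qI (r *\<^sub>R x) = r * qI x"
  "qJ (r *\<^sub>R x) = r * qJ x" "qK (r *\<^sub>R x) = r * qK x"
  by (simp_all add: zero_quat_def plus_quat_def uminus_quat_def minus_quat_def scaleR_quat_def)

instantiation quat :: real_algebra_1
begin

definition "1 = Quat 1 0 0 0"
definition "x * y = Quat
  (qRe x * qRe y - qI x * qI y - qJ x * qJ y - qK x * qK y)
  (qRe x * qI y + qI x * qRe y + qJ x * qK y - qK x * qJ y)
  (qRe x * qJ y - qI x * qK y + qJ x * qRe y + qK x * qI y)
  (qRe x * qK y + qI x * qJ y - qJ x * qI y + qK x * qRe y)"

instance
  by standard
    (simp_all add: quat_eq_iff one_quat_def times_quat_def algebra_simps)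

end

lemma quat_times_simps [simp]:
  "qRe 1 = 1" "qI 1 = 0" "qJ 1 = 0" "qK 1 = 0"
  "qRe (x * y) = qRe x * qRe y - qI x * qI y - qJ x * qJ y - qK x * qK y"
  "qI (x * y) = qRe x * qI y + qI x * qRe y + qJ x * qK y - qK x * qJ y"
  "qJ (x * y) = qRe x * qJ y - qI x * qK y + qJ x * qRe y + qK x * qI y"
  "qK (x * y) = qRe x * qK y + qI x * qJ y - qJ x * qI y + qK x * qRe y"
  by (simp_all add: one_quat_def times_quat_def)

definition qnormsq :: "quat \<Rightarrow> real" where
  "qnormsq x = (qRe x)\<^sup>2 + (qI x)\<^sup>2 + (qJ x)\<^sup>2 + (qK x)\<^sup>2"

lemma qnormsq_nonneg: "qnormsq x \<ge> 0"
  by (simp add: qnormsq_def)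

lemma qnormsq_eq_0: "qnormsq x = 0 \<longleftrightarrow> x = 0"
  by (simp add: qnormsq_def quat_eq_iff add_nonneg_eq_0_iff)

lemma quat_scaleR_cnj_mult:
  assumes "x \<noteq> 0"
  shows "(inverse (qnormsq x) *\<^sub>R qcnj x) * x = 1" "x * (inverse (qnormsq x) *\<^sub>R qcnj x) = 1"
proof -
  have n: "qnormsq x \<noteq> 0" using assms qnormsq_eq_0 by blast
  have "qcnj x * x = qnormsq x *\<^sub>R 1" "x * qcnj x = qnormsq x *\<^sub>R 1"
    by (simp_all add: quat_eq_iff qnormsq_def power2_eq_square algebra_simps)
  then show "(inverse (qnormsq x) *\<^sub>R qcnj x) * x = 1"
    "x * (inverse (qnormsq x) *\<^sub>R qcnj x) = 1"
    using n by (simp_all only: mult_scaleR_left mult_scaleR_right scaleR_scaleR) auto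
qed

instantiation quat :: real_div_algebra
begin

definition "inverse x = inverse (qnormsq x) *\<^sub>R qcnj x"
definition "x div y = x * inverse y" for x y :: quat

instance
proof
  fix x y :: quat
  show "x \<noteq> 0 \<Longrightarrow> inverse x * x = 1" "x \<noteq> 0 \<Longrightarrow> x * inverse x = 1"
    unfolding inverse_quat_def by (rule quat_scaleR_cnj_mult; assumption)+
  show "x div y = x * inverse y" by (rule divide_quat_def)
  show "inverse (0 :: quat) = 0"
    by (simp add: inverse_quat_def qnormsq_def)
qed

end

instantiation quat :: real_normed_div_algebra
begin

definition "norm x = sqrt (qnormsq x)"
definition sgn_quat_def: "sgn x = x /\<^sub>R norm (x :: quat)"
definition dist_quat_def: "dist x y = norm (x - y :: quat)"
definition uniformity_quat_def [code del]:
  "(uniformity :: (quat \<times> quat) filter) = (INF e\<in>{0 <..}. principal {(x, y). dist x y < e})"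
definition open_quat_def [code del]:
  "open (U :: quat set) \<longleftrightarrow> (\<forall>x\<in>U. eventually (\<lambda>(x', y). x' = x \<longrightarrow> y \<in> U) uniformity)"

instance
proof
  fix r :: real and x y :: quat
  show "(norm x = 0) = (x = 0)"
    by (simp add: norm_quat_def qnormsq_eq_0)
  have tuple: "norm z = norm ((qRe z, qI z), (qJ z, qK z))" for z
    by (simp add: norm_quat_def qnormsq_def norm_Pair)
  show "norm (x + y) \<le> norm x + norm y"
    using norm_triangle_ineq[of "((qRe x, qI x), (qJ x, qK x))" "((qRe y, qI y), (qJ y, qK y))"]
    by (simp add: tuple)
  have "qnormsq (r *\<^sub>R x) = r\<^sup>2 * qnormsq x"
    by (simp add: qnormsq_def power_mult_distrib algebra_simps)
  then show "norm (r *\<^sub>R x) = \<bar>r\<bar> * norm x"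
    by (simp add: norm_quat_def real_sqrt_mult)
  have "qnormsq (x * y) = qnormsq x * qnormsq y"
    by (simp add: qnormsq_def) algebra
  then show "norm (x * y) = norm x * norm y"
    by (simp add: norm_quat_def real_sqrt_mult)
qed (rule sgn_quat_def dist_quat_def open_quat_def uniformity_quat_def)+

end


section \<open>Quaternionic hyperbolic space\<close>

text \<open>
  Vectors of \<open>\<bbbH>\<^sup>n\<^sup>,\<^sup>1\<close> are indexed by a finite type \<open>'n\<close> with \<open>CARD('n) = n + 1\<close>, in which two
  distinct indices \<open>p\<close> and \<open>q\<close> take the place of \<open>n\<close> and \<open>n + 1\<close>; the remaining \<open>n - 1\<close> indices
  (possibly none) take the place of \<open>1, \<dots>, n - 1\<close>. The definitions below are meant for \<open>p \<noteq> q\<close>.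
\<close>

definition herm :: "'n \<Rightarrow> 'n \<Rightarrow> quat ^ 'n::finite \<Rightarrow> quat ^ 'n \<Rightarrow> quat" where
  "herm p q z w =
     (\<Sum>i\<in>UNIV - {p, q}. qcnj (w $ i) * z $ i) - (qcnj (w $ p) * z $ q + qcnj (w $ q) * z $ p)"

text \<open>Right-linear automorphisms of the column space are exactly the invertible matrices acting
  from the left.\<close>

definition Sp :: "'n \<Rightarrow> 'n \<Rightarrow> (quat ^ 'n ^ 'n::finite) monoid" where
  "Sp p q = \<lparr>carrier = {A. invertible A \<and> (\<forall>z w. herm p q (A *v z) (A *v w) = herm p q z w)},
             mult = (**), one = mat 1\<rparr>"

text \<open>\<open>herm p q z z\<close> is always real, so its sign is that of its real part.\<close>

definition V_zero :: "'n \<Rightarrow> 'n \<Rightarrow> (quat ^ 'n::finite) set" where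
  "V_zero p q = {z. z \<noteq> 0 \<and> herm p q z z = 0}"

definition V_neg :: "'n \<Rightarrow> 'n \<Rightarrow> (quat ^ 'n::finite) set" where
  "V_neg p q = {z. qRe (herm p q z z) < 0}"

text \<open>A projective point is represented by the set of all its lifts.\<close>

type_synonym 'n ppoint = "(quat ^ 'n) set"

definition proj :: "quat ^ 'n \<Rightarrow> 'n::finite ppoint" where
  "proj z = {(\<chi> i. z $ i * l) | l. l \<noteq> 0}"

definition hyp :: "'n \<Rightarrow> 'n \<Rightarrow> 'n::finite ppoint set" where
  "hyp p q = proj ` V_neg p q"

definition bdry :: "'n \<Rightarrow> 'n \<Rightarrow> 'n::finite ppoint set" where
  "bdry p q = proj ` V_zero p q"

definition act :: "quat ^ 'n ^ 'n \<Rightarrow> 'n::finite ppoint \<Rightarrow> 'n ppoint" where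
  "act g P = (\<lambda>z. g *v z) ` P"

definition rho :: "'n \<Rightarrow> 'n \<Rightarrow> 'n::finite ppoint \<Rightarrow> 'n ppoint \<Rightarrow> real" where
  "rho p q P Q = (THE d. d \<ge> 0 \<and> (\<forall>z\<in>P. \<forall>w\<in>Q.
     of_real ((cosh (d / 2))\<^sup>2) =
       (herm p q z w * herm p q w z) / (herm p q z z * herm p q w w)))"

text \<open>Convergence in the quotient topology of projective space, expressed by convergence of
  suitable lifts.\<close>

definition ptendsto :: "('a \<Rightarrow> 'n::finite ppoint) \<Rightarrow> 'n ppoint \<Rightarrow> 'a filter \<Rightarrow> bool" where
  "ptendsto c P F \<longleftrightarrow> (\<exists>z. (\<forall>t. z t \<in> c t) \<and> (\<exists>w\<in>P. (z \<longlongrightarrow> w) F))"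

text \<open>\<open>\<gamma>\<close> is (the point set of) a complete geodesic with endpoints \<open>u\<close> and \<open>v\<close> at infinity.\<close>

definition geodesic_joining ::
    "'n \<Rightarrow> 'n \<Rightarrow> 'n::finite ppoint \<Rightarrow> 'n ppoint \<Rightarrow> 'n ppoint set \<Rightarrow> bool" where
  "geodesic_joining p q u v \<gamma> \<longleftrightarrow>
     (\<exists>c :: real \<Rightarrow> 'n ppoint. range c = \<gamma> \<and> \<gamma> \<subseteq> hyp p q \<and>
        (\<forall>s t. rho p q (c s) (c t) = \<bar>s - t\<bar>) \<and>
        ptendsto c u at_bot \<and> ptendsto c v at_top)"

definition tube :: "'n \<Rightarrow> 'n \<Rightarrow> 'n::finite ppoint set \<Rightarrow> real \<Rightarrow> 'n ppoint set" where
  "tube p q \<gamma> r = {x \<in> hyp p q. (INF y\<in>\<gamma>. rho p q x y) < r}"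


section \<open>Loxodromic elements and their invariants\<close>

definition fixed_points :: "'n \<Rightarrow> 'n \<Rightarrow> quat ^ 'n ^ 'n \<Rightarrow> 'n::finite ppoint set" where
  "fixed_points p q g = {P \<in> hyp p q \<union> bdry p q. act g P = P}"

definition loxodromic :: "'n \<Rightarrow> 'n \<Rightarrow> quat ^ 'n ^ 'n::finite \<Rightarrow> bool" where
  "loxodromic p q g \<longleftrightarrow> g \<in> carrier (Sp p q) \<and>
     card (fixed_points p q g) = 2 \<and> fixed_points p q g \<subseteq> bdry p q"

definition is_axis :: "'n \<Rightarrow> 'n \<Rightarrow> quat ^ 'n ^ 'n \<Rightarrow> 'n::finite ppoint set \<Rightarrow> bool" where
  "is_axis p q g \<gamma> \<longleftrightarrow> (\<exists>u v. fixed_points p q g = {u, v} \<and> u \<noteq> v \<and> geodesic_joining p q u v \<gamma>)"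

definition diagonal :: "('n \<Rightarrow> quat) \<Rightarrow> quat ^ 'n ^ 'n::finite" where
  "diagonal l = (\<chi> i j. if i = j then l i else 0)"

text \<open>\<open>l\<close> lists the diagonal entries \<open>\<lambda>\<^sub>1, \<dots>, \<lambda>\<^sub>n\<^sub>-\<^sub>1, \<lambda>\<^sub>n, cnj(\<lambda>\<^sub>n)\<^sup>-\<^sup>1\<close> of a diagonal matrix conjugate to
  \<open>g\<close>. They are determined by \<open>g\<close> only up to the order of the first \<open>n - 1\<close> entries and up to
  similarity of each entry, neither of which affects \<open>delta_inv\<close> and \<open>M_inv\<close> below.\<close>

definition diag_form :: "'n \<Rightarrow> 'n \<Rightarrow> quat ^ 'n ^ 'n::finite \<Rightarrow> ('n \<Rightarrow> quat) \<Rightarrow> bool" where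
  "diag_form p q g l \<longleftrightarrow>
     (\<forall>i. i \<noteq> p \<and> i \<noteq> q \<longrightarrow> norm (l i) = 1) \<and> norm (l p) > 1 \<and> l q = inverse (qcnj (l p)) \<and>
     (\<exists>A\<in>carrier (Sp p q).
        A \<otimes>\<^bsub>Sp p q\<^esub> g \<otimes>\<^bsub>Sp p q\<^esub> inv\<^bsub>Sp p q\<^esub> A = diagonal l)"

definition eigs :: "'n \<Rightarrow> 'n \<Rightarrow> quat ^ 'n ^ 'n::finite \<Rightarrow> 'n \<Rightarrow> quat" where
  "eigs p q g = (SOME l. diag_form p q g l)"

text \<open>Inserting 0 gives the convention for the empty index set and is harmless otherwise.\<close>

definition delta_inv :: "'n \<Rightarrow> 'n \<Rightarrow> quat ^ 'n ^ 'n::finite \<Rightarrow> real" where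
  "delta_inv p q g = Max (insert 0 ((\<lambda>i. norm (eigs p q g i - 1)) ` (UNIV - {p, q})))"

definition M_inv :: "'n \<Rightarrow> 'n \<Rightarrow> quat ^ 'n ^ 'n::finite \<Rightarrow> real" where
  "M_inv p q g =
     2 * delta_inv p q g + norm (eigs p q g p - 1) + norm (inverse (qcnj (eigs p q g p)) - 1)"


section \<open>Subgroups, precise invariance and embedded collars\<close>

definition orbit :: "(quat ^ 'n ^ 'n) set \<Rightarrow> 'n::finite ppoint \<Rightarrow> 'n ppoint set" where
  "orbit K x = (\<lambda>k. act k x) ` K"

definition elementary :: "'n \<Rightarrow> 'n \<Rightarrow> (quat ^ 'n ^ 'n::finite) set \<Rightarrow> bool" where
  "elementary p q G \<longleftrightarrow> (\<exists>x \<in> hyp p q \<union> bdry p q. finite (orbit G x))"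

definition torsion_free :: "'n \<Rightarrow> 'n \<Rightarrow> (quat ^ 'n ^ 'n::finite) set \<Rightarrow> bool" where
  "torsion_free p q G \<longleftrightarrow>
     (\<forall>x\<in>G. \<forall>m::nat. m > 0 \<and> x [^]\<^bsub>Sp p q\<^esub> m = \<one>\<^bsub>Sp p q\<^esub> \<longrightarrow> x = \<one>\<^bsub>Sp p q\<^esub>)"

text \<open>\<open>g\<close> is not a proper power in \<open>G\<close>. If \<open>g = k\<^sup>m\<close> with \<open>k \<in> G\<close> and \<open>m \<ge> 2\<close>, then \<open>k \<notin> \<langle>g\<rangle>\<close> maps
  every tube about the axis of \<open>g\<close> to itself, so no such tube is precisely invariant under \<open>\<langle>g\<rangle>\<close>.\<close>

definition primitive_in :: "'n \<Rightarrow> 'n \<Rightarrow> (quat ^ 'n ^ 'n::finite) set \<Rightarrow> quat ^ 'n ^ 'n \<Rightarrow> bool" where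
  "primitive_in p q G g \<longleftrightarrow> (\<forall>k\<in>G. \<forall>m::nat. m \<ge> 2 \<longrightarrow> k [^]\<^bsub>Sp p q\<^esub> m \<noteq> g)"

definition set_stabiliser ::
    "(quat ^ 'n ^ 'n) set \<Rightarrow> 'n::finite ppoint set \<Rightarrow> (quat ^ 'n ^ 'n) set" where
  "set_stabiliser G X = {h \<in> G. act h ` X = X}"

definition precisely_invariant ::
    "(quat ^ 'n ^ 'n) set \<Rightarrow> (quat ^ 'n ^ 'n) set \<Rightarrow> 'n::finite ppoint set \<Rightarrow> bool" where
  "precisely_invariant G K T \<longleftrightarrow> (\<forall>h \<in> G - K. act h ` T \<inter> T = {})"

definition quotient_by ::
    "(quat ^ 'n ^ 'n) set \<Rightarrow> 'n::finite ppoint set \<Rightarrow> 'n ppoint set set" where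
  "quotient_by K X = orbit K ` X"

text \<open>For \<open>K \<subseteq> G\<close>, the natural map sends a \<open>K\<close>-orbit to the \<open>G\<close>-orbit containing it.\<close>

definition natural_map ::
    "(quat ^ 'n ^ 'n) set \<Rightarrow> 'n::finite ppoint set \<Rightarrow> 'n ppoint set" where
  "natural_map G c = (\<Union>x\<in>c. orbit G x)"

text \<open>The image of \<open>T/K\<close> under the natural map lies in the quotient of hyperbolic space by \<open>G\<close>, and
  the map is injective.\<close>

definition collar_embedded ::
    "'n \<Rightarrow> 'n \<Rightarrow> (quat ^ 'n ^ 'n) set \<Rightarrow> (quat ^ 'n ^ 'n) set \<Rightarrow> 'n::finite ppoint set \<Rightarrow> bool" where
  "collar_embedded p q G K T \<longleftrightarrow>
     natural_map G ` quotient_by K T \<subseteq> quotient_by G (hyp p q) \<and>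
     inj_on (natural_map G) (quotient_by K T)"

end

(*
  Conjugate so that g = diag(l) with fixed points e_p, e_q, and let a, b, c, d be the corner entries of
  h in G. If the tube meets its image under h, then a point of the axis is at distance less than 2r
  from a point of its image, and the distance formula gives 2 x y < cosh 2r with x = sqrt|bc| and
  y = sqrt|ad|. In Joergensen's iteration h_0 = h, h_(k+1) = h_k g h_k^(-1), one has
  x_(k+1) <= M_g x_k y_k and, by Ptolemy's inequality, y_k <= 1 + x_k. The choice of r is exactly what
  makes M_g (1 + x_1) < 1, so x_k tends to 0 geometrically. Discreteness then forces h_k to fix e_p and
  e_q for large k, and going back through the iteration, h preserves the pair {e_p, e_q}, hence the
  axis. In a discrete torsion-free group such h cannot exchange the end points, and the stabiliser of
  the axis is cyclic, so it is generated by g if g is primitive.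
*)

theory Submission
  imports Defs
begin

section \<open>Quaternions\<close>

text \<open>Overlap of the tubes bounds only the product x_0 y_0, not x_0 itself, so no contraction
  is available at the start. One step of the iteration turns that bound into x_1 < (1 - M_g) / M_g,
  and M_g (1 + x_1) then serves as contraction factor for all later steps. M_g arises by subtracting
  a row relation of h h^(-1) = 1 from the same entry of h g h^(-1): every eigenvalue is replaced by
  its difference from 1, and the n - 1 middle ones contribute 2 delta because the middle part of row
  p or q has squared length at most twice the product of its two corners. Discreteness does not
  apply to a small x_k directly, since x_k only measures the product of two corners; conjugation by
  powers of g balances them. The definitions add two tasks. The eigenvalues are a choice, so a
  diagonal form must be produced by a spectral argument over the quaternions; and the axis is any
  metric geodesic between the fixed points, so it must be shown to be the expected line.\<close>

instantiation quat :: real_inner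
begin

definition "inner x y = qRe x * qRe y + qI x * qI y + qJ x * qJ y + qK x * qK y"

instance
proof
  fix x y z :: quat and r :: real
  show "inner x y = inner y x" "inner (x + y) z = inner x z + inner y z"
    "inner (r *\<^sub>R x) y = r * inner x y"
    by (simp_all add: inner_quat_def algebra_simps)
  show n: "0 \<le> inner x x" by (simp add: inner_quat_def)
  show "inner x x = 0 \<longleftrightarrow> x = 0"
    using qnormsq_eq_0[of x] by (simp add: inner_quat_def qnormsq_def power2_eq_square)
  show "norm x = sqrt (inner x x)"
    by (simp add: inner_quat_def norm_quat_def qnormsq_def power2_eq_square)
qed

end

text \<open>Vectors and matrices over \<open>quat\<close> thereby become Euclidean spaces over the
  reals: closed bounded sets are compact, and injective linear maps are surjective.\<close>

instantiation quat :: euclidean_space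
begin

definition "Basis = {Quat 1 0 0 0, Quat 0 1 0 0, Quat 0 0 1 0, Quat 0 0 0 1}"

instance
proof
  fix u v x :: quat
  show "(Basis :: quat set) \<noteq> {}" "finite (Basis :: quat set)"
    by (simp_all add: Basis_quat_def)
  show "u \<in> Basis \<Longrightarrow> v \<in> Basis \<Longrightarrow> inner u v = (if u = v then 1 else 0)"
    unfolding Basis_quat_def inner_quat_def by (elim insertE emptyE) simp_all
  show "(\<forall>u\<in>Basis. inner x u = 0) \<longleftrightarrow> x = 0"
    unfolding Basis_quat_def inner_quat_def by simp (simp add: quat_eq_iff)
qed

end

lemma qcnj_qcnj [simp]: "qcnj (qcnj x) = x"
  by (simp add: quat_eq_iff)

lemma qcnj_0 [simp]: "qcnj 0 = 0" and qcnj_1 [simp]: "qcnj 1 = 1"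
  by (simp_all add: quat_eq_iff)

lemma qcnj_add [simp]: "qcnj (x + y) = qcnj x + qcnj y"
  and qcnj_diff [simp]: "qcnj (x - y) = qcnj x - qcnj y"
  and qcnj_minus [simp]: "qcnj (- x) = - qcnj x"
  and qcnj_mult [simp]: "qcnj (x * y) = qcnj y * qcnj x"
  and qcnj_scaleR [simp]: "qcnj (r *\<^sub>R x) = r *\<^sub>R qcnj x"
  by (simp_all add: quat_eq_iff algebra_simps)

lemma qcnj_of_real [simp]: "qcnj (of_real r) = of_real r"
  by (simp add: of_real_def)

lemma qcnj_eq_0 [simp]: "qcnj x = 0 \<longleftrightarrow> x = 0"
  by (simp add: quat_eq_iff)

lemma qcnj_sum: "qcnj (sum f A) = (\<Sum>i\<in>A. qcnj (f i))"
  by (induction A rule: infinite_finite_induct) auto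

lemma qRe_sum: "qRe (sum f A) = (\<Sum>i\<in>A. qRe (f i))"
  by (induction A rule: infinite_finite_induct) auto

lemma norm_quat_sq: "(norm x)\<^sup>2 = (qRe x)\<^sup>2 + (qI x)\<^sup>2 + (qJ x)\<^sup>2 + (qK x)\<^sup>2"
  for x :: quat
  by (simp add: norm_quat_def qnormsq_def)

lemma norm_qcnj [simp]: "norm (qcnj x) = norm x"
  by (simp add: norm_quat_def qnormsq_def)

lemma qRe_of_real [simp]: "qRe (of_real r) = r"
  by (simp add: of_real_def)

lemma qRe_numeral [simp]: "qRe (numeral k) = numeral k"
  by (metis of_real_numeral qRe_of_real)

lemma mult_qcnj: "x * qcnj x = of_real ((norm x)\<^sup>2)"
  by (simp add: quat_eq_iff norm_quat_sq of_real_def) (simp add: power2_eq_square algebra_simps)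

lemma qcnj_mult_self: "qcnj x * x = of_real ((norm x)\<^sup>2)"
  by (simp add: quat_eq_iff norm_quat_sq of_real_def) (simp add: power2_eq_square algebra_simps)

lemma of_real_quat_commute: "of_real r * x = x * of_real r" for x :: quat
  by (simp add: of_real_def)

lemma qRe_le_norm: "\<bar>qRe x\<bar> \<le> norm x"
  by (rule power2_le_imp_le) (simp_all add: norm_quat_sq)

lemma real_if_norm_eq_qRe: "norm x = qRe x \<Longrightarrow> x = of_real (qRe x)"
  using norm_quat_sq[of x]
  by (simp add: quat_eq_iff of_real_def add_nonneg_eq_0_iff)

lemma self_conj_real: "qcnj x = x \<Longrightarrow> x = of_real (qRe x)"
  by (simp add: quat_eq_iff of_real_def)

lemma inner_quat_qRe: "inner x y = qRe (qcnj y * x)"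
  by (simp add: inner_quat_def algebra_simps)

section \<open>The Hermitian form\<close>

text \<open>Scalars act on the right, so this operation commutes with matrices acting on the left,
  although multiplication is not commutative.\<close>

definition rscale :: "quat ^ 'n \<Rightarrow> quat \<Rightarrow> quat ^ 'n::finite" where
  "rscale z l = (\<chi> i. z $ i * l)"

lemma rscale_nth [simp]: "rscale z l $ i = z $ i * l"
  by (simp add: rscale_def)

lemma rscale_simps [simp]: "rscale z 1 = z" "rscale 0 l = 0" "rscale z 0 = 0"
  by (simp_all add: vec_eq_iff)

lemma rscale_rscale [simp]: "rscale (rscale z l) m = rscale z (l * m)"
  by (simp add: vec_eq_iff mult.assoc)

lemma rscale_eq_0: "rscale z l = 0 \<longleftrightarrow> z = 0 \<or> l = 0"
  by (auto simp: vec_eq_iff)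

lemma rscale_add: "rscale (z + w) l = rscale z l + rscale w l"
  "rscale z (l + m) = rscale z l + rscale z m"
  "rscale (z - w) l = rscale z l - rscale w l"
  "rscale z (l - m) = rscale z l - rscale z m"
  by (simp_all add: vec_eq_iff algebra_simps)

lemma rscale_of_real: "rscale z (of_real r) = r *\<^sub>R z"
  by (simp add: vec_eq_iff of_real_def)

lemma mat_vec_rscale: "A *v rscale z l = rscale (A *v z) l" for A :: "quat ^ 'n ^ 'm"
  by (simp add: vec_eq_iff matrix_vector_mult_def sum_distrib_right mult.assoc)

lemma mat_vec_axis: "(A *v axis j c) $ i = A $ i $ j * c" for A :: "quat ^ 'n ^ 'm"
proof -
  have "(\<Sum>k\<in>UNIV. A $ i $ k * (if k = j then c else 0)) = (\<Sum>k\<in>UNIV. if k = j then A $ i $ k * c else 0)"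
    by (rule sum.cong) auto
  then show ?thesis by (simp add: matrix_vector_mult_def axis_def)
qed

lemma mat_eq_iff_vec: "(\<forall>z. A *v z = B *v z) \<longleftrightarrow> A = B" for A B :: "quat ^ 'n ^ 'm"
proof
  assume "\<forall>z. A *v z = B *v z"
  then have "(A *v axis j 1) $ i = (B *v axis j 1) $ i" for i j by simp
  then show "A = B" by (simp add: mat_vec_axis vec_eq_iff)
qed simp

lemma proj_image: "proj w = rscale w ` {l. l \<noteq> 0}"
  by (auto simp: proj_def rscale_def)

lemma mem_proj: "z \<in> proj w \<longleftrightarrow> (\<exists>l. l \<noteq> 0 \<and> z = rscale w l)"
  by (auto simp: proj_def rscale_def)

lemma self_in_proj: "z \<in> proj z"
  by (auto simp: mem_proj intro!: exI[of _ 1])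

lemma proj_rscale: assumes l: "l \<noteq> 0" shows "proj (rscale z l) = proj z"
proof -
  have "m \<in> (*) l ` {m. m \<noteq> 0}" if "m \<noteq> 0" for m
    using that l by (intro image_eqI[of _ _ "inverse l * m"]) (simp_all add: mult.assoc[symmetric])
  with l have "(*) l ` {m. m \<noteq> 0} = {m. m \<noteq> 0}" by auto
  then have "rscale z ` {m. m \<noteq> 0} = rscale z ` (*) l ` {m. m \<noteq> 0}" by simp
  then show ?thesis by (simp add: proj_image image_image)
qed

lemma proj_eq_iff: "proj z = proj w \<longleftrightarrow> (\<exists>l. l \<noteq> 0 \<and> z = rscale w l)"
  by (metis mem_proj proj_rscale self_in_proj)

lemma act_proj: "act A (proj z) = proj (A *v z)"
  by (simp add: act_def proj_image image_image mat_vec_rscale)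

lemma act_mult: "act (A ** B) P = act A (act B P)"
  by (simp add: act_def image_image matrix_vector_mul_assoc)

lemma act_1: "act (mat 1) P = P"
  by (simp add: act_def)

locale frame =
  fixes p q :: "'n::finite"
  assumes pq: "p \<noteq> q"
begin

abbreviation H :: "quat ^ 'n \<Rightarrow> quat ^ 'n \<Rightarrow> quat" where "H \<equiv> herm p q"

text \<open>The Gram matrix of the form is the permutation matrix of \<open>sw\<close> with signs
  \<open>sg\<close>. Written this way, the form is a single sum over all indices, without separate
  treatment of \<open>p\<close> and \<open>q\<close>.\<close>

definition sw :: "'n \<Rightarrow> 'n" where "sw i = (if i = p then q else if i = q then p else i)"

definition sg :: "'n \<Rightarrow> real" where "sg i = (if i = p \<or> i = q then - 1 else 1)"

lemma qp: "q \<noteq> p" using pq by simp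

lemma sw_simps [simp]: "sw p = q" "sw q = p" "i \<noteq> p \<Longrightarrow> i \<noteq> q \<Longrightarrow> sw i = i" "sw (sw i) = i"
  "sw i = p \<longleftrightarrow> i = q" "sw i = q \<longleftrightarrow> i = p"
  using pq by (auto simp: sw_def)

lemma sg_simps [simp]: "sg p = - 1" "sg q = - 1" "i \<noteq> p \<Longrightarrow> i \<noteq> q \<Longrightarrow> sg i = 1"
  "sg (sw i) = sg i" "sg i * sg i = 1" "sg i * (sg i * r) = r" "\<bar>sg i\<bar> = 1"
  by (auto simp: sg_def sw_def)

lemma bij_sw: "bij sw"
  by (rule involuntory_imp_bij) simp

lemma sum_UNIV_split: "sum f UNIV = sum f (UNIV - {p, q}) + f p + f q"
  for f :: "'n \<Rightarrow> 'a::comm_monoid_add"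
proof -
  have "sum f UNIV = sum f (UNIV - {p, q}) + sum f {p, q}"
    by (rule sum.subset_diff) auto
  then show ?thesis using pq by (simp add: add.assoc)
qed

lemma herm_sum: "H z w = (\<Sum>i\<in>UNIV. sg i *\<^sub>R (qcnj (w $ sw i) * z $ i))"
  unfolding herm_def by (subst sum_UNIV_split) (simp add: algebra_simps)

lemma herm_add_left: "H (x + y) w = H x w + H y w"
  and herm_diff_left: "H (x - y) w = H x w - H y w"
  and herm_add_right: "H w (x + y) = H w x + H w y"
  and herm_diff_right: "H w (x - y) = H w x - H w y"
  by (simp_all add: herm_sum algebra_simps sum.distrib sum_subtractf scaleR_right_diff_distrib)

lemma herm_rscale_left: "H (rscale z l) w = H z w * l"
  by (simp add: herm_sum sum_distrib_right mult.assoc)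

lemma herm_rscale_right: "H z (rscale w l) = qcnj l * H z w"
  by (simp add: herm_sum sum_distrib_left mult.assoc)

lemma herm_scaleR [simp]: "H (r *\<^sub>R z) w = r *\<^sub>R H z w" "H z (r *\<^sub>R w) = r *\<^sub>R H z w"
  by (simp_all add: of_real_def herm_rscale_left herm_rscale_right flip: rscale_of_real)

lemma herm_0 [simp]: "H 0 w = 0" "H w 0 = 0"
  by (simp_all add: herm_sum)

lemma herm_cnj: "H w z = qcnj (H z w)"
proof -
  have "H w z = (\<Sum>i\<in>UNIV. sg (sw i) *\<^sub>R (qcnj (z $ sw (sw i)) * w $ sw i))"
    unfolding herm_sum by (rule sum.reindex_bij_betw[OF bij_sw, symmetric])
  then show ?thesis by (simp add: herm_sum qcnj_sum)
qed

lemma norm_herm_commute: "norm (H w z) = norm (H z w)"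
  by (subst herm_cnj) simp

lemma herm_self_real: "H z z = of_real (qRe (H z z))"
  by (rule self_conj_real) (rule herm_cnj[symmetric])

lemma herm_axis_right: "H z (axis j 1) = sg j *\<^sub>R z $ sw j"
proof -
  have "H z (axis j 1) = (\<Sum>i\<in>UNIV. if i = sw j then sg i *\<^sub>R z $ i else 0)"
    unfolding herm_sum by (rule sum.cong) (auto simp: axis_def)
  then show ?thesis by simp
qed

lemma herm_axis_left: "H (axis j 1) z = sg j *\<^sub>R qcnj (z $ sw j)"
  by (subst herm_cnj) (simp add: herm_axis_right)

lemma herm_nondegenerate: "(\<And>w. H z w = 0) \<Longrightarrow> z = 0"
proof -
  assume "\<And>w. H z w = 0"
  then have "sg (sw i) *\<^sub>R z $ i = 0" for i using herm_axis_right[of z "sw i"] by simp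
  moreover have "sg i \<noteq> 0" for i by (simp add: sg_def)
  ultimately show ?thesis by (simp add: vec_eq_iff)
qed

lemma qRe_herm_self:
  "qRe (H z z) = (\<Sum>i\<in>UNIV - {p, q}. (norm (z $ i))\<^sup>2) - 2 * qRe (qcnj (z $ p) * z $ q)"
  by (simp add: herm_def qRe_sum qcnj_mult_self del: of_real_power)

text \<open>This is J A^* J with J the Gram matrix, hence the inverse of A if A preserves the form.
  The entries of an inverse are thus explicit conjugated entries of A.\<close>

definition adj :: "quat ^ 'n ^ 'n \<Rightarrow> quat ^ 'n ^ 'n" where
  "adj A = (\<chi> i j. (sg i * sg j) *\<^sub>R qcnj (A $ sw j $ sw i))"

lemma adj_nth: "adj A $ i $ j = (sg i * sg j) *\<^sub>R qcnj (A $ sw j $ sw i)"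
  by (simp add: adj_def)

lemma herm_adj: "H (A *v z) w = H z (adj A *v w)"
proof -
  have "H (A *v z) w = (\<Sum>i\<in>UNIV. \<Sum>j\<in>UNIV. sg i *\<^sub>R (qcnj (w $ sw i) * (A $ i $ j * z $ j)))"
    by (simp add: herm_sum matrix_vector_mult_def sum_distrib_left scaleR_sum_right)
  also have "\<dots> = (\<Sum>j\<in>UNIV. \<Sum>i\<in>UNIV. sg i *\<^sub>R (qcnj (w $ sw i) * (A $ i $ j * z $ j)))"
    by (rule sum.swap)
  also have "\<dots> = (\<Sum>j\<in>UNIV. \<Sum>i\<in>UNIV. sg i *\<^sub>R (qcnj (w $ i) * (A $ sw i $ j * z $ j)))"
    by (rule sum.cong[OF refl], subst sum.reindex_bij_betw[OF bij_sw, symmetric]) simp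
  also have "\<dots> = H z (adj A *v w)"
    by (simp add: herm_sum matrix_vector_mult_def sum_distrib_right scaleR_sum_right qcnj_sum
        adj_nth mult.assoc)
  finally show ?thesis .
qed

lemma adj_mult_iff: "(\<forall>z w. H (A *v z) (A *v w) = H z w) \<longleftrightarrow> adj A ** A = mat 1"
proof
  assume *: "\<forall>z w. H (A *v z) (A *v w) = H z w"
  have "adj A *v (A *v w) - w = 0" for w
  proof (rule herm_nondegenerate)
    fix z
    have "H z (adj A *v (A *v w) - w) = 0" using * by (simp add: herm_diff_right flip: herm_adj)
    then show "H (adj A *v (A *v w) - w) z = 0" by (subst herm_cnj) simp
  qed
  then have "\<forall>w. (adj A ** A) *v w = mat 1 *v w" by (simp flip: matrix_vector_mul_assoc)
  then show "adj A ** A = mat 1" by (simp only: mat_eq_iff_vec)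
qed (simp add: herm_adj matrix_vector_mul_assoc)

section \<open>The group Sp(n, 1)\<close>

abbreviation S :: "(quat ^ 'n ^ 'n) monoid" where "S \<equiv> Sp p q"

lemma SpI:
  assumes "\<And>z w. H (A *v z) (A *v w) = H z w" "A ** B = mat 1"
  shows "A \<in> carrier S"
proof -
  have "adj A ** A = mat 1" using assms(1) adj_mult_iff by blast
  then have "adj A = B" using assms(2) by (metis matrix_mul_assoc matrix_mul_lid matrix_mul_rid)
  with assms \<open>adj A ** A = mat 1\<close> show ?thesis by (auto simp: Sp_def invertible_def)
qed

lemma Sp_herm: "A \<in> carrier S \<Longrightarrow> H (A *v z) (A *v w) = H z w"
  by (simp add: Sp_def)

lemma Sp_adj: assumes "A \<in> carrier S" shows "adj A ** A = mat 1" "A ** adj A = mat 1"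
proof -
  show 1: "adj A ** A = mat 1" using assms adj_mult_iff by (auto simp: Sp_def)
  obtain B where "A ** B = mat 1" using assms by (auto simp: Sp_def invertible_def)
  with 1 have "adj A = B" by (metis matrix_mul_assoc matrix_mul_lid matrix_mul_rid)
  with \<open>A ** B = mat 1\<close> show "A ** adj A = mat 1" by simp
qed

lemma Sp_adj_vec: assumes "A \<in> carrier S" shows "adj A *v (A *v z) = z" "A *v (adj A *v z) = z"
  using Sp_adj[OF assms] by (simp_all add: matrix_vector_mul_assoc)

lemma adj_Sp: assumes A: "A \<in> carrier S" shows "adj A \<in> carrier S"
proof (rule SpI[where B = A])
  show "H (adj A *v z) (adj A *v w) = H z w" for z w
    using Sp_herm[OF A, of "adj A *v z" "adj A *v w"] by (simp add: Sp_adj_vec[OF A])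
qed (rule Sp_adj[OF A])

lemma adj_adj [simp]: "adj (adj A) = A"
proof -
  have "sg i * sg j * (sg j * sg i) = 1" for i j by (simp add: sg_def)
  then show ?thesis by (simp add: adj_def vec_eq_iff)
qed

lemma Sp_mult: "A \<in> carrier S \<Longrightarrow> B \<in> carrier S \<Longrightarrow> A ** B \<in> carrier S"
proof (rule SpI[where B = "adj B ** adj A"])
  assume A: "A \<in> carrier S" and B: "B \<in> carrier S"
  show "H ((A ** B) *v z) ((A ** B) *v w) = H z w" for z w
    using A B by (simp add: Sp_herm flip: matrix_vector_mul_assoc)
  have "A ** B ** (adj B ** adj A) = A ** (B ** adj B) ** adj A"
    by (simp only: matrix_mul_assoc)
  then show "A ** B ** (adj B ** adj A) = mat 1" using A B by (simp add: Sp_adj)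
qed

lemma Sp_one: "mat 1 \<in> carrier S"
  by (rule SpI[where B = "mat 1"]) simp_all

lemma mult_Sp: "A \<otimes>\<^bsub>S\<^esub> B = A ** B" and one_Sp: "\<one>\<^bsub>S\<^esub> = mat 1"
  by (simp_all add: Sp_def)

lemma group_Sp: "group S"
proof (rule groupI)
  fix A assume "A \<in> carrier S"
  then show "\<exists>B\<in>carrier S. B \<otimes>\<^bsub>S\<^esub> A = \<one>\<^bsub>S\<^esub>"
    by (intro bexI[of _ "adj A"] adj_Sp) (simp_all add: Sp_adj mult_Sp one_Sp)
qed (simp_all add: Sp_mult Sp_one mult_Sp one_Sp matrix_mul_assoc)

lemma inv_Sp: "A \<in> carrier S \<Longrightarrow> inv\<^bsub>S\<^esub> A = adj A"
  by (rule group.inv_equality[OF group_Sp]) (simp_all add: adj_Sp Sp_adj mult_Sp one_Sp)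

end

section \<open>The Bergman metric\<close>

context frame
begin

lemma qRe_herm_diff_rscale:
  "qRe (H (x - rscale y l) (x - rscale y l)) =
     qRe (H x x) - 2 * qRe (qcnj l * H x y) + (norm l)\<^sup>2 * qRe (H y y)"
proof -
  have "H (x - rscale y l) (x - rscale y l) =
      H x x - qcnj l * H x y - H y x * l + qcnj l * H y y * l"
    by (simp add: herm_diff_left herm_diff_right herm_rscale_left herm_rscale_right algebra_simps)
  moreover have "qRe (H y x * l) = qRe (qcnj l * H x y)"
    by (subst herm_cnj) (simp add: algebra_simps)
  moreover have "qcnj l * H y y * l = of_real (qRe (H y y) * (norm l)\<^sup>2)"
    by (subst herm_self_real)
      (metis (no_types) mult.assoc of_real_mult of_real_quat_commute qcnj_mult_self)
  ultimately show ?thesis by (simp add: mult.commute del: of_real_mult quat_times_simps)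
qed

text \<open>The condition says that v is orthogonal to the negative vector e_p + e_q. On this
  hyperplane the mixed term contributes twice the square of |v_p| with a positive sign.\<close>

lemma qRe_herm_nonneg: "v $ p + v $ q = 0 \<Longrightarrow> qRe (H v v) \<ge> 0"
proof -
  assume "v $ p + v $ q = 0"
  then have "v $ q = - v $ p" by (simp add: add_eq_0_iff)
  then show ?thesis
    by (simp add: qRe_herm_self qcnj_mult_self sum_nonneg del: of_real_power quat_times_simps)
qed

text \<open>Subtract a multiple of y from x to reach the hyperplane of
  \<open>qRe_herm_nonneg\<close>; nonnegativity there, together with |l| and |H x y| compared by a
  square, gives the bound.\<close>

lemma reverse_Cauchy_Schwarz:
  assumes y: "H y y = - 1"
  shows "qRe (H x x) + (norm (H x y))\<^sup>2 \<ge> 0"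
proof -
  have nz: "y $ p + y $ q \<noteq> 0" using qRe_herm_nonneg[of y] y by auto
  \<comment> \<open>Solves (x - y l)_p + (x - y l)_q = 0; the division is possible because the
    negative vector y is not in that hyperplane.\<close>
  define l where "l = inverse (y $ p + y $ q) * (x $ p + x $ q)"
  have "(y $ p + y $ q) * l = x $ p + x $ q"
    using nz by (simp add: l_def mult.assoc[symmetric])
  then have "(x - rscale y l) $ p + (x - rscale y l) $ q = 0"
    by (simp add: algebra_simps)
  from qRe_herm_nonneg[OF this] have "0 \<le> qRe (H x x) - 2 * qRe (qcnj l * H x y) - (norm l)\<^sup>2"
    using qRe_herm_diff_rscale[of x y l] y
    by (simp del: quat_times_simps(5))
  moreover have "\<bar>qRe (qcnj l * H x y)\<bar> \<le> norm l * norm (H x y)"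
    using qRe_le_norm[of "qcnj l * H x y"] by (simp add: norm_mult)
  moreover have "0 \<le> (norm l - norm (H x y))\<^sup>2" by simp
  ultimately show ?thesis by (simp add: power2_diff del: quat_times_simps)
qed

text \<open>By \<open>reverse_Cauchy_Schwarz\<close> the form is nonnegative on the orthogonal
  complement of y. The usual discriminant argument works there, with real t along the direction k =
  H x z.\<close>

lemma Cauchy_Schwarz_orthogonal:
  assumes y: "H y y = - 1" and "H x y = 0" "H z y = 0"
  shows "(norm (H x z))\<^sup>2 \<le> qRe (H x x) * qRe (H z z)"
proof -
  define k where "k = H x z"
  let ?A = "qRe (H x x)" and ?B = "qRe (H z z)" and ?K = "(norm k)\<^sup>2"
  have nn: "qRe (H v v) \<ge> 0" if "H v y = 0" for v
    using reverse_Cauchy_Schwarz[OF y, of v] that by simp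
  have *: "0 \<le> ?A - 2 * (t * ?K) + t\<^sup>2 * ?K * ?B" for t
  proof -
    have "H (x - rscale z (t *\<^sub>R k)) y = 0"
      using assms by (simp add: herm_diff_left herm_rscale_left)
    note nn[OF this]
    moreover have "qRe (qcnj (t *\<^sub>R k) * k) = t * ?K"
      by (simp add: qcnj_mult_self del: of_real_power quat_times_simps(5))
    ultimately show ?thesis
      by (simp add: qRe_herm_diff_rscale power_mult_distrib flip: k_def
          del: quat_times_simps(5) qcnj_scaleR)
  qed
  have B: "?B \<ge> 0" using nn assms by blast
  show ?thesis
  proof (cases "?B = 0")
    \<comment> \<open>A function linear in t and bounded below has slope zero; the chosen t would
      give the value - 1.\<close>
    case True
    have "?K \<le> 0"
    proof (rule ccontr)
      assume "\<not> ?K \<le> 0"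
      with *[of "(?A + 1) / (2 * ?K)"] True show False by (simp add: field_simps)
    qed
    with True show ?thesis by (simp add: k_def)
  next
    case False
    with B *[of "1 / ?B"] show ?thesis by (simp add: field_simps power2_eq_square k_def)
  qed
qed

text \<open>This is cosh (a + b) = cosh a cosh b + sinh a sinh b in disguise. \<open>P\<close>
  projects orthogonally to y; the y-components give the product of the norms, and the projections
  have squared lengths |H v y|^2 - 1, the squares of the sinh terms.\<close>

lemma herm_triangle:
  assumes x: "H x x = - 1" and y: "H y y = - 1" and z: "H z z = - 1"
  shows "norm (H x z) \<le> norm (H x y) * norm (H y z) +
    sqrt ((norm (H x y))\<^sup>2 - 1) * sqrt ((norm (H y z))\<^sup>2 - 1)"
proof -
  define P where "P v = v + rscale y (H v y)" for v
  have perp: "H (P v) y = 0" for v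
    by (simp add: P_def herm_add_left herm_rscale_left y)
  then have perp': "H y (P v) = 0" for v
    by (subst herm_cnj) simp
  have PP: "H (P v) (P w) = H v w + qcnj (H w y) * H v y" for v w
  proof -
    have "H (P v) (P w) = H v (P w)"
      by (subst P_def) (simp add: herm_add_left herm_rscale_left perp')
    also have "\<dots> = H v w + qcnj (H w y) * H v y"
      by (simp add: P_def herm_add_right herm_rscale_right)
    finally show ?thesis .
  qed
  have n: "qRe (H (P v) (P v)) = (norm (H v y))\<^sup>2 - 1" if "H v v = - 1" for v
    using that by (simp add: PP qcnj_mult_self del: of_real_power)
  have "norm (H (P x) (P z)) \<le> sqrt (qRe (H (P x) (P x)) * qRe (H (P z) (P z)))"
    using Cauchy_Schwarz_orthogonal[OF y perp perp] real_le_rsqrt by blast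
  also have "\<dots> = sqrt ((norm (H x y))\<^sup>2 - 1) * sqrt ((norm (H y z))\<^sup>2 - 1)"
    by (simp add: n x z real_sqrt_mult norm_herm_commute[of z y])
  finally have "norm (H (P x) (P z)) \<le> \<dots>" .
  moreover have "H x z = H (P x) (P z) - qcnj (H z y) * H x y" by (simp add: PP)
  then have "norm (H x z) \<le> norm (H (P x) (P z)) + norm (H x y) * norm (H y z)"
    using norm_triangle_ineq4[of "H (P x) (P z)" "qcnj (H z y) * H x y"]
    by (simp add: norm_mult norm_herm_commute[of z y] mult.commute)
  ultimately show ?thesis by linarith
qed

lemma norm_herm_ge_1: "H x x = - 1 \<Longrightarrow> H y y = - 1 \<Longrightarrow> norm (H x y) \<ge> 1"
  using reverse_Cauchy_Schwarz[of y x] power2_le_imp_le[of 1 "norm (H x y)"] by simp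

text \<open>Shows that the description in \<open>rho\<close> denotes: rescaling the lifts multiplies
  numerator and denominator by the same real number, and cosh is injective on nonnegative
  arguments.\<close>

lemma rho_proj:
  assumes z: "H z z = - 1" and w: "H w w = - 1"
  shows "rho p q (proj z) (proj w) \<ge> 0" "cosh (rho p q (proj z) (proj w) / 2) = norm (H z w)"
proof -
  have quot: "(H z' w' * H w' z') / (H z' z' * H w' w') = of_real ((norm (H z w))\<^sup>2)"
    if "z' \<in> proj z" "w' \<in> proj w" for z' w'
  proof -
    obtain l m where lm: "l \<noteq> 0" "m \<noteq> 0" "z' = rscale z l" "w' = rscale w m"
      using \<open>z' \<in> _\<close> \<open>w' \<in> _\<close> by (auto simp: mem_proj)
    have "H w' z' = qcnj (H z' w')" by (rule herm_cnj)
    then have "H z' w' * H w' z' = of_real ((norm m * norm (H z w) * norm l)\<^sup>2)"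
      by (simp only: mult_qcnj) (simp add: lm herm_rscale_left herm_rscale_right norm_mult mult.assoc)
    moreover have "H z' z' * H w' w' = of_real ((norm l)\<^sup>2 * (norm m)\<^sup>2)"
      by (simp add: lm herm_rscale_left herm_rscale_right z w qcnj_mult_self del: of_real_power)
    ultimately show ?thesis
      using lm by (simp add: power_mult_distrib mult.assoc field_simps
          del: of_real_power of_real_mult flip: of_real_divide)
  qed
  define d where "d = 2 * arcosh (norm (H z w))"
  have n1: "norm (H z w) \<ge> 1" using norm_herm_ge_1[OF z w] .
  then have d: "d \<ge> 0" "cosh (d / 2) = norm (H z w)"
    by (simp_all add: d_def arcosh_nonneg_real)
  have "rho p q (proj z) (proj w) = d"
    unfolding rho_def
  proof (rule the_equality)
    show "d \<ge> 0 \<and> (\<forall>z'\<in>proj z. \<forall>w'\<in>proj w. of_real ((cosh (d / 2))\<^sup>2) =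
        (H z' w' * H w' z') / (H z' z' * H w' w'))"
      using d quot by simp
    fix e :: real
    assume e: "e \<ge> 0 \<and> (\<forall>z'\<in>proj z. \<forall>w'\<in>proj w. of_real ((cosh (e / 2))\<^sup>2) =
        (H z' w' * H w' z') / (H z' z' * H w' w'))"
    then have "(of_real ((cosh (e / 2))\<^sup>2) :: quat) = of_real ((norm (H z w))\<^sup>2)"
      using quot self_in_proj by metis
    then have "cosh (e / 2) = cosh (d / 2)"
      unfolding of_real_eq_iff d by (simp add: power2_eq_iff_nonneg)
    then have "\<bar>e / 2\<bar> = \<bar>d / 2\<bar>" by (simp only: cosh_real_eq_iff)
    with e d show "e = d" by simp
  qed
  with d show "rho p q (proj z) (proj w) \<ge> 0" "cosh (rho p q (proj z) (proj w) / 2) = norm (H z w)"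
    by simp_all
qed

lemma hyp_unit_lift: assumes "P \<in> hyp p q" obtains z where "H z z = - 1" "P = proj z"
proof -
  obtain z where z: "P = proj z" "qRe (H z z) < 0" using assms by (auto simp: hyp_def V_neg_def)
  define t where "t = 1 / sqrt (- qRe (H z z))"
  have t: "t * t * qRe (H z z) = - 1" "t \<noteq> 0"
    using z by (simp_all add: t_def field_simps)
  have "H (t *\<^sub>R z) (t *\<^sub>R z) = of_real (t * t * qRe (H z z))"
    by (subst of_real_mult, subst herm_self_real[symmetric]) (simp add: of_real_def)
  then have "H (t *\<^sub>R z) (t *\<^sub>R z) = - 1" using t by simp
  moreover have "P = proj (t *\<^sub>R z)"
    using t z proj_rscale[of "of_real t" z] by (simp add: rscale_of_real)
  ultimately show thesis using that by blast
qed

lemma proj_in_hyp: "qRe (H z z) < 0 \<Longrightarrow> proj z \<in> hyp p q"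
  by (auto simp: hyp_def V_neg_def)

lemma rho_nonneg: "P \<in> hyp p q \<Longrightarrow> Q \<in> hyp p q \<Longrightarrow> rho p q P Q \<ge> 0"
  by (metis hyp_unit_lift rho_proj(1))

lemma rho_triangle:
  assumes "P \<in> hyp p q" "Q \<in> hyp p q" "R \<in> hyp p q"
  shows "rho p q P R \<le> rho p q P Q + rho p q Q R"
proof -
  obtain x y z where x: "H x x = - 1" "P = proj x" and y: "H y y = - 1" "Q = proj y"
    and z: "H z z = - 1" "R = proj z"
    using assms hyp_unit_lift by metis
  let ?a = "rho p q P Q / 2" and ?b = "rho p q Q R / 2" and ?c = "rho p q P R / 2"
  have nn: "?a \<ge> 0" "?b \<ge> 0" "?c \<ge> 0" using assms by (simp_all add: rho_nonneg)
  have sinh: "sinh t = sqrt ((cosh t)\<^sup>2 - 1)" if "t \<ge> 0" for t :: real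
    using that by (simp add: cosh_square_eq)
  have "cosh ?c \<le> cosh ?a * cosh ?b + sinh ?a * sinh ?b"
    using herm_triangle[OF x(1) y(1) z(1)] nn x y z by (simp add: sinh rho_proj(2))
  then have "cosh ?c \<le> cosh (?a + ?b)" by (simp only: cosh_add)
  then show ?thesis using nn by (subst (asm) cosh_real_nonneg_le_iff) (auto simp: field_simps)
qed

lemma Sp_hyp: "A \<in> carrier S \<Longrightarrow> P \<in> hyp p q \<Longrightarrow> act A P \<in> hyp p q"
  by (auto simp: hyp_def V_neg_def act_proj Sp_herm)

lemma rho_act:
  assumes A: "A \<in> carrier S" and "P \<in> hyp p q" "Q \<in> hyp p q"
  shows "rho p q (act A P) (act A Q) = rho p q P Q"
proof -
  obtain x y where x: "H x x = - 1" "P = proj x" and y: "H y y = - 1" "Q = proj y"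
    using assms hyp_unit_lift by metis
  have "cosh (rho p q (act A P) (act A Q) / 2) = cosh (rho p q P Q / 2)"
    using x y by (simp add: act_proj rho_proj Sp_herm[OF A])
  moreover have "rho p q (act A P) (act A Q) \<ge> 0" "rho p q P Q \<ge> 0"
    using assms by (simp_all add: rho_nonneg Sp_hyp)
  ultimately show ?thesis by (simp add: cosh_real_eq_iff)
qed

end

section \<open>Diagonalisation of loxodromic elements\<close>

lemma rscale_axis: "rscale (axis i c) l = axis i (c * l)"
  by (simp add: vec_eq_iff axis_def)

lemma axis_eq_rscale: "axis i c = rscale (axis i 1) c"
  by (simp add: rscale_axis)

lemma mat_vec_via_rscale: "c \<noteq> 0 \<Longrightarrow> A *v z = rscale (A *v rscale z (inverse c)) c"
  for A :: "quat ^ 'n ^ 'm"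
  by (simp flip: mat_vec_rscale)

lemma vec_eq_sum_axis: "z = (\<Sum>j\<in>UNIV. rscale (axis j 1) (z $ j))"
proof -
  have "(\<Sum>j\<in>UNIV. (if i = j then 1 else 0) * z $ j) = z $ i" for i
    by (subst sum.cong[OF refl, of _ _ "\<lambda>j. if i = j then z $ j else 0"]) auto
  then show ?thesis by (simp add: vec_eq_iff axis_def)
qed

lemma right_linear_matrix:
  fixes f :: "quat ^ 'n \<Rightarrow> quat ^ 'n::finite"
  assumes add: "\<And>x y. f (x + y) = f x + f y" and scale: "\<And>z l. f (rscale z l) = rscale (f z) l"
  obtains A where "\<And>z. A *v z = f z"
proof
  fix z
  interpret additive f by standard (rule add)
  have "f z = (\<Sum>j\<in>UNIV. rscale (f (axis j 1)) (z $ j))"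
    by (subst vec_eq_sum_axis[of z]) (simp add: sum scale)
  then show "(\<chi> i j. f (axis j 1) $ i) *v z = f z"
    by (simp add: vec_eq_iff matrix_vector_mult_def)
qed

lemma linear_mat_vec: "linear ((*v) A)" for A :: "quat ^ 'n ^ 'm"
  by (rule linearI) (simp_all add: matrix_vector_right_distrib mat_vec_rscale flip: rscale_of_real)

text \<open>The first-order condition at a minimum, in the form needed for the maximiser in
  \<open>exists_eigenvector\<close>.\<close>

lemma nonneg_quadratic_linear_coeff:
  fixes a b :: real
  assumes "\<And>e. 0 \<le> e * a + e\<^sup>2 * b"
  shows "a = 0"
proof (rule ccontr)
  assume a: "a \<noteq> 0"
  \<comment> \<open>Since k is positive and exceeds b, the value at e = - a / k is the square of a /
    k times the negative number b - k.\<close>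
  define k where "k = \<bar>b\<bar> + 1"
  have k: "k > 0" "b < k" by (simp_all add: k_def)
  have "0 \<le> (- a / k) * a + (- a / k)\<^sup>2 * b" by (rule assms)
  also have "\<dots> = (a / k)\<^sup>2 * (b - k)" using k by (simp add: field_simps power2_eq_square)
  finally show False using a k by (simp add: zero_le_mult_iff)
qed

context frame
begin

text \<open>The form supplies the left inverse \<open>adj A\<close>. Hence A is injective, and as a
  real linear map in finite dimension also surjective, which makes the left inverse
  two-sided.\<close>

lemma preserving_imp_Sp:
  assumes *: "\<And>z w. H (A *v z) (A *v w) = H z w"
  shows "A \<in> carrier S"
proof -
  have 1: "adj A ** A = mat 1" using * adj_mult_iff by blast
  have "inj ((*v) A)"
    by (rule inj_on_inverseI[of _ "(*v) (adj A)"]) (simp add: 1 matrix_vector_mul_assoc)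
  then have surj: "surj ((*v) A)" using linear_injective_imp_surjective linear_mat_vec by blast
  have "A *v (adj A *v z) = z" for z
  proof -
    obtain y where y: "z = A *v y" using surj by blast
    have "adj A *v (A *v y) = y" by (simp add: 1 matrix_vector_mul_assoc)
    with y show ?thesis by simp
  qed
  then have "A ** adj A = mat 1"
    by (simp add: matrix_vector_mul_assoc flip: mat_eq_iff_vec)
  with * show ?thesis by (rule SpI)
qed

lemma right_linear_Sp:
  assumes "\<And>x y. f (x + y) = f x + f y" "\<And>z l. f (rscale z l) = rscale (f z) l"
    and "\<And>z w. H (f z) (f w) = H z w"
  obtains A where "A \<in> carrier S" "\<And>z. A *v z = f z"
  using right_linear_matrix[of f] preserving_imp_Sp assms by metis

text \<open>The reflection in v = x - y sends x to y only if H x v is half of H v v. This is where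
  the pairing of x and y must be real, a condition absent over the reals; callers first rescale x to
  achieve it. The inequality says that v is not null.\<close>

lemma reflection:
  assumes xx: "H x x = H y y" and real: "qcnj (H x y) = H x y" and nz: "H x x \<noteq> H x y"
  obtains R where "R \<in> carrier S" "R *v x = y" "\<And>z. H z (x - y) = 0 \<Longrightarrow> R *v z = z"
proof -
  define v where "v = x - y"
  define N where "N = qRe (H v v)"
  have yx: "H y x = H x y" using herm_cnj[of y x] real by simp
  have vv: "H v v = 2 *\<^sub>R (H x x - H x y)"
    by (simp add: v_def herm_diff_left herm_diff_right yx xx scaleR_2)
  have vN: "H v v = of_real N" unfolding N_def by (rule herm_self_real)
  with vv nz have N: "N \<noteq> 0" by auto
  define f where "f z = z - rscale v ((2 / N) *\<^sub>R H z v)" for z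
  have vzN: "qcnj l * H v v * m = N *\<^sub>R (qcnj l * m)" for l m
    by (simp add: vN of_real_def)
  have "H (f z) (f w) = H z w" for z w
  proof -
    have "H (f z) (f w) = H z w - (2 / N) *\<^sub>R (qcnj (H w v) * H z v)
        - (2 / N) *\<^sub>R (H v w * H z v) + (2 / N) *\<^sub>R (2 / N) *\<^sub>R (qcnj (H w v) * H v v * H z v)"
      by (simp add: f_def herm_diff_left herm_diff_right herm_rscale_left herm_rscale_right
          algebra_simps)
    also have "qcnj (H w v) = H v w" by (simp flip: herm_cnj)
    finally have "H (f z) (f w) = H z w - (2 / N) *\<^sub>R (H v w * H z v)
        - (2 / N) *\<^sub>R (H v w * H z v) + (4 / N) *\<^sub>R (H v w * H z v)"
      using vzN[of "qcnj (H v w)" "H z v"] N by simp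
    moreover have "(4 / N) *\<^sub>R X = (2 / N) *\<^sub>R X + (2 / N) *\<^sub>R X" for X :: quat
      by (simp flip: scaleR_left_distrib)
    ultimately show ?thesis by simp
  qed
  moreover have "f (z + w) = f z + f w" for z w
    by (simp add: f_def herm_add_left rscale_add scaleR_right_distrib)
  moreover have "f (rscale z l) = rscale (f z) l" for z l
    by (simp add: f_def herm_rscale_left rscale_add)
  ultimately obtain R where R: "R \<in> carrier S" "\<And>z. R *v z = f z"
    using right_linear_Sp[of f] by blast
  have "H x v = H x x - H x y" by (simp add: v_def herm_diff_right)
  then have "2 *\<^sub>R H x v = of_real N" using vv vN by simp
  then have "(2 / N) *\<^sub>R H x v = 1" using N
    by (metis divide_inverse mult.commute of_real_def scaleR_scaleR left_inverse scaleR_one)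
  then have "R *v x = y" by (simp add: R f_def v_def)
  moreover have "R *v z = z" if "H z (x - y) = 0" for z
    using that by (simp add: R f_def v_def)
  ultimately show thesis using R that by blast
qed

section \<open>Null vectors and pairs of boundary points\<close>

lemma null_vanishing:
  assumes "H z z = 0" "z $ p = 0 \<or> z $ q = 0" "i \<noteq> p" "i \<noteq> q"
  shows "z $ i = 0"
proof -
  have "qRe (qcnj (z $ p) * z $ q) = 0" using assms(2) by auto
  then have "(\<Sum>i\<in>UNIV - {p, q}. (norm (z $ i))\<^sup>2) = 0"
    using qRe_herm_self[of z] assms(1) by simp
  then have "\<forall>i\<in>UNIV - {p, q}. (norm (z $ i))\<^sup>2 = 0"
    by (subst (asm) sum_nonneg_eq_0_iff) auto
  with assms show ?thesis by simp
qed

lemma null_axis: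
  assumes "H z z = 0"
  shows "z $ q = 0 \<Longrightarrow> z = axis p (z $ p)" "z $ p = 0 \<Longrightarrow> z = axis q (z $ q)"
proof -
  show "z = axis p (z $ p)" if "z $ q = 0"
    unfolding vec_eq_iff
  proof
    fix i show "z $ i = axis p (z $ p) $ i"
      using null_vanishing[OF assms, of i] that by (cases "i = p"; cases "i = q") (simp_all add: axis_def)
  qed
  show "z = axis q (z $ q)" if "z $ p = 0"
    unfolding vec_eq_iff
  proof
    fix i show "z $ i = axis q (z $ q) $ i"
      using null_vanishing[OF assms, of i] that by (cases "i = p"; cases "i = q") (simp_all add: axis_def)
  qed
qed

lemma herm_basis: "H (axis p 1) (axis p 1) = 0" "H (axis q 1) (axis q 1) = 0"
  "H (axis p 1) (axis q 1) = - 1" "H (axis q 1) (axis p 1) = - 1"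
  using pq qp by (simp_all add: herm_axis_right) (simp_all add: axis_def)

lemma Sp_inj: "A \<in> carrier S \<Longrightarrow> A *v z = A *v w \<longleftrightarrow> z = w"
  by (metis Sp_adj_vec(1))

lemma null_to_p:
  assumes u: "H u u = 0" "u \<noteq> 0"
  obtains A c where "A \<in> carrier S" "c \<noteq> 0" "A *v u = axis p c"
proof (cases "u $ q = 0")
  case True
  then have "u = axis p (u $ p)" using null_axis u by blast
  with u that[OF Sp_one] show thesis by (metis axis_eq_0_iff matrix_vector_mul_lid)
next
  case False
  \<comment> \<open>Makes the q-coordinate of u k equal to the real number |u_q|, so that its
    pairing with e_p is real and \<open>reflection\<close> applies.\<close>
  define k where "k = norm (u $ q) *\<^sub>R inverse (u $ q)"
  have k: "k \<noteq> 0" "u $ q * k = of_real (norm (u $ q))"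
    using False by (simp_all add: k_def of_real_def)
  have e: "H (rscale u k) (axis p 1) = - of_real (norm (u $ q))"
    by (simp add: herm_axis_right k)
  obtain R where R: "R \<in> carrier S" "R *v rscale u k = axis p 1"
  proof (rule reflection)
    show "H (rscale u k) (rscale u k) = H (axis p 1) (axis p 1)"
      by (simp add: herm_rscale_left herm_rscale_right u herm_basis)
    show "qcnj (H (rscale u k) (axis p 1)) = H (rscale u k) (axis p 1)" by (simp add: e)
    show "H (rscale u k) (rscale u k) \<noteq> H (rscale u k) (axis p 1)"
      using False by (simp add: herm_rscale_left herm_rscale_right u herm_axis_right k(1))
  qed blast
  have "R *v u = rscale (R *v rscale u k) (inverse k)" using k by (simp flip: mat_vec_rscale)
  also have "\<dots> = axis p (inverse k)" by (simp add: R rscale_axis)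
  finally show thesis using that R k by (metis nonzero_imp_inverse_nonzero)
qed

text \<open>The inverse of the map constructed here is the Heisenberg translation taking \<open>e\<^sub>q\<close> to \<open>w\<close>.\<close>

lemma fix_p_move_to_q:
  assumes w: "H w w = 0" "w $ q = 1"
  obtains A where "A \<in> carrier S" "A *v axis p 1 = axis p 1" "A *v w = axis q 1"
proof -
  let ?E = "axis p 1" and ?F = "axis q 1"
  define d where "d = w - ?F"
  define f where "f z = z + rscale d (z $ q) + rscale ?E (H z d + qcnj (w $ p) * z $ q)" for z
  have E: "H z ?E = - z $ q" "H ?E z = - qcnj (z $ q)" for z
    by (simp_all add: herm_axis_right herm_axis_left)
  have dq: "d $ q = 0" using w by (simp add: d_def axis_def)
  have dd: "H d d = w $ p + qcnj (w $ p)"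
    by (simp add: d_def herm_diff_left herm_diff_right w herm_axis_right herm_axis_left)
      (simp add: axis_def pq qp)
  have "H (f z) (f z') = H z z'" for z z'
  proof -
    have dz: "H d z' = qcnj (H z' d)" by (rule herm_cnj)
    show ?thesis
      by (simp add: f_def herm_add_left herm_add_right herm_rscale_left herm_rscale_right E dq dd dz)
        (simp add: algebra_simps axis_def pq qp)
  qed
  moreover have "f (x + y) = f x + f y" for x y
    by (simp add: f_def herm_add_left rscale_add algebra_simps)
  moreover have "f (rscale z l) = rscale (f z) l" for z l
    by (simp add: f_def herm_rscale_left rscale_add algebra_simps)
  ultimately obtain T where T: "T \<in> carrier S" "\<And>z. T *v z = f z"
    using right_linear_Sp[of f] by blast
  have "T *v ?E = ?E" using pq by (simp add: T f_def E dq) (simp add: axis_def)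
  moreover have "T *v ?F = w"
  proof -
    have "H ?F d = - qcnj (w $ p)" by (simp add: herm_axis_left d_def) (simp add: axis_def pq)
    then show ?thesis by (simp add: T f_def) (simp add: axis_def d_def)
  qed
  ultimately have "adj T *v ?E = ?E" "adj T *v w = ?F"
    using Sp_adj_vec(1)[OF T(1), of ?E] Sp_adj_vec(1)[OF T(1), of ?F] by simp_all
  with adj_Sp[OF T(1)] that show thesis by blast
qed

text \<open>After u is moved to the line of e_p, the image of v has nonzero q-coordinate, because a
  null vector with vanishing q-coordinate lies on the line of e_p. Scaled to q-coordinate 1, it is
  moved to e_q by a map that keeps e_p.\<close>

lemma null_pair_normal_form:
  assumes u: "H u u = 0" "u \<noteq> 0" and v: "H v v = 0" "v \<noteq> 0" and uv: "proj u \<noteq> proj v"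
  obtains A c d where "A \<in> carrier S" "c \<noteq> 0" "d \<noteq> 0" "A *v u = axis p c" "A *v v = axis q d"
proof -
  obtain A c where A: "A \<in> carrier S" "c \<noteq> 0" "A *v u = axis p c" using null_to_p[OF u] .
  let ?v = "A *v v"
  have vv: "H ?v ?v = 0" using A v by (simp add: Sp_herm)
  have q: "?v $ q \<noteq> 0"
  proof
    assume "?v $ q = 0"
    then obtain a where a: "?v = axis p a" using null_axis(1)[OF vv] by blast
    have "?v \<noteq> 0" using Sp_inj[OF A(1), of v 0] v by simp
    with a have "a \<noteq> 0" by (auto simp: axis_eq_0_iff)
    have "A *v rscale u (inverse c * a) = ?v"
      using A(2) by (simp add: a mat_vec_rscale A(3) rscale_axis mult.assoc[symmetric])
    then have "v = rscale u (inverse c * a)" by (simp add: Sp_inj[OF A(1)])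
    then have "proj v = proj u"
      using A(2) \<open>a \<noteq> 0\<close> by (simp add: proj_rscale)
    with uv show False by simp
  qed
  have "H (rscale ?v (inverse (?v $ q))) (rscale ?v (inverse (?v $ q))) = 0"
    by (simp add: herm_rscale_left herm_rscale_right vv)
  moreover have "rscale ?v (inverse (?v $ q)) $ q = 1" using q by simp
  ultimately obtain B where B: "B \<in> carrier S" "B *v axis p 1 = axis p 1"
      "B *v rscale ?v (inverse (?v $ q)) = axis q 1"
    by (rule fix_p_move_to_q)
  have BA: "(B ** A) *v z = B *v (A *v z)" for z by (simp add: matrix_vector_mul_assoc)
  have "(B ** A) *v u = B *v rscale (axis p 1) c" by (simp add: BA A(3) rscale_axis)
  also have "\<dots> = axis p c" by (simp add: mat_vec_rscale B(2)) (simp add: rscale_axis)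
  finally have u': "(B ** A) *v u = axis p c" .
  have "(B ** A) *v v = rscale (B *v rscale ?v (inverse (?v $ q))) (?v $ q)"
    unfolding BA using q by (rule mat_vec_via_rscale)
  then have "(B ** A) *v v = axis q (?v $ q)" by (simp add: B(3) rscale_axis)
  from that[OF Sp_mult[OF B(1) A(1)] A(2) q u' this] show thesis .
qed

section \<open>Spectral theorem on the positive definite part\<close>

definition diag_on :: "quat ^ 'n ^ 'n \<Rightarrow> 'n set \<Rightarrow> bool" where
  "diag_on g T \<longleftrightarrow> (\<forall>j\<in>T. \<exists>c. g *v axis j 1 = axis j c)"

lemma diag_onE:
  assumes "diag_on g T" "g \<in> carrier S" "j \<in> T"
  obtains c where "c \<noteq> 0" "g *v axis j 1 = axis j c"
proof -
  obtain c where c: "g *v axis j 1 = axis j c" using assms by (auto simp: diag_on_def)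
  have "axis j (1 :: quat) \<noteq> 0" by (simp add: axis_eq_0_iff)
  then have "g *v axis j 1 \<noteq> 0" using Sp_inj[OF assms(2), of "axis j 1" 0] by simp
  with c that show thesis by (auto simp: axis_eq_0_iff)
qed

lemma adj_diag_on: assumes "diag_on g T" and g: "g \<in> carrier S" shows "diag_on (adj g) T"
  unfolding diag_on_def
proof
  fix j assume "j \<in> T"
  then obtain c where c: "c \<noteq> 0" "g *v axis j 1 = axis j c" using assms diag_onE by blast
  have "axis j 1 = rscale (axis j c) (inverse c)" using c by (simp add: rscale_axis)
  also have "\<dots> = g *v axis j (inverse c)"
    by (simp add: c(2) mat_vec_rscale axis_eq_rscale[of j "inverse c"])
  finally have "adj g *v axis j 1 = axis j (inverse c)" using Sp_adj_vec(1)[OF g] by metis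
  then show "\<exists>c. adj g *v axis j 1 = axis j c" by blast
qed

text \<open>If T contains \<open>p\<close> and \<open>q\<close>, it is invariant under
  \<open>sw\<close>, and this is the orthogonal complement of the basis vectors indexed by T. There
  the form is the standard Euclidean one (\<open>herm_vanishing\<close>).\<close>

definition vanishing :: "'n set \<Rightarrow> (quat ^ 'n) set" where
  "vanishing T = {z. \<forall>j\<in>T. z $ j = 0}"

lemma vanishing_closed_ops: "x \<in> vanishing T \<Longrightarrow> y \<in> vanishing T \<Longrightarrow> x + y \<in> vanishing T"
  "x \<in> vanishing T \<Longrightarrow> y \<in> vanishing T \<Longrightarrow> x - y \<in> vanishing T"
  "x \<in> vanishing T \<Longrightarrow> r *\<^sub>R x \<in> vanishing T"
  "x \<in> vanishing T \<Longrightarrow> rscale x l \<in> vanishing T"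
  by (auto simp: vanishing_def)

text \<open>An isometry that keeps the lines indexed by T keeps their orthogonal complement.\<close>

lemma vanishing_invariant:
  assumes g: "g \<in> carrier S" "diag_on g T" and T: "p \<in> T" "q \<in> T" and z: "z \<in> vanishing T"
  shows "g *v z \<in> vanishing T"
  unfolding vanishing_def
proof (intro CollectI ballI)
  fix j assume "j \<in> T"
  then have "sw j \<in> T" using T by (auto simp: sw_def)
  then obtain c where c: "c \<noteq> 0" "g *v axis (sw j) 1 = axis (sw j) c" using g diag_onE by blast
  have "H (g *v z) (axis (sw j) c) = H z (axis (sw j) 1)" by (simp add: Sp_herm[OF g(1)] flip: c(2))
  also have "\<dots> = 0" using z \<open>j \<in> T\<close> by (simp add: herm_axis_right vanishing_def)
  finally have "qcnj c * (sg j *\<^sub>R (g *v z) $ j) = 0"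
    by (simp only: axis_eq_rscale[of "sw j" c] herm_rscale_right herm_axis_right sw_simps sg_simps)
  moreover have "sg j \<noteq> 0" by (simp add: sg_def)
  ultimately show "(g *v z) $ j = 0" using c by simp
qed

lemma herm_vanishing:
  assumes T: "p \<in> T" "q \<in> T" and z: "z \<in> vanishing T"
  shows "qRe (H z w) = inner z w"
  unfolding herm_sum qRe_sum inner_vec_def
proof (rule sum.cong[OF refl])
  fix i
  show "qRe (sg i *\<^sub>R (qcnj (w $ sw i) * z $ i)) = z $ i \<bullet> w $ i"
  proof (cases "i = p \<or> i = q")
    case True
    then have "z $ i = 0" using T z by (auto simp: vanishing_def)
    then show ?thesis by simp
  qed (simp add: inner_quat_qRe)
qed

lemma compact_unit_vanishing: "compact {z \<in> vanishing T. norm z = 1}"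
proof -
  have "closed (\<Inter>j\<in>T. {z :: quat ^ 'n. z $ j = 0})"
    by (intro closed_INT ballI closed_Collect_eq continuous_intros)
  moreover have "{z \<in> vanishing T. norm z = 1} = (\<Inter>j\<in>T. {z. z $ j = 0}) \<inter> sphere 0 1"
    by (auto simp: vanishing_def)
  ultimately show ?thesis by (simp add: closed_Int_compact)
qed

text \<open>
  A maximiser \<open>z\<close> of \<open>Re \<langle>g z, z\<rangle>\<close> on the unit sphere of the positive definite invariant subspace
  satisfies \<open>g z + g\<^sup>-\<^sup>1 z = 2 t z\<close> with \<open>t\<close> real and \<open>\<bar>t\<bar> \<le> 1\<close>. If \<open>\<mu>\<close> is the root of
  \<open>x\<^sup>2 - 2 t x + 1\<close> in the complex subfield, then \<open>g z - z \<mu>\<^sup>*\<close> is zero or an eigenvector.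
\<close>

lemma exists_eigenvector:
  assumes g: "g \<in> carrier S" "diag_on g T" and T: "p \<in> T" "q \<in> T" "T \<noteq> UNIV"
  obtains w m where "w \<in> vanishing T" "w \<noteq> 0" "g *v w = rscale w m"
proof -
  let ?W = "vanishing T"
  let ?f = "\<lambda>z. inner (g *v z) z"
  note W = vanishing_closed_ops[of _ T] vanishing_invariant[OF g T(1,2)]
    vanishing_invariant[OF adj_Sp[OF g(1)] adj_diag_on[OF g(2,1)] T(1,2)]
  have lin: "g *v (x + y) = g *v x + g *v y" "g *v (x - y) = g *v x - g *v y"
    "g *v (r *\<^sub>R x) = r *\<^sub>R (g *v x)" for x y r
    using linear_add[OF linear_mat_vec] linear_diff[OF linear_mat_vec] linear_scale[OF linear_mat_vec]
    by blast+
  obtain i0 where "i0 \<notin> T" using T by blast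
  then have "axis i0 1 \<in> {z \<in> ?W. norm z = 1}"
    by (auto simp: vanishing_def norm_eq_sqrt_inner inner_axis_axis inner_quat_def) (auto simp: axis_def)
  then have ne: "{z \<in> ?W. norm z = 1} \<noteq> {}" by blast
  have "continuous_on {z \<in> ?W. norm z = 1} ?f"
    by (intro continuous_on_inner continuous_on_id linear_continuous_on
        linear_conv_bounded_linear[THEN iffD1] linear_mat_vec)
  from continuous_attains_sup[OF compact_unit_vanishing ne this] obtain z
    where z: "z \<in> ?W" "norm z = 1" and max: "\<And>w. w \<in> ?W \<Longrightarrow> norm w = 1 \<Longrightarrow> ?f w \<le> ?f z"
    by auto
  define t where "t = ?f z"
  have le: "?f w \<le> t * inner w w" if "w \<in> ?W" for w
  proof (cases "w = 0")
    case False
    then have "?f ((1 / norm w) *\<^sub>R w) \<le> t" unfolding t_def using that by (intro max W) auto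
    with False show ?thesis
      by (simp add: lin field_simps dot_square_norm power2_eq_square)
  qed simp
  have sym: "inner (g *v y) z = inner y (adj g *v z)" if "y \<in> ?W" for y
    using that by (simp add: herm_adj W flip: herm_vanishing[OF T(1,2)])
  define y where "y = (2 * t) *\<^sub>R z - g *v z - adj g *v z"
  have y: "y \<in> ?W" unfolding y_def by (intro W z)
  \<comment> \<open>Vary the maximiser z in the direction y itself: t |z + e y|^2 -
    \<open>?f (z + e y)\<close> is nonnegative, and its term linear in e has coefficient
    |y|^2.\<close>
  have "inner y y = 0"
  proof (rule nonneg_quadratic_linear_coeff)
    fix e :: real
    have "inner z z = 1" using z by (simp add: norm_eq_1)
    then have "inner (z + e *\<^sub>R y) (z + e *\<^sub>R y) = 1 + 2 * e * inner z y + e\<^sup>2 * inner y y"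
      by (simp add: inner_simps inner_commute[of y z] power2_eq_square algebra_simps)
    moreover have "?f (z + e *\<^sub>R y) = t + e * (inner (g *v z) y + inner (g *v y) z) + e\<^sup>2 * ?f y"
      by (simp add: lin inner_simps t_def power2_eq_square algebra_simps)
    moreover have "?f (z + e *\<^sub>R y) \<le> t * inner (z + e *\<^sub>R y) (z + e *\<^sub>R y)"
      by (intro le W z y)
    ultimately have "0 \<le> e * (2 * t * inner z y - inner (g *v z) y - inner (g *v y) z)
        + e\<^sup>2 * (t * inner y y - ?f y)"
      by (simp add: algebra_simps)
    also have "2 * t * inner z y - inner (g *v z) y - inner (g *v y) z
        = inner ((2 * t) *\<^sub>R z - g *v z - adj g *v z) y"
      by (simp add: sym[OF y] inner_diff_left inner_commute[of y "adj g *v z"])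
    also have "\<dots> = inner y y" by (simp add: y_def)
    finally show "0 \<le> e * inner y y + e\<^sup>2 * (t * inner y y - ?f y)" .
  qed
  then have "y = 0" by simp
  then have "g *v z + adj g *v z = (2 * t) *\<^sub>R z"
    unfolding y_def by (metis diff_diff_eq eq_iff_diff_eq_0)
  then have "g *v (g *v z + adj g *v z) = g *v ((2 * t) *\<^sub>R z)" by simp
  then have quad: "g *v (g *v z) = (2 * t) *\<^sub>R (g *v z) - z"
    by (simp add: lin Sp_adj_vec[OF g(1)] algebra_simps)
  have "norm (g *v z) = 1"
  proof -
    have "inner (g *v z) (g *v z) = inner z z"
      using herm_vanishing[OF T(1,2)] W z Sp_herm[OF g(1)] by metis
    then show ?thesis using z by (simp add: norm_eq_sqrt_inner)
  qed
  then have "\<bar>t\<bar> \<le> 1" unfolding t_def using Cauchy_Schwarz_ineq2[of "g *v z" z] z by simp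
  then have t1: "t\<^sup>2 \<le> 1" by (simp add: abs_square_le_1)
  define m where "m = Quat t (sqrt (1 - t\<^sup>2)) 0 0"
  have m: "qcnj m * m = 1" "m + qcnj m = of_real (2 * t)"
    using t1 by (simp_all add: m_def quat_eq_iff of_real_def power2_eq_square)
  define w where "w = g *v z - rscale z (qcnj m)"
  have "g *v w = rscale w m"
  proof -
    have "g *v w = rscale (g *v z) (of_real (2 * t)) - z - rscale (g *v z) (qcnj m)"
      unfolding w_def lin quad mat_vec_rscale rscale_of_real ..
    also have "\<dots> = rscale w m"
      unfolding m(2)[symmetric] w_def rscale_add rscale_rscale m(1) by simp
    finally show ?thesis .
  qed
  show thesis
  proof (cases "w = 0")
    case True
    then have "g *v z = rscale z (qcnj m)" by (simp add: w_def)
    moreover have "z \<noteq> 0" using z by auto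
    ultimately show thesis using that z by blast
  next
    case False
    have "w \<in> ?W" unfolding w_def by (intro W z)
    with False that \<open>g *v w = rscale w m\<close> show thesis by blast
  qed
qed

text \<open>T collects the basis vectors already known to be eigenvectors. An eigenvector in their
  complement is moved to a further basis vector by a reflection that fixes those of T, and the
  conjugated matrix is diagonal on one more index.\<close>

lemma diagonalise:
  assumes "g \<in> carrier S" "diag_on g T" "p \<in> T" "q \<in> T"
  shows "\<exists>A l. A \<in> carrier S \<and> (\<forall>j\<in>T. A *v axis j 1 = axis j 1) \<and> A ** g ** adj A = diagonal l"
  using assms
proof (induction "card (UNIV - T)" arbitrary: g T)
  case 0
  then have "T = UNIV" by auto
  then obtain l where l: "g *v axis j 1 = axis j (l j)" for j
    using 0 by (auto simp: diag_on_def) metis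
  have "g $ i $ j = (if i = j then l i else 0)" for i j
  proof -
    have "g $ i $ j = axis j (l j) $ i" using mat_vec_axis[of g j 1 i] by (simp add: l)
    then show ?thesis by (auto simp: axis_def)
  qed
  then have "g = diagonal l" by (simp add: diagonal_def vec_eq_iff)
  moreover have "adj (mat 1) = mat 1" using Sp_adj(1)[OF Sp_one] by simp
  ultimately show ?case using Sp_one by (intro exI[of _ "mat 1"] exI[of _ l]) simp
next
  case (Suc k)
  then have "T \<noteq> UNIV" by auto
  then obtain i0 where i0: "i0 \<notin> T" by blast
  obtain w0 m0 where w0: "w0 \<in> vanishing T" "w0 \<noteq> 0" "g *v w0 = rscale w0 m0"
    using exists_eigenvector[OF Suc.prems \<open>T \<noteq> UNIV\<close>] .
  \<comment> \<open>Chosen of norm 1 so that the coordinate at \<open>i0\<close> becomes real, as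
    \<open>reflection\<close> requires. Right scaling of an eigenvector by c merely conjugates its
    eigenvalue by c.\<close>
  define k0 where "k0 = (if w0 $ i0 = 0 then 1 else norm (w0 $ i0) *\<^sub>R inverse (w0 $ i0))"
  define c where "c = (1 / norm w0) *\<^sub>R k0"
  have k0: "norm k0 = 1" "w0 $ i0 * k0 = of_real (norm (w0 $ i0))"
    by (auto simp: k0_def norm_inverse of_real_def)
  have c0: "c \<noteq> 0" using k0 w0 by (auto simp: c_def)
  define w where "w = rscale w0 c"
  have w: "w \<in> vanishing T" "w \<noteq> 0" using w0 c0 by (auto simp: w_def vanishing_closed_ops rscale_eq_0)
  have wi: "w $ i0 = of_real (norm (w0 $ i0) / norm w0)"
    by (simp add: w_def c_def k0 del: of_real_divide)
      (simp add: scaleR_conv_of_real flip: of_real_mult del: of_real_divide)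
  have ww: "H w w = 1"
  proof -
    have "norm w = norm w0 * norm c"
      unfolding w_def norm_vec_def rscale_nth norm_mult by (simp add: L2_set_left_distrib)
    then have "norm w = 1" using k0 w0(2) by (simp add: c_def)
    then have "qRe (H w w) = 1" using herm_vanishing[OF Suc.prems(3,4) w(1)] by (simp add: norm_eq_1)
    then show ?thesis by (subst herm_self_real) simp
  qed
  have gw: "g *v w = rscale w (inverse c * m0 * c)"
    using c0 by (simp add: w_def mat_vec_rscale w0 mult.assoc[symmetric])
  let ?e = "axis i0 1"
  have ipq: "i0 \<noteq> p" "i0 \<noteq> q" using i0 Suc.prems by auto
  have ee: "H ?e ?e = 1" and we: "H w ?e = w $ i0"
    using ipq by (simp_all add: herm_axis_right)
  have ej: "H (axis j 1) (w - ?e) = 0" if "j \<in> T" for j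
  proof -
    have "sw j \<in> T" using that Suc.prems by (auto simp: sw_def)
    then show ?thesis using i0 w by (simp add: herm_axis_left vanishing_def) (auto simp: axis_def)
  qed
  obtain R where R: "R \<in> carrier S" "R *v w = ?e" "\<And>j. j \<in> T \<Longrightarrow> R *v axis j 1 = axis j 1"
  proof (cases "w $ i0 = 1")
    \<comment> \<open>The reflection vector w - e would be null here; by positive definiteness it is
      zero, so w is already the basis vector.\<close>
    case True
    have "qRe (H (w - ?e) (w - ?e)) = 0"
      using True by (simp add: herm_diff_left herm_diff_right ww ee we herm_cnj[of ?e w])
    moreover have "w - ?e \<in> vanishing T"
      using w i0 by (intro vanishing_closed_ops) (auto simp: vanishing_def axis_def)
    ultimately have "w = ?e" using herm_vanishing[OF Suc.prems(3,4)] by simp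
    with that[OF Sp_one] show thesis by simp
  next
    case False
    show thesis
    proof (rule reflection[of w ?e])
      show "H w w = H ?e ?e" "qcnj (H w ?e) = H w ?e" "H w w \<noteq> H w ?e"
        using False by (simp_all add: ww ee we wi del: of_real_divide)
    qed (use that ej in blast)
  qed
  have aR: "adj R *v ?e = w" "\<And>j. j \<in> T \<Longrightarrow> adj R *v axis j 1 = axis j 1"
    using Sp_adj_vec(1)[OF R(1)] R(2,3) by metis+
  let ?g = "R ** g ** adj R"
  have gS: "?g \<in> carrier S" using R Suc.prems by (simp add: Sp_mult adj_Sp)
  have "diag_on ?g (insert i0 T)"
    unfolding diag_on_def
  proof
    fix j assume "j \<in> insert i0 T"
    then consider "j = i0" | "j \<in> T" by blast
    then show "\<exists>c. ?g *v axis j 1 = axis j c"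
    proof cases
      case 1
      have "?g *v axis j 1 = rscale (axis j 1) (inverse c * m0 * c)"
        using 1 by (simp add: aR gw mat_vec_rscale R flip: matrix_vector_mul_assoc)
      then show ?thesis by (auto simp: rscale_axis)
    next
      case 2
      then obtain d where d: "g *v axis j 1 = axis j d"
        using Suc.prems(2) unfolding diag_on_def by blast
      then have "?g *v axis j 1 = R *v rscale (axis j 1) d"
        using 2 by (simp add: aR d rscale_axis flip: matrix_vector_mul_assoc)
      also have "\<dots> = axis j d" using 2 by (simp add: mat_vec_rscale R) (simp add: rscale_axis)
      finally show ?thesis by blast
    qed
  qed
  moreover have "k = card (UNIV - insert i0 T)"
  proof -
    have "UNIV - T = insert i0 (UNIV - insert i0 T)" using i0 by auto
    then have "card (UNIV - T) = Suc (card (UNIV - insert i0 T))" by (metis DiffD2 card_insert_disjoint finite insertI1)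
    with Suc.hyps(2) show ?thesis by simp
  qed
  ultimately obtain A l where A: "A \<in> carrier S" "\<And>j. j \<in> insert i0 T \<Longrightarrow> A *v axis j 1 = axis j 1"
      "A ** ?g ** adj A = diagonal l"
    using Suc.hyps(1)[of "insert i0 T" ?g] gS Suc.prems by blast
  have adjAR: "adj (A ** R) = adj R ** adj A"
  proof -
    have "(A ** R) ** (adj R ** adj A) = A ** (R ** adj R) ** adj A" by (simp only: matrix_mul_assoc)
    then have "(A ** R) ** (adj R ** adj A) = mat 1" using A(1) R(1) by (simp add: Sp_adj)
    then show ?thesis
      by (metis A(1) R(1) Sp_adj(1) Sp_mult matrix_mul_assoc matrix_mul_lid matrix_mul_rid)
  qed
  show ?case
  proof (intro exI conjI ballI)
    show "A ** R \<in> carrier S" using A R by (simp add: Sp_mult)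
    show "(A ** R) *v axis j 1 = axis j 1" if "j \<in> T" for j
      using that A R by (simp flip: matrix_vector_mul_assoc)
    show "(A ** R) ** g ** adj (A ** R) = diagonal l"
      using A(3) by (simp add: adjAR matrix_mul_assoc)
  qed
qed

end

lemma diagonal_vec: "(diagonal l *v z) $ i = l i * z $ i"
proof -
  have "(\<Sum>j\<in>UNIV. (if i = j then l i else 0) * z $ j) = (\<Sum>j\<in>UNIV. if i = j then l i * z $ j else 0)"
    by (rule sum.cong) auto
  then show ?thesis by (simp add: diagonal_def matrix_vector_mult_def)
qed

lemma diagonal_axis: "diagonal l *v axis j c = axis j (l j * c)"
  by (simp add: vec_eq_iff diagonal_vec) (simp add: axis_def)

context frame
begin

section \<open>Diagonal form of a loxodromic element\<close>

lemma diagonal_Sp_entries: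
  assumes l: "diagonal l \<in> carrier S"
  shows "qcnj (l q) * l p = 1" "i \<noteq> p \<Longrightarrow> i \<noteq> q \<Longrightarrow> norm (l i) = 1"
proof -
  have *: "H (axis i (l i)) (axis j (l j)) = H (axis i 1) (axis j 1)" for i j
    using Sp_herm[OF l, of "axis i 1" "axis j 1"] by (simp add: diagonal_axis)
  have **: "H (axis i (l i)) (axis j (l j)) = qcnj (l j) * H (axis i 1) (axis j 1) * l i" for i j
    by (simp add: axis_eq_rscale[of i "l i"] axis_eq_rscale[of j "l j"] herm_rscale_left
        herm_rscale_right mult.assoc)
  show "qcnj (l q) * l p = 1" using *[of p q] **[of p q] by (simp add: herm_basis)
  assume "i \<noteq> p" "i \<noteq> q"
  then have "H (axis i 1) (axis i 1) = 1" by (simp add: herm_axis_right)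
  then have "qcnj (l i) * l i = 1" using *[of i i] **[of i i] by simp
  then have "norm (l i) * norm (l i) = 1" by (metis norm_mult norm_one norm_qcnj)
  then show "norm (l i) = 1" by (metis norm_ge_zero real_sqrt_abs2 real_sqrt_one abs_of_nonneg)
qed

lemma hyp_bdry_disjoint: "P \<in> hyp p q \<Longrightarrow> P \<notin> bdry p q"
proof
  assume "P \<in> hyp p q" "P \<in> bdry p q"
  then obtain z w where z: "P = proj z" "qRe (H z z) < 0" and w: "P = proj w" "H w w = 0"
    by (auto simp: hyp_def bdry_def V_neg_def V_zero_def)
  then obtain l where "z = rscale w l" by (metis proj_eq_iff)
  then have "H z z = 0" by (simp add: herm_rscale_left herm_rscale_right w)
  with z show False by simp
qed

lemma act_eq_proj_iff: "act g (proj u) = proj u \<longleftrightarrow> (\<exists>a. a \<noteq> 0 \<and> g *v u = rscale u a)"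
  by (simp add: act_proj proj_eq_iff)

lemma null_orthogonal:
  assumes "H u u = 0" "u \<noteq> 0" "H v v = 0" "v \<noteq> 0" "proj u \<noteq> proj v"
  shows "H u v \<noteq> 0"
proof -
  obtain A c d where A: "A \<in> carrier S" "c \<noteq> 0" "d \<noteq> 0" "A *v u = axis p c" "A *v v = axis q d"
    using null_pair_normal_form[OF assms] .
  have "H u v = H (rscale (axis p 1) c) (rscale (axis q 1) d)"
    using Sp_herm[OF A(1), of u v] A by (simp add: rscale_axis)
  then show ?thesis using A by (simp add: herm_rscale_left herm_rscale_right herm_basis)
qed

lemma adj_mult: assumes A: "A \<in> carrier S" and B: "B \<in> carrier S"
  shows "adj (A ** B) = adj B ** adj A"
  by (metis A B Sp_adj matrix_mul_assoc matrix_mul_lid matrix_mul_rid Sp_mult)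

text \<open>The condition on \<open>a\<close> puts the expanding fixed point at index
  \<open>p\<close>. Conjugation to the pair e_p, e_q leaves only the complement to be diagonalised,
  and \<open>diagonalise\<close> keeps these two vectors.\<close>

lemma fixed_pair_diag_form:
  assumes g: "loxodromic p q g"
    and u: "H u u = 0" "u \<noteq> 0" and v: "H v v = 0" "v \<noteq> 0" and uv: "proj u \<noteq> proj v"
    and gu: "g *v u = rscale u a" and gv: "g *v v = rscale v b" and a: "norm a \<ge> 1"
  shows "\<exists>l. diag_form p q g l"
proof -
  have gS: "g \<in> carrier S" using g by (simp add: loxodromic_def)
  obtain A c d where A: "A \<in> carrier S" "c \<noteq> 0" "d \<noteq> 0" "A *v u = axis p c" "A *v v = axis q d"
    using null_pair_normal_form[OF u v uv] .
  define g' where "g' = A ** g ** adj A"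
  have g'S: "g' \<in> carrier S" unfolding g'_def by (intro Sp_mult adj_Sp A gS)
  have inv: "adj A *v axis p 1 = rscale u (inverse c)" "adj A *v axis q 1 = rscale v (inverse d)"
    using A(2,3) Sp_adj_vec(1)[OF A(1), of "rscale u (inverse c)"]
      Sp_adj_vec(1)[OF A(1), of "rscale v (inverse d)"]
    by (simp_all add: mat_vec_rscale A(4,5) rscale_axis)
  have g'p: "g' *v axis p 1 = axis p (c * a * inverse c)"
    and g'q: "g' *v axis q 1 = axis q (d * b * inverse d)"
    by (simp_all add: g'_def inv mat_vec_rscale gu gv A(4,5) rscale_axis mult.assoc
        flip: matrix_vector_mul_assoc)
  then have "diag_on g' {p, q}" by (auto simp: diag_on_def)
  then obtain B l where B: "B \<in> carrier S" "B *v axis p 1 = axis p 1" "B ** g' ** adj B = diagonal l"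
    using diagonalise[OF g'S] by (metis insertCI)
  define D where "D = B ** A"
  have D: "D \<in> carrier S" "D ** g ** adj D = diagonal l"
    using B(3) by (simp_all add: D_def Sp_mult A B(1) adj_mult g'_def matrix_mul_assoc)
  have lS: "diagonal l \<in> carrier S" unfolding D(2)[symmetric] by (intro Sp_mult adj_Sp D gS)
  note l = diagonal_Sp_entries[OF lS]
  have "adj B *v axis p 1 = axis p 1" using Sp_adj_vec(1)[OF B(1), of "axis p 1"] B(2) by simp
  then have "diagonal l *v axis p 1 = rscale (B *v axis p 1) (c * a * inverse c)"
    unfolding B(3)[symmetric]
    by (simp add: g'p rscale_axis flip: matrix_vector_mul_assoc mat_vec_rscale)
  then have "l p = c * a * inverse c"
    by (auto simp: B(2) diagonal_axis rscale_axis axis_eq_axis)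
  then have "norm (l p) = norm c * norm a * inverse (norm c)" by (simp add: norm_mult norm_inverse)
  then have lp1: "norm (l p) \<ge> 1" using a A(2) by (simp add: field_simps)
  then have lp0: "l p \<noteq> 0" by auto
  then have lq: "l q = inverse (qcnj (l p))"
  proof -
    have "qcnj (l p) * l q = 1" using arg_cong[OF l(1), of qcnj] by simp
    then show ?thesis by (simp add: inverse_unique)
  qed
  \<comment> \<open>With |l_p| = 1 the entries at \<open>p\<close> and \<open>q\<close> coincide, so
    e_p + e_q would be a negative eigenvector, that is, a fixed point inside hyperbolic
    space.\<close>
  have "norm (l p) \<noteq> 1"
  proof
    assume "norm (l p) = 1"
    then have "qcnj (l p) * l p = 1" by (simp add: qcnj_mult_self)
    then have "l q = l p" unfolding lq by (simp add: inverse_unique)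
    then have fix_e: "diagonal l *v (axis p 1 + axis q 1) = rscale (axis p 1 + axis q 1) (l p)"
      by (simp add: matrix_vector_right_distrib diagonal_axis rscale_add rscale_axis)
    define z where "z = adj D *v (axis p 1 + axis q 1)"
    have "g = adj D ** diagonal l ** D"
    proof -
      have "adj D ** (D ** g ** adj D) ** D = (adj D ** D) ** g ** (adj D ** D)"
        by (simp only: matrix_mul_assoc)
      then show ?thesis using D(1) by (simp add: D(2) Sp_adj)
    qed
    then have "g *v z = rscale z (l p)"
      by (simp add: z_def Sp_adj_vec[OF D(1)] fix_e mat_vec_rscale flip: matrix_vector_mul_assoc)
    then have "act g (proj z) = proj z" using lp0 act_eq_proj_iff by blast
    moreover have "H z z = - 2"
      by (simp add: z_def Sp_herm adj_Sp D(1) herm_add_left herm_add_right herm_basis)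
    then have "proj z \<in> hyp p q" by (intro proj_in_hyp) simp
    ultimately have "proj z \<in> fixed_points p q g" by (simp add: fixed_points_def)
    with g \<open>proj z \<in> hyp p q\<close> hyp_bdry_disjoint show False by (auto simp: loxodromic_def)
  qed
  with lp1 have "norm (l p) > 1" by simp
  with l(2) lq D have "diag_form p q g l"
    unfolding diag_form_def by (auto simp: mult_Sp inv_Sp intro!: bexI[of _ D])
  then show ?thesis by blast
qed

lemma loxodromic_fixed_points:
  assumes g: "loxodromic p q g" and fp: "fixed_points p q g = {P, Q}" "P \<noteq> Q"
  obtains u v a b where "P = proj u" "Q = proj v" "H u u = 0" "u \<noteq> 0" "H v v = 0" "v \<noteq> 0"
    "g *v u = rscale u a" "g *v v = rscale v b" "norm a * norm b = 1"
proof -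
  have "P \<in> bdry p q" "Q \<in> bdry p q" and act: "act g P = P" "act g Q = Q"
    using g fp unfolding loxodromic_def fixed_points_def by auto
  then obtain u v where u: "P = proj u" "H u u = 0" "u \<noteq> 0" and v: "Q = proj v" "H v v = 0" "v \<noteq> 0"
    by (auto simp: bdry_def V_zero_def)
  obtain a b where ab: "g *v u = rscale u a" "g *v v = rscale v b"
    using act u(1) v(1) act_eq_proj_iff by metis
  have "g \<in> carrier S" using g by (simp add: loxodromic_def)
  then have "qcnj b * H u v * a = H u v"
    using Sp_herm[of g u v] by (simp add: ab herm_rscale_left herm_rscale_right mult.assoc)
  then have "norm b * norm (H u v) * norm a = norm (H u v)" by (metis norm_mult norm_qcnj)
  moreover have "H u v \<noteq> 0" using null_orthogonal u v fp by metis
  ultimately have "norm a * norm b = 1" by (simp add: mult.commute)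
  with u v ab that show thesis by blast
qed

text \<open>Gives the existence behind the choice in \<open>eigs\<close>. The eigenvalue norms at
  the two fixed points multiply to 1, so one of them is at least 1 and decides which point goes to
  \<open>p\<close>.\<close>

lemma loxodromic_diag_form:
  assumes g: "loxodromic p q g"
  shows "diag_form p q g (eigs p q g)"
proof -
  obtain P Q where PQ: "fixed_points p q g = {P, Q}" "P \<noteq> Q"
    using g by (auto simp: loxodromic_def card_2_iff)
  obtain u v a b where *: "P = proj u" "Q = proj v" "H u u = 0" "u \<noteq> 0" "H v v = 0" "v \<noteq> 0"
    "g *v u = rscale u a" "g *v v = rscale v b" "norm a * norm b = 1"
    using loxodromic_fixed_points[OF g PQ] .
  have "norm a \<ge> 1 \<or> norm b \<ge> 1"
    using mult_strict_mono'[of "norm a" 1 "norm b" 1] *(9) by fastforce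
  then have "\<exists>l. diag_form p q g l"
  proof
    assume "norm a \<ge> 1"
    with * PQ g show ?thesis by (intro fixed_pair_diag_form[of g u v a b]) auto
  next
    assume "norm b \<ge> 1"
    with * PQ g show ?thesis by (intro fixed_pair_diag_form[of g v u b a]) auto
  qed
  then show ?thesis unfolding eigs_def by (rule someI_ex)
qed

lemma diag_form_fixed_points:
  assumes g: "loxodromic p q g" and A: "A \<in> carrier S" "A ** g ** adj A = diagonal l"
  shows "fixed_points p q g = {proj (adj A *v axis p 1), proj (adj A *v axis q 1)}"
proof -
  have gS: "g \<in> carrier S" and card: "card (fixed_points p q g) = 2"
    using g by (simp_all add: loxodromic_def)
  have lS: "diagonal l \<in> carrier S" unfolding A(2)[symmetric] by (intro Sp_mult adj_Sp A gS)
  have gA: "g *v (adj A *v z) = adj A *v (diagonal l *v z)" for z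
    by (simp add: A(1) Sp_adj_vec flip: A(2) matrix_vector_mul_assoc)
  have mem: "proj (adj A *v axis i 1) \<in> fixed_points p q g" if i: "i = p \<or> i = q" for i
  proof -
    have "l i \<noteq> 0" using diagonal_Sp_entries(1)[OF lS] i by auto
    moreover have "g *v (adj A *v axis i 1) = rscale (adj A *v axis i 1) (l i)"
      by (simp add: gA diagonal_axis rscale_axis flip: mat_vec_rscale)
    moreover have "H (adj A *v axis i 1) (adj A *v axis i 1) = 0"
      using i by (auto simp: Sp_herm adj_Sp A(1) herm_basis)
    moreover have "adj A *v axis i 1 \<noteq> 0"
      using Sp_inj[OF adj_Sp[OF A(1)], of "axis i 1" 0] by (simp add: axis_eq_0_iff)
    ultimately show ?thesis
      by (auto simp: fixed_points_def bdry_def V_zero_def act_eq_proj_iff)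
  qed
  have "proj (adj A *v axis p 1) \<noteq> proj (adj A *v axis q 1)"
  proof
    assume "proj (adj A *v axis p 1) = proj (adj A *v axis q 1)"
    then obtain k where "adj A *v axis p 1 = rscale (adj A *v axis q 1) k"
      by (auto simp: proj_eq_iff)
    then have "axis p 1 = axis q k"
      by (simp add: Sp_inj[OF adj_Sp[OF A(1)]] rscale_axis flip: mat_vec_rscale)
    with pq show False by (simp add: axis_eq_axis)
  qed
  moreover have fin: "finite (fixed_points p q g)" using card by (intro card_ge_0_finite) simp
  ultimately show ?thesis
    by (intro card_subset_eq[symmetric]) (auto simp: card mem)
qed

end

section \<open>Geodesics\<close>

text \<open>The common factor exp (t / 2) / 2 cancels, leaving a quotient in exp (- t).\<close>

lemma tendsto_cosh_quotient:
  "((\<lambda>t. cosh ((t - s) / 2) / cosh (t / 2)) \<longlongrightarrow> exp (- s / 2)) at_top" for s :: real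
proof -
  have *: "cosh ((t - s) / 2) / cosh (t / 2) =
      (exp (- s / 2) + exp (s / 2) * exp (- t)) / (1 + exp (- t))" for t
  proof -
    have e: "cosh ((t - r) / 2) = exp (t / 2) / 2 * (exp (- r / 2) + exp (r / 2) * exp (- t))" for r
    proof -
      have "exp (t / 2) * (exp (- r / 2) + exp (r / 2) * exp (- t)) = exp ((t - r) / 2) + exp (- ((t - r) / 2))"
        by (simp add: algebra_simps flip: exp_add) (simp add: field_simps)
      then show ?thesis by (simp add: cosh_field_def)
    qed
    have "cosh (t / 2) = exp (t / 2) / 2 * (1 + exp (- t))" using e[of 0] by simp
    then show ?thesis by (simp only: e[of s] mult_divide_mult_cancel_left_if) simp
  qed
  have "((\<lambda>t :: real. exp (- t)) \<longlongrightarrow> 0) at_top"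
    by (rule filterlim_compose[OF exp_at_bot filterlim_uminus_at_bot_at_top])
  then have "((\<lambda>t. (exp (- s / 2) + exp (s / 2) * exp (- t)) / (1 + exp (- t)))
      \<longlongrightarrow> (exp (- s / 2) + exp (s / 2) * 0) / (1 + 0)) at_top"
    by (intro tendsto_intros) auto
  then show ?thesis unfolding * by simp
qed

lemma ptendsto_compose:
  assumes "ptendsto c P F" "filterlim f F G"
  shows "ptendsto (\<lambda>t. c (f t)) P G"
proof -
  obtain z w where z: "\<And>t. z t \<in> c t" "w \<in> P" "(z \<longlongrightarrow> w) F"
    using assms(1) by (auto simp: ptendsto_def)
  have "((\<lambda>t. z (f t)) \<longlongrightarrow> w) G" using z(3) assms(2) by (rule filterlim_compose)
  with z(1,2) show ?thesis unfolding ptendsto_def by (intro exI[of _ "\<lambda>t. z (f t)"]) blast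
qed

context frame
begin

lemma tendsto_herm_left: "(f \<longlongrightarrow> w) F \<Longrightarrow> ((\<lambda>t. H (f t) v) \<longlongrightarrow> H w v) F"
  unfolding herm_sum by (intro tendsto_intros)

text \<open>Along a geodesic ray ending at \<open>w\<close>, the function \<open>- 2 log \<bar>\<langle>w, y\<rangle>\<bar>\<close> of unit lifts \<open>y\<close> is a
  Busemann function.\<close>

lemma norm_herm_along_geodesic:
  assumes y: "\<And>s. H (y s) (y s) = - 1"
    and dist: "\<And>s t. rho p q (proj (y s)) (proj (y t)) = \<bar>s - t\<bar>"
    and lim: "ptendsto (\<lambda>s. proj (y s)) (proj w) at_top"
  shows "norm (H w (y s)) = exp (- s / 2) * norm (H w (y 0))"
proof -
  obtain z w' where z: "\<And>t. z t \<in> proj (y t)" "w' \<in> proj w" "(z \<longlongrightarrow> w') at_top"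
    using lim by (auto simp: ptendsto_def)
  obtain k where k: "k \<noteq> 0" "w' = rscale w k" using z(2) by (auto simp: mem_proj)
  have "\<forall>t. \<exists>l. z t = rscale (y t) l" using z(1) by (auto simp: mem_proj)
  then obtain l where l: "\<And>t. z t = rscale (y t) (l t)" by metis
  have n: "norm (H (z t) (y s)) = cosh ((t - s) / 2) * norm (l t)" for t s
  proof -
    have "norm (H (y t) (y s)) = cosh (\<bar>t - s\<bar> / 2)"
      using rho_proj(2)[OF y[of t] y[of s]] dist by simp
    also have "\<dots> = cosh \<bar>(t - s) / 2\<bar>" by simp
    finally show ?thesis unfolding cosh_real_abs by (simp add: l herm_rscale_left norm_mult)
  qed
  have lim: "((\<lambda>t. norm (H (z t) (y s))) \<longlongrightarrow> norm (H w' (y s))) at_top" for s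
    by (intro tendsto_norm tendsto_herm_left z)
  \<comment> \<open>The convergent lifts differ from the unit lifts by unknown scalars
    \<open>l t\<close>; these cancel when the pairing with y_s is compared with the pairing with
    y_0.\<close>
  have "norm (H (z t) (y s)) = cosh ((t - s) / 2) / cosh (t / 2) * norm (H (z t) (y 0))" for t
    by (simp add: n)
  then have "((\<lambda>t. norm (H (z t) (y s))) \<longlongrightarrow> exp (- s / 2) * norm (H w' (y 0))) at_top"
    using tendsto_mult[OF tendsto_cosh_quotient lim[of 0]] by presburger
  from tendsto_unique[OF _ lim this] show ?thesis
    using k by (simp add: herm_rscale_left norm_mult)
qed

section \<open>The standard geodesic and its uniqueness\<close>

definition dil :: "real \<Rightarrow> quat ^ 'n ^ 'n" where
  "dil s = diagonal (\<lambda>i. if i = p then of_real s else if i = q then of_real (1 / s) else 1)"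

definition base :: "quat ^ 'n" where "base = axis p 1 + axis q 1"

text \<open>Written as the orbit of one point under the dilations, so that
  \<open>std_geodesic_distance\<close> can move any two of its points to \<open>base\<close> at
  once.\<close>

definition std_geodesic :: "'n ppoint set" where
  "std_geodesic = {proj (dil s *v base) | s. s > 0}"

lemma herm_base: "H base base = - 2"
  by (simp add: base_def herm_add_left herm_add_right herm_basis)

lemma dil_Sp: assumes "s > 0" shows "dil s \<in> carrier S"
proof (rule preserving_imp_Sp)
  fix z w
  have "sg i *\<^sub>R (qcnj ((dil s *v w) $ sw i) * (dil s *v z) $ i) = sg i *\<^sub>R (qcnj (w $ sw i) * z $ i)" for i
    using assms pq
    by (cases "i = p"; cases "i = q") (simp_all add: dil_def diagonal_vec of_real_def)
  then show "H (dil s *v z) (dil s *v w) = H z w" by (simp only: herm_sum)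
qed

lemma dil_base: "dil s *v base = axis p (of_real s) + axis q (of_real (1 / s))"
  using pq by (simp add: dil_def base_def matrix_vector_right_distrib diagonal_axis)

lemma std_geodesic_alt: "std_geodesic = {proj (axis p 1 + axis q (of_real r)) | r. r > 0}"
proof -
  have *: "proj (dil s *v base) = proj (axis p 1 + axis q (of_real (1 / s\<^sup>2)))" if "s > 0" for s
  proof -
    have "dil s *v base = rscale (axis p 1 + axis q (of_real (1 / s\<^sup>2))) (of_real s)"
      using that by (simp add: dil_base rscale_add rscale_axis power2_eq_square
          del: of_real_divide flip: of_real_mult)
    then show ?thesis using that by (simp add: proj_rscale)
  qed
  have "proj (axis p 1 + axis q (of_real r)) = proj (dil (1 / sqrt r) *v base)" if "r > 0" for r
    using that *[of "1 / sqrt r"] by (simp add: power_divide)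
  then show ?thesis unfolding std_geodesic_def using * by (metis (no_types, lifting) divide_pos_pos
        real_sqrt_gt_zero zero_less_one zero_less_power)
qed

lemma std_geodesic_hyp: "std_geodesic \<subseteq> hyp p q"
  by (auto simp: std_geodesic_def Sp_herm dil_Sp herm_base intro!: proj_in_hyp)

text \<open>The Busemann functions of the two ends give |y_p| = exp (- s / 2) P and |y_q| = exp (s /
  2) Q along the unit lifts, so C = P Q is constant. Normalisation gives C at least 1/2, and
  comparing growth rates gives C at most 1/2. In the equality case the middle coordinates vanish and
  the product of \<open>qcnj\<close> y_p with y_q is exactly 1/2, which describes the standard
  geodesic.\<close>

lemma geodesic_joining_std:
  assumes "geodesic_joining p q (proj (axis p 1)) (proj (axis q 1)) \<gamma>"
  shows "\<gamma> = std_geodesic"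
proof -
  obtain c where c: "range c = \<gamma>" "\<gamma> \<subseteq> hyp p q" "\<And>s t. rho p q (c s) (c t) = \<bar>s - t\<bar>"
    and bot: "ptendsto c (proj (axis p 1)) at_bot" and top: "ptendsto c (proj (axis q 1)) at_top"
    using assms by (auto simp: geodesic_joining_def)
  have "\<forall>s. \<exists>z. H z z = - 1 \<and> c s = proj z" using c hyp_unit_lift by (metis rangeI subsetD)
  then obtain y where y: "\<And>s. H (y s) (y s) = - 1" and cy: "c = (\<lambda>s. proj (y s))" by metis
  define P where "P = norm (y 0 $ p)"
  define Q where "Q = norm (y 0 $ q)"
  have a: "norm (y s $ p) = exp (- s / 2) * P" for s
    using norm_herm_along_geodesic[of y "axis q 1" s] y c top
    by (simp add: cy herm_axis_left P_def)
  have b: "norm (y s $ q) = exp (s / 2) * Q" for s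
  proof -
    have "ptendsto (\<lambda>t. c (- t)) (proj (axis p 1)) at_top"
      using bot filterlim_uminus_at_bot_at_top by (rule ptendsto_compose)
    then show ?thesis
      using norm_herm_along_geodesic[of "\<lambda>t. y (- t)" "axis p 1" "- s"] y c
      by (simp add: cy herm_axis_left Q_def)
  qed
  define C where "C = P * Q"
  have ab: "norm (y s $ p) * norm (y s $ q) = C" for s
    unfolding a b C_def by (simp add: mult.assoc mult.left_commute flip: exp_add)
  have C0: "C \<ge> 0" by (simp add: C_def P_def Q_def)
  let ?I = "UNIV - {p, q}"
  have sq: "(\<Sum>i\<in>?I. (norm (y s $ i))\<^sup>2) = 2 * qRe (qcnj (y s $ p) * y s $ q) - 1" for s
    using qRe_herm_self[of "y s"] y[of s] by simp
  have re: "qRe (qcnj (y s $ p) * y s $ q) \<le> C" for s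
    using qRe_le_norm[of "qcnj (y s $ p) * y s $ q"] ab[of s] by (simp add: norm_mult)
  \<comment> \<open>The pairing of y_s with y_0 has norm cosh (s / 2), growing like exp (s / 2) / 2,
    while one of its terms has norm C exp (s / 2) and the others stay bounded. Hence C cannot exceed
    1/2.\<close>
  have bound: "C * exp (s / 2) \<le> cosh (s / 2) + (2 * C - 1) + C * exp (- s / 2)" if "s \<ge> 0" for s
  proof -
    let ?z = "\<Sum>i\<in>?I. qcnj (y 0 $ i) * y s $ i"
    have "norm ?z \<le> (\<Sum>i\<in>?I. ((norm (y 0 $ i))\<^sup>2 + (norm (y s $ i))\<^sup>2) / 2)"
    proof (rule sum_norm_le)
      fix i
      have "0 \<le> (norm (y 0 $ i) - norm (y s $ i))\<^sup>2" by simp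
      then show "norm (qcnj (y 0 $ i) * y s $ i) \<le> ((norm (y 0 $ i))\<^sup>2 + (norm (y s $ i))\<^sup>2) / 2"
        by (simp add: norm_mult power2_diff)
    qed
    also have "\<dots> = qRe (qcnj (y 0 $ p) * y 0 $ q) + qRe (qcnj (y s $ p) * y s $ q) - 1"
      by (simp add: sq sum.distrib flip: sum_divide_distrib)
    also have "\<dots> \<le> 2 * C - 1" using re[of 0] re[of s] by simp
    finally have 1: "norm ?z \<le> 2 * C - 1" .
    have 2: "norm (H (y s) (y 0)) = cosh (s / 2)"
      using rho_proj(2)[OF y[of s] y[of 0]] c(3)[of s 0] that by (simp add: cy)
    have "qcnj (y 0 $ p) * y s $ q = ?z - qcnj (y 0 $ q) * y s $ p - H (y s) (y 0)"
      by (simp add: herm_def)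
    then have "norm (qcnj (y 0 $ p) * y s $ q)
        \<le> norm ?z + norm (qcnj (y 0 $ q) * y s $ p) + norm (H (y s) (y 0))"
      using norm_triangle_ineq4[of ?z "qcnj (y 0 $ q) * y s $ p"]
        norm_triangle_ineq4[of "?z - qcnj (y 0 $ q) * y s $ p" "H (y s) (y 0)"]
      by (simp only:)
    then have "P * (exp (s / 2) * Q) \<le> (2 * C - 1) + Q * (exp (- s / 2) * P) + cosh (s / 2)"
      using 1 2 by (simp add: norm_mult a[of s] b[of s] flip: P_def Q_def)
    then show ?thesis by (simp add: C_def mult_ac)
  qed
  have "C \<le> 1 / 2"
  proof (rule ccontr)
    assume "\<not> C \<le> 1 / 2"
    then have C: "C > 1 / 2" by simp
    \<comment> \<open>x stands for exp (s / 2). It is at least 1, so that s is nonnegative, and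
      makes (C - 1/2) x equal to 4 C - 1/2, above the bound 3 C - 1/2 derived below.\<close>
    define x where "x = 1 + 3 * C / (C - 1 / 2)"
    have x: "x \<ge> 1" using C by (simp add: x_def)
    define s where "s = 2 * ln x"
    have s: "s \<ge> 0" "exp (s / 2) = x" "exp (- s / 2) = 1 / x" "cosh (s / 2) = (x + 1 / x) / 2"
      using x by (simp_all add: s_def exp_minus inverse_eq_divide cosh_field_def)
    have "C * x \<le> (x + 1 / x) / 2 + (2 * C - 1) + C * (1 / x)" using bound[OF s(1)] by (simp only: s)
    then have "(C - 1 / 2) * x \<le> (2 * C - 1) + (C + 1 / 2) * (1 / x)"
      by (simp add: algebra_simps add_divide_distrib)
    also have "(C + 1 / 2) * (1 / x) \<le> (C + 1 / 2) * 1" using x C by (intro mult_left_mono) auto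
    finally have "(C - 1 / 2) * x \<le> 3 * C - 1 / 2" by simp
    moreover have "(C - 1 / 2) * x = C - 1 / 2 + 3 * C" using C by (simp add: x_def field_simps)
    ultimately show False using C by simp
  qed
  have half: "qRe (qcnj (y s $ p) * y s $ q) = 1 / 2" for s
  proof -
    have "(\<Sum>i\<in>?I. (norm (y s $ i))\<^sup>2) \<ge> 0" by (simp add: sum_nonneg)
    then show ?thesis using sq[of s] re[of s] \<open>C \<le> 1 / 2\<close> by simp
  qed
  have rest: "y s $ i = 0" if "i \<in> ?I" for s i
  proof -
    have "(\<Sum>i\<in>?I. (norm (y s $ i))\<^sup>2) = 0" using sq[of s] half[of s] by simp
    then have "(norm (y s $ i))\<^sup>2 = 0" using that by (subst (asm) sum_nonneg_eq_0_iff) auto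
    then show ?thesis by simp
  qed
  have prod: "qcnj (y s $ p) * y s $ q = of_real (1 / 2)" for s
  proof -
    have "norm (qcnj (y s $ p) * y s $ q) \<le> 1 / 2"
      using ab[of s] \<open>C \<le> 1 / 2\<close> by (simp add: norm_mult)
    then have "norm (qcnj (y s $ p) * y s $ q) = qRe (qcnj (y s $ p) * y s $ q)"
      using qRe_le_norm[of "qcnj (y s $ p) * y s $ q"] half[of s] by linarith
    from real_if_norm_eq_qRe[OF this] show ?thesis unfolding half .
  qed
  have P: "P > 0" using prod[of 0] by (auto simp: P_def)
  \<comment> \<open>y_q is a positive real multiple of y_p, so right scaling by the inverse of y_p
    makes both coordinates real.\<close>
  have cs: "c s = proj (axis p 1 + axis q (of_real (exp s / (2 * P\<^sup>2))))" for s
  proof -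
    have nz: "y s $ p \<noteq> 0" using a[of s] P by auto
    have "(y s $ p * qcnj (y s $ p)) * y s $ q = y s $ p * of_real (1 / 2)"
      by (simp only: mult.assoc prod)
    then have "of_real ((norm (y s $ p))\<^sup>2) * y s $ q = y s $ p * of_real (1 / 2)"
      by (simp only: mult_qcnj)
    then have "(norm (y s $ p))\<^sup>2 *\<^sub>R y s $ q = (1 / 2) *\<^sub>R y s $ p"
      by (simp only: of_real_quat_commute[symmetric] scaleR_conv_of_real)
    moreover have "(norm (y s $ p))\<^sup>2 = exp (- s) * P\<^sup>2"
      by (simp add: a power_mult_distrib flip: exp_double)
    ultimately have "(exp s / P\<^sup>2) *\<^sub>R (exp (- s) * P\<^sup>2) *\<^sub>R y s $ q = (exp s / P\<^sup>2) *\<^sub>R (1 / 2) *\<^sub>R y s $ p"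
      by simp
    then have "y s $ q = (exp s / (2 * P\<^sup>2)) *\<^sub>R y s $ p"
      using P by (simp add: mult.commute flip: exp_add)
    then have "y s = rscale (axis p 1 + axis q (of_real (exp s / (2 * P\<^sup>2)))) (y s $ p)"
      using rest[of _ s] pq by (auto simp: vec_eq_iff axis_def scaleR_conv_of_real)
    then show ?thesis unfolding cy using nz proj_rscale by metis
  qed
  have "\<gamma> = range c" using c by simp
  also have "\<dots> = std_geodesic"
    unfolding std_geodesic_alt
  proof (intro equalityI subsetI)
    fix x assume "x \<in> range c"
    then obtain s where "x = c s" by blast
    moreover have "exp s / (2 * P\<^sup>2) > 0" using P by simp
    ultimately show "x \<in> {proj (axis p 1 + axis q (of_real r)) | r. r > 0}" unfolding cs by blast
  next
    fix x assume "x \<in> {proj (axis p 1 + axis q (of_real r)) | r. r > 0}"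
    then obtain r where r: "r > 0" "x = proj (axis p 1 + axis q (of_real r))" by blast
    then have "exp (ln (r * (2 * P\<^sup>2))) / (2 * P\<^sup>2) = r" using P by simp
    then have "x = c (ln (r * (2 * P\<^sup>2)))" unfolding cs r by simp
    then show "x \<in> range c" by blast
  qed
  finally show ?thesis .
qed

lemma geodesic_joining_commute:
  assumes "geodesic_joining p q u v \<gamma>" shows "geodesic_joining p q v u \<gamma>"
proof -
  obtain c where c: "range c = \<gamma>" "\<gamma> \<subseteq> hyp p q" "\<And>s t. rho p q (c s) (c t) = \<bar>s - t\<bar>"
    and bot: "ptendsto c u at_bot" and top: "ptendsto c v at_top"
    using assms by (auto simp: geodesic_joining_def)
  have "range (\<lambda>t. c (- t)) = \<gamma>"
  proof -
    have "c s \<in> range (\<lambda>t. c (- t))" for s using rangeI[of "\<lambda>t. c (- t)" "- s"] by simp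
    then show ?thesis using c(1) by auto
  qed
  moreover have "ptendsto (\<lambda>t. c (- t)) u at_top"
    using bot filterlim_uminus_at_bot_at_top by (rule ptendsto_compose)
  moreover have "ptendsto (\<lambda>t. c (- t)) v at_bot"
    using top filterlim_uminus_at_top_at_bot by (rule ptendsto_compose)
  moreover have "rho p q (c (- s)) (c (- t)) = \<bar>s - t\<bar>" for s t by (simp add: c)
  ultimately show ?thesis unfolding geodesic_joining_def using c(2) by blast
qed

lemma ptendsto_act: assumes "ptendsto c P F" shows "ptendsto (\<lambda>t. act A (c t)) (act A P) F"
proof -
  obtain z w where z: "\<And>t. z t \<in> c t" "w \<in> P" "(z \<longlongrightarrow> w) F" using assms by (auto simp: ptendsto_def)
  have "isCont ((*v) A) w"
    using linear_mat_vec linear_continuous_at linear_conv_bounded_linear by blast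
  then have "((\<lambda>t. A *v z t) \<longlongrightarrow> A *v w) F" using z(3) by (rule isCont_tendsto_compose)
  with z show ?thesis unfolding ptendsto_def act_def
    by (intro exI[of _ "\<lambda>t. A *v z t"] conjI bexI[of _ "A *v w"]) auto
qed

lemma geodesic_joining_act:
  assumes "geodesic_joining p q u v \<gamma>" and A: "A \<in> carrier S"
  shows "geodesic_joining p q (act A u) (act A v) (act A ` \<gamma>)"
proof -
  obtain c where c: "range c = \<gamma>" "\<gamma> \<subseteq> hyp p q" "\<And>s t. rho p q (c s) (c t) = \<bar>s - t\<bar>"
    and lims: "ptendsto c u at_bot" "ptendsto c v at_top"
    using assms by (auto simp: geodesic_joining_def)
  have "c s \<in> hyp p q" for s using c by blast
  then have "rho p q (act A (c s)) (act A (c t)) = \<bar>s - t\<bar>" for s t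
    using c(3) by (simp add: rho_act A)
  moreover have "range (\<lambda>s. act A (c s)) = act A ` \<gamma>" using c(1) by auto
  moreover have "act A ` \<gamma> \<subseteq> hyp p q" using c(2) Sp_hyp[OF A] by blast
  ultimately show ?thesis
    unfolding geodesic_joining_def using ptendsto_act[OF lims(1)] ptendsto_act[OF lims(2)]
    by (intro exI[of _ "\<lambda>s. act A (c s)"]) simp
qed

lemma act_adj: "A \<in> carrier S \<Longrightarrow> act (adj A) (act A P) = P" "A \<in> carrier S \<Longrightarrow> act A (act (adj A) P) = P"
  by (simp_all add: Sp_adj act_1 flip: act_mult)

text \<open>\<open>is_axis\<close> does not tell which fixed point is which end, so the geodesic may
  have to be run backwards before it is compared with the standard one.\<close>

lemma loxodromic_axis:
  assumes g: "loxodromic p q g" and A: "A \<in> carrier S" "A ** g ** adj A = diagonal l"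
    and ax: "is_axis p q g \<gamma>"
  shows "\<gamma> = act (adj A) ` std_geodesic"
proof -
  obtain u v where uv: "fixed_points p q g = {u, v}" "geodesic_joining p q u v \<gamma>"
    using ax by (auto simp: is_axis_def)
  have "{u, v} = {proj (adj A *v axis p 1), proj (adj A *v axis q 1)}"
    using diag_form_fixed_points[OF g A] uv by simp
  then have "geodesic_joining p q (proj (adj A *v axis p 1)) (proj (adj A *v axis q 1)) \<gamma>"
    using uv(2) geodesic_joining_commute by (metis doubleton_eq_iff)
  from geodesic_joining_act[OF this A(1)]
  have "geodesic_joining p q (proj (axis p 1)) (proj (axis q 1)) (act A ` \<gamma>)"
    by (simp add: act_proj Sp_adj_vec[OF A(1)])
  then have "act A ` \<gamma> = std_geodesic" by (rule geodesic_joining_std)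
  then have "act (adj A) ` std_geodesic = act (adj A) ` act A ` \<gamma>" by simp
  also have "\<dots> = \<gamma>" by (simp add: image_image act_adj[OF A(1)])
  finally show ?thesis ..
qed

end

section \<open>Estimates for matrix entries\<close>

lemma qRe_mult_qcnj: "qRe (x * qcnj y) = inner x y"
  by (simp add: inner_quat_def)

lemma norm_sum4_sq: "(norm (a + b + c + d))\<^sup>2 = (norm a)\<^sup>2 + (norm b)\<^sup>2 + (norm c)\<^sup>2 + (norm d)\<^sup>2
    + 2 * (inner a b + inner a c + inner a d + inner b c + inner b d + inner c d)"
  for a :: "'a::real_inner"
  by (simp add: power2_norm_eq_inner inner_add_left inner_add_right inner_commute)

context frame
begin

lemma row_relation:
  assumes "h \<in> carrier S"
  shows "(\<Sum>m\<in>UNIV. (sg m * sg j) *\<^sub>R (h $ i $ m * qcnj (h $ sw j $ sw m))) = (if i = j then 1 else 0)"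
proof -
  have "(h ** adj h) $ i $ j = (if i = j then 1 else 0)"
    by (simp add: Sp_adj[OF assms]) (simp add: mat_def)
  then show ?thesis by (simp add: matrix_matrix_mult_def adj_nth)
qed

text \<open>Rows p and q are null vectors: this is the vanishing entry at (i, \<open>sw i\<close>)
  of h h^(-1) = 1. The middle entries are thereby controlled by two corners.\<close>

lemma row_norms:
  assumes h: "h \<in> carrier S" and i: "i = p \<or> i = q"
  shows "(\<Sum>m\<in>UNIV - {p, q}. (norm (h $ i $ m))\<^sup>2) = 2 * inner (h $ i $ p) (h $ i $ q)"
proof -
  have ne: "i \<noteq> sw i" using i pq by auto
  have "(\<Sum>m\<in>UNIV. (sg m * sg (sw i)) *\<^sub>R (h $ i $ m * qcnj (h $ i $ sw m))) = 0"
    using row_relation[OF h, of "sw i" i] ne by simp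
  then have "(\<Sum>m\<in>UNIV - {p, q}. (sg m * sg i) *\<^sub>R (h $ i $ m * qcnj (h $ i $ sw m)))
      + h $ i $ p * qcnj (h $ i $ q) + h $ i $ q * qcnj (h $ i $ p) = 0"
    using i by (subst (asm) sum_UNIV_split) auto
  from arg_cong[OF this, of qRe]
  have "(\<Sum>m\<in>UNIV - {p, q}. qRe ((sg m * sg i) *\<^sub>R (h $ i $ m * qcnj (h $ i $ sw m))))
      + inner (h $ i $ p) (h $ i $ q) + inner (h $ i $ q) (h $ i $ p) = 0"
    by (simp add: qRe_sum qRe_mult_qcnj del: quat_times_simps(5))
  moreover have "qRe ((sg m * sg i) *\<^sub>R (h $ i $ m * qcnj (h $ i $ sw m))) = - (norm (h $ i $ m))\<^sup>2"
    if "m \<in> UNIV - {p, q}" for m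
    using that i by (auto simp: mult_qcnj simp del: quat_times_simps(5) of_real_power)
  ultimately show ?thesis
    by (simp add: sum_negf inner_commute)
qed

lemma row_product:
  assumes h: "h \<in> carrier S"
  shows "h $ p $ p * qcnj (h $ q $ q) + h $ p $ q * qcnj (h $ q $ p)
    - (\<Sum>m\<in>UNIV - {p, q}. h $ p $ m * qcnj (h $ q $ m)) = 1"
proof -
  have "(\<Sum>m\<in>UNIV - {p, q}. (sg m * sg p) *\<^sub>R (h $ p $ m * qcnj (h $ q $ sw m)))
      + h $ p $ p * qcnj (h $ q $ q) + h $ p $ q * qcnj (h $ q $ p) = 1"
    using row_relation[OF h, of p p] by (subst (asm) sum_UNIV_split) simp
  moreover have "(\<Sum>m\<in>UNIV - {p, q}. (sg m * sg p) *\<^sub>R (h $ p $ m * qcnj (h $ q $ sw m)))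
      = - (\<Sum>m\<in>UNIV - {p, q}. h $ p $ m * qcnj (h $ q $ m))"
    unfolding sum_negf[symmetric] by (rule sum.cong) auto
  ultimately show ?thesis by (simp add: algebra_simps)
qed

lemma column_nonneg:
  assumes h: "h \<in> carrier S" and j: "j = p \<or> j = q"
  shows "inner (h $ p $ j) (h $ q $ j) \<ge> 0"
proof -
  have "H (h *v axis j 1) (h *v axis j 1) = 0" using j by (auto simp: Sp_herm[OF h] herm_basis)
  then have "2 * qRe (qcnj (h $ p $ j) * h $ q $ j) = (\<Sum>i\<in>UNIV - {p, q}. (norm (h $ i $ j))\<^sup>2)"
    using qRe_herm_self[of "h *v axis j 1"] by (simp add: mat_vec_axis)
  moreover have "\<dots> \<ge> 0" by (simp add: sum_nonneg)
  moreover have "inner (h $ p $ j) (h $ q $ j) = qRe (qcnj (h $ p $ j) * h $ q $ j)"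
    by (simp add: inner_quat_def)
  ultimately show ?thesis by (simp del: quat_times_simps(5))
qed

text \<open>With corners a, b, c, d, expand |a + b + c + d|^2. By \<open>row_product\<close>, a.d +
  b.c is 1 plus the inner product of the middle parts of the two rows; by \<open>row_norms\<close>,
  this together with a.b + c.d completes to a sum of squares. The remaining a.c and b.d are
  nonnegative by the columns.\<close>

lemma herm_base_estimate:
  assumes h: "h \<in> carrier S"
  shows "(norm (h $ p $ p))\<^sup>2 + (norm (h $ p $ q))\<^sup>2 + (norm (h $ q $ p))\<^sup>2 + (norm (h $ q $ q))\<^sup>2 + 2
    \<le> (norm (H (h *v base) base))\<^sup>2"
proof -
  let ?a = "h $ p $ p" and ?b = "h $ p $ q" and ?c = "h $ q $ p" and ?d = "h $ q $ q"
  let ?I = "UNIV - {p, q}"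
  have "H (h *v base) base = - (?a + ?b + ?c + ?d)"
    by (simp add: base_def matrix_vector_right_distrib herm_add_left herm_add_right herm_axis_right
        mat_vec_axis)
  then have 1: "(norm (H (h *v base) base))\<^sup>2 = (norm ?a)\<^sup>2 + (norm ?b)\<^sup>2 + (norm ?c)\<^sup>2 + (norm ?d)\<^sup>2
    + 2 * (inner ?a ?b + inner ?a ?c + inner ?a ?d + inner ?b ?c + inner ?b ?d + inner ?c ?d)"
    by (simp only: norm_minus_cancel norm_sum4_sq)
  have 2: "inner ?a ?d + inner ?b ?c = 1 + (\<Sum>m\<in>?I. inner (h $ p $ m) (h $ q $ m))"
    using arg_cong[OF row_product[OF h], of qRe]
    by (simp add: qRe_sum qRe_mult_qcnj del: quat_times_simps(5))
  have "0 \<le> (\<Sum>m\<in>?I. (norm (h $ p $ m + h $ q $ m))\<^sup>2)" by (simp add: sum_nonneg)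
  also have "\<dots> = (\<Sum>m\<in>?I. (norm (h $ p $ m))\<^sup>2) + (\<Sum>m\<in>?I. (norm (h $ q $ m))\<^sup>2)
      + 2 * (\<Sum>m\<in>?I. inner (h $ p $ m) (h $ q $ m))"
    by (simp add: power2_norm_eq_inner inner_add_left inner_add_right inner_commute sum.distrib
        sum_distrib_left)
  finally have "0 \<le> 2 * inner ?a ?b + 2 * inner ?c ?d
      + 2 * (\<Sum>m\<in>?I. inner (h $ p $ m) (h $ q $ m))"
    using row_norms[OF h, of p] row_norms[OF h, of q] by simp
  then show ?thesis
    unfolding 1 using 2 column_nonneg[OF h, of p] column_nonneg[OF h, of q] by simp
qed

text \<open>
  For \<open>h\<close> in \<open>Sp(n, 1)\<close> the numbers \<open>ratio_x h\<close> and \<open>ratio_y h\<close> are the square roots of the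
  absolute values of the two cross-ratios of \<open>h(e\<^sub>p), e\<^sub>p, e\<^sub>q, h(e\<^sub>q)\<close>.
\<close>

definition ratio_x :: "quat ^ 'n ^ 'n \<Rightarrow> real" where
  "ratio_x h = sqrt (norm (h $ p $ q) * norm (h $ q $ p))"

definition ratio_y :: "quat ^ 'n ^ 'n \<Rightarrow> real" where
  "ratio_y h = sqrt (norm (h $ p $ p) * norm (h $ q $ q))"

lemma ratio_nonneg: "ratio_x h \<ge> 0" "ratio_y h \<ge> 0"
  by (simp_all add: ratio_x_def ratio_y_def)

lemma ratio_sq: "(ratio_x h)\<^sup>2 = norm (h $ p $ q) * norm (h $ q $ p)"
  "(ratio_y h)\<^sup>2 = norm (h $ p $ p) * norm (h $ q $ q)"
  by (simp_all add: ratio_x_def ratio_y_def)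

lemma norm_entry: "norm (h $ p $ j) = norm (H (h *v axis j 1) (axis q 1))"
  "norm (h $ q $ j) = norm (H (h *v axis j 1) (axis p 1))"
  by (simp_all add: herm_axis_right mat_vec_axis)

lemma std_geodesic_distance:
  assumes h: "h \<in> carrier S" and P: "P \<in> std_geodesic" "Q \<in> std_geodesic"
  shows "2 * ratio_x h * ratio_y h \<le> cosh (rho p q (act h Q) P)"
proof -
  obtain s t where st: "s > 0" "t > 0" and PQ: "P = proj (dil t *v base)" "Q = proj (dil s *v base)"
    using P by (auto simp: std_geodesic_def)
  \<comment> \<open>Both points are moved to \<open>base\<close>. The dilations rescale the corners
    but keep the products of opposite ones, hence both ratios.\<close>
  define k where "k = adj (dil t) ** h ** dil s"
  have kS: "k \<in> carrier S" unfolding k_def by (intro Sp_mult adj_Sp dil_Sp h st)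
  have k: "H (k *v z) w = H (h *v (dil s *v z)) (dil t *v w)" for z w
    by (simp add: k_def herm_adj flip: matrix_vector_mul_assoc)
  have dil: "dil r *v axis p 1 = r *\<^sub>R axis p 1" "dil r *v axis q 1 = (1 / r) *\<^sub>R axis q 1" for r
    using pq by (simp_all add: dil_def diagonal_axis rscale_axis flip: rscale_of_real)
  have n: "norm (k $ p $ p) = s / t * norm (h $ p $ p)" "norm (k $ p $ q) = 1 / (s * t) * norm (h $ p $ q)"
    "norm (k $ q $ p) = s * t * norm (h $ q $ p)" "norm (k $ q $ q) = t / s * norm (h $ q $ q)"
    using st unfolding norm_entry k dil
    by (simp_all add: linear_scale[OF linear_mat_vec])
  define N where "N = norm (H (k *v base) base)"
  define r :: real where "r = 1 / sqrt 2"
  have r: "r > 0" "r * r = 1 / 2" by (simp_all add: r_def)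
  have unit: "H (r *\<^sub>R (dil u *v base)) (r *\<^sub>R (dil u *v base)) = - 1" if "u > 0" for u
  proof -
    have "H (dil u *v base) (dil u *v base) = - 2"
      unfolding Sp_herm[OF dil_Sp[OF that]] by (rule herm_base)
    then have "H (r *\<^sub>R (dil u *v base)) (r *\<^sub>R (dil u *v base)) = (r * r) *\<^sub>R (- 2)" by simp
    moreover have "(2 :: quat) = 2 *\<^sub>R 1" by (metis scaleR_2 one_add_one)
    ultimately show ?thesis unfolding r by simp
  qed
  have pr: "proj (r *\<^sub>R z) = proj z" for z :: "quat ^ 'n"
    using proj_rscale[of "of_real r" z] r by (simp add: rscale_of_real)
  have "cosh (rho p q (act h Q) P / 2) = norm (H (h *v (r *\<^sub>R (dil s *v base))) (r *\<^sub>R (dil t *v base)))"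
    using rho_proj(2)[of "h *v (r *\<^sub>R (dil s *v base))" "r *\<^sub>R (dil t *v base)"] unit st
    by (simp add: PQ act_proj Sp_herm[OF h] linear_scale[OF linear_mat_vec] pr)
  also have "\<dots> = N / 2"
    using r by (simp add: linear_scale[OF linear_mat_vec] N_def k flip: mult.assoc)
  finally have c: "cosh (rho p q (act h Q) P / 2) = N / 2" .
  \<comment> \<open>With N^2 at least 2 x^2 + 2 y^2 + 2, this yields cosh of the distance at least
    x^2 + y^2, hence at least 2 x y.\<close>
  have "cosh (rho p q (act h Q) P) = 2 * (N / 2)\<^sup>2 - 1"
    using cosh_double_cosh[of "rho p q (act h Q) P / 2"] c by simp
  then have C: "cosh (rho p q (act h Q) P) = N\<^sup>2 / 2 - 1" by (simp add: power_divide)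
  have AMGM: "2 * (u * v) \<le> u\<^sup>2 + v\<^sup>2" for u v :: real
    using sum_squares_bound[of u v] by simp
  have "norm (k $ p $ p) * norm (k $ q $ q) = (ratio_y h)\<^sup>2"
    "norm (k $ p $ q) * norm (k $ q $ p) = (ratio_x h)\<^sup>2"
    using st by (simp_all add: n ratio_sq)
  then have "2 * (ratio_y h)\<^sup>2 + 2 * (ratio_x h)\<^sup>2 + 2 \<le> N\<^sup>2"
    using herm_base_estimate[OF kS] AMGM[of "norm (k $ p $ p)" "norm (k $ q $ q)"]
      AMGM[of "norm (k $ p $ q)" "norm (k $ q $ p)"] unfolding N_def by linarith
  then show ?thesis using AMGM[of "ratio_x h" "ratio_y h"] by (simp add: C)
qed

text \<open>Cauchy-Schwarz for the middle parts of rows p and q, whose squared lengths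
  \<open>row_norms\<close> bounds by twice the products of their corners.\<close>

lemma sum_product_bound:
  assumes h: "h \<in> carrier S"
  shows "(\<Sum>m\<in>UNIV - {p, q}. norm (h $ p $ m) * norm (h $ q $ m)) \<le> 2 * (ratio_x h * ratio_y h)"
proof -
  let ?I = "UNIV - {p, q}"
  have nn: "0 \<le> inner (h $ i $ p) (h $ i $ q)" if "i = p \<or> i = q" for i
  proof -
    have "0 \<le> (\<Sum>m\<in>?I. (norm (h $ i $ m))\<^sup>2)" by (simp add: sum_nonneg)
    then show ?thesis using row_norms[OF h that] by linarith
  qed
  have "(\<Sum>m\<in>?I. norm (h $ p $ m) * norm (h $ q $ m))\<^sup>2
      \<le> (\<Sum>m\<in>?I. (norm (h $ p $ m))\<^sup>2) * (\<Sum>m\<in>?I. (norm (h $ q $ m))\<^sup>2)"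
    by (rule Cauchy_Schwarz_ineq_sum)
  also have "\<dots> = (2 * inner (h $ p $ p) (h $ p $ q)) * (2 * inner (h $ q $ p) (h $ q $ q))"
    by (simp only: row_norms[OF h] simp_thms)
  also have "\<dots> \<le> (2 * (norm (h $ p $ p) * norm (h $ p $ q))) * (2 * (norm (h $ q $ p) * norm (h $ q $ q)))"
    by (intro mult_mono) (simp_all add: norm_cauchy_schwarz nn)
  also have "\<dots> = (2 * (ratio_x h * ratio_y h))\<^sup>2"
    by (simp add: power_mult_distrib ratio_sq mult_ac)
  finally show ?thesis by (rule power2_le_imp_le) (simp add: ratio_nonneg)
qed

text \<open>For a null vector the squared middle length is at most twice |z_p| |z_q|, so
  Cauchy-Schwarz bounds the middle sum by exactly the mixed term of the square.\<close>

lemma herm_null_bound: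
  assumes P: "H P P = 0" and Q: "H Q Q = 0"
  shows "norm (H P Q) \<le> (sqrt (norm (P $ q) * norm (Q $ p)) + sqrt (norm (P $ p) * norm (Q $ q)))\<^sup>2"
proof -
  let ?I = "UNIV - {p, q}"
  have sq: "(\<Sum>i\<in>?I. (norm (z $ i))\<^sup>2) \<le> 2 * (norm (z $ p) * norm (z $ q))"
    if "H z z = 0" for z
    using qRe_herm_self[of z] that qRe_le_norm[of "qcnj (z $ p) * z $ q"] by (simp add: norm_mult)
  have "(\<Sum>i\<in>?I. norm (Q $ i) * norm (P $ i))\<^sup>2 \<le> (\<Sum>i\<in>?I. (norm (Q $ i))\<^sup>2) * (\<Sum>i\<in>?I. (norm (P $ i))\<^sup>2)"
    by (rule Cauchy_Schwarz_ineq_sum)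
  also have "\<dots> \<le> (2 * (norm (Q $ p) * norm (Q $ q))) * (2 * (norm (P $ p) * norm (P $ q)))"
    using sq[OF P] sq[OF Q] by (intro mult_mono) (simp_all add: sum_nonneg)
  also have "\<dots> = (2 * sqrt (norm (P $ q) * norm (Q $ p)) * sqrt (norm (P $ p) * norm (Q $ q)))\<^sup>2"
    by (simp add: power_mult_distrib mult_ac)
  finally have "(\<Sum>i\<in>?I. norm (Q $ i) * norm (P $ i))
      \<le> 2 * sqrt (norm (P $ q) * norm (Q $ p)) * sqrt (norm (P $ p) * norm (Q $ q))"
    by (rule power2_le_imp_le) simp
  moreover have "norm (\<Sum>i\<in>?I. qcnj (Q $ i) * P $ i) \<le> (\<Sum>i\<in>?I. norm (Q $ i) * norm (P $ i))"
    by (rule sum_norm_le) (simp add: norm_mult)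
  moreover have "norm (qcnj (Q $ p) * P $ q + qcnj (Q $ q) * P $ p)
      \<le> norm (Q $ p) * norm (P $ q) + norm (Q $ q) * norm (P $ p)"
    by (rule order_trans[OF norm_triangle_ineq]) (simp add: norm_mult)
  moreover have "norm (H P Q) \<le> norm (\<Sum>i\<in>?I. qcnj (Q $ i) * P $ i)
      + norm (qcnj (Q $ p) * P $ q + qcnj (Q $ q) * P $ p)"
    unfolding herm_def by (rule norm_triangle_ineq4)
  ultimately show ?thesis by (simp add: power2_sum mult_ac)
qed

text \<open>With the square root of |H| as distance of null vectors, this is Ptolemy's inequality.
  Once R and T are moved to the lines of e_p and e_q, pairings with them are coordinates and
  \<open>herm_null_bound\<close> applies.\<close>

lemma Ptolemy:
  assumes null: "H P P = 0" "H Q Q = 0" "H R R = 0" "H T T = 0" and RT: "H R T \<noteq> 0"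
  shows "norm (H P Q) * norm (H R T)
    \<le> (sqrt (norm (H P R) * norm (H Q T)) + sqrt (norm (H P T) * norm (H Q R)))\<^sup>2"
proof -
  have "R \<noteq> 0" "T \<noteq> 0" using RT by auto
  moreover have "proj R \<noteq> proj T"
    using null RT by (auto simp: proj_eq_iff herm_rscale_left)
  ultimately obtain A r t where A: "A \<in> carrier S" "A *v R = axis p r" "A *v T = axis q t"
    using null_pair_normal_form null by metis
  let ?P = "A *v P" and ?Q = "A *v Q"
  note HA = Sp_herm[OF A(1), symmetric]
  have R: "norm (H z R) = norm r * norm ((A *v z) $ q)" and T: "norm (H z T) = norm t * norm ((A *v z) $ p)" for z
    by (simp_all add: HA[of z] A axis_eq_rscale[of p r] axis_eq_rscale[of q t] herm_rscale_right
        herm_axis_right norm_mult)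
  have "norm (H R T) = norm r * norm t"
    using T[of R] by (simp add: A)
  moreover have "norm (H P Q) \<le> (sqrt (norm (?P $ q) * norm (?Q $ p)) + sqrt (norm (?P $ p) * norm (?Q $ q)))\<^sup>2"
    using herm_null_bound[of ?P ?Q] null by (simp add: Sp_herm A(1))
  ultimately have "norm (H P Q) * norm (H R T) \<le> (norm r * norm t) *
      (sqrt (norm (?P $ q) * norm (?Q $ p)) + sqrt (norm (?P $ p) * norm (?Q $ q)))\<^sup>2"
    by (simp add: mult.commute mult_left_mono)
  also have "\<dots> = (sqrt (norm r * norm t) * (sqrt (norm (?P $ q) * norm (?Q $ p)) + sqrt (norm (?P $ p) * norm (?Q $ q))))\<^sup>2"
    by (simp add: power_mult_distrib)
  also have "\<dots> = (sqrt (norm (H P R) * norm (H Q T)) + sqrt (norm (H P T) * norm (H Q R)))\<^sup>2"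
    by (simp add: R T distrib_left mult_ac flip: real_sqrt_mult)
  finally show ?thesis .
qed

text \<open>Ptolemy for h e_p, e_q, h e_q, e_p: the pairs h e_p, h e_q and e_q, e_p have pairing of
  norm 1, which gives the summand 1. The case of a zero corner is separated because
  \<open>Ptolemy\<close> divides by a pairing.\<close>

lemma ratio_triangle:
  assumes h: "h \<in> carrier S"
  shows "ratio_y h \<le> 1 + ratio_x h"
proof (cases "h $ q $ q = 0")
  case True
  then show ?thesis using ratio_nonneg(1)[of h] by (simp add: ratio_y_def)
next
  case False
  let ?U = "h *v axis p 1" and ?V = "h *v axis q 1" and ?u = "axis p 1" and ?v = "axis q 1"
  have ne: "H ?V ?u \<noteq> 0" using False by (simp add: herm_axis_right mat_vec_axis)
  have "norm (H ?V ?u) = norm (h $ q $ q)" "norm (H ?U ?v) = norm (h $ p $ p)"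
    "norm (H ?U ?u) = norm (h $ q $ p)" "norm (H ?v ?V) = norm (h $ p $ q)"
    "norm (H ?U ?V) = 1" "norm (H ?v ?u) = 1"
    by (simp_all add: norm_entry norm_herm_commute[of ?v] Sp_herm[OF h] herm_basis)
  moreover have "norm (H ?U ?v) * norm (H ?V ?u)
      \<le> (sqrt (norm (H ?U ?V) * norm (H ?v ?u)) + sqrt (norm (H ?U ?u) * norm (H ?v ?V)))\<^sup>2"
    by (intro Ptolemy) (simp_all add: Sp_herm[OF h] herm_basis ne)
  ultimately have "(ratio_y h)\<^sup>2 \<le> (1 + ratio_x h)\<^sup>2"
    by (simp add: ratio_sq ratio_x_def mult.commute)
  then show ?thesis by (rule power2_le_imp_le) (simp add: ratio_nonneg)
qed

end

section \<open>Discreteness\<close>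

text \<open>The separation must be uniform: a bounded set of isolated points may accumulate at a
  point outside it.\<close>

lemma finite_if_separated:
  fixes X :: "'a::heine_borel set"
  assumes e: "e > 0" and sep: "\<And>x y. x \<in> X \<Longrightarrow> y \<in> X \<Longrightarrow> dist x y < e \<Longrightarrow> x = y" and X: "bounded X"
  shows "finite X"
proof (rule ccontr)
  assume inf: "infinite X"
  have "closed X"
    using e sep by (intro discrete_imp_closed[of e]) auto
  with X have "compact X" by (simp add: compact_eq_bounded_closed)
  then obtain x where x: "x \<in> X" "x islimpt X"
    using Heine_Borel_imp_Bolzano_Weierstrass inf by blast
  then obtain y where "y \<in> X" "y \<noteq> x" "dist y x < e" using e islimpt_approachable by metis
  with sep x show False by blast
qed

lemma norm_vec_le_sum: "norm z \<le> (\<Sum>i\<in>UNIV. norm (z $ i))"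
  by (simp add: norm_vec_def L2_set_le_sum)

lemma norm_matrix_le:
  fixes A :: "quat ^ 'm::finite ^ 'n::finite" and C :: real
  assumes "\<And>i j. norm (A $ i $ j) \<le> C"
  shows "norm A \<le> CARD('n) * (CARD('m) * C)"
proof -
  have row: "norm (A $ i) \<le> CARD('m) * C" for i
    using norm_vec_le_sum[of "A $ i"] sum_bounded_above[of UNIV "\<lambda>j. norm (A $ i $ j)" C] assms by simp
  show ?thesis
    using norm_vec_le_sum[of A] sum_bounded_above[of UNIV "\<lambda>i. norm (A $ i)" "CARD('m) * C"] row by simp
qed

lemma norm_entry_le: "norm (A $ i $ j) \<le> norm A" for A :: "quat ^ 'm::finite ^ 'n::finite"
  using Finite_Cartesian_Product.norm_nth_le order_trans by metis

lemma matrix_diff_distrib_right: "A ** (B - C) = A ** B - A ** C"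
  for A :: "quat ^ 'm ^ 'n" and B C :: "quat ^ 'k ^ 'm"
  by (simp add: matrix_matrix_mult_def vec_eq_iff right_diff_distrib sum_subtractf)

lemma norm_mult_entry_le:
  fixes A :: "quat ^ 'm::finite ^ 'n::finite" and B :: "quat ^ 'k::finite ^ 'm"
    and C D :: real
  assumes "\<And>i j. norm (A $ i $ j) \<le> C" "\<And>i j. norm (B $ i $ j) \<le> D" "C \<ge> 0"
  shows "norm ((A ** B) $ i $ j) \<le> CARD('m) * (C * D)"
proof -
  have "norm ((A ** B) $ i $ j) \<le> (\<Sum>m\<in>UNIV. norm (A $ i $ m * B $ m $ j))"
    unfolding matrix_matrix_mult_def by (simp add: norm_sum)
  also have "\<dots> \<le> (\<Sum>m\<in>(UNIV :: 'm set). C * D)"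
    by (intro sum_mono) (simp add: norm_mult mult_mono assms)
  finally show ?thesis by simp
qed

context frame
begin

text \<open>Four corners control the whole matrix (\<open>entry_le\<close>), so finiteness in a
  discrete group can be read off from them alone.\<close>

definition corners_le :: "real \<Rightarrow> quat ^ 'n ^ 'n \<Rightarrow> bool" where
  "corners_le C h \<longleftrightarrow> norm (h $ p $ p) \<le> C \<and> norm (h $ p $ q) \<le> C \<and> norm (h $ q $ p) \<le> C \<and> norm (h $ q $ q) \<le> C"

lemma row_entry_le:
  assumes h: "h \<in> carrier S" and i: "i = p \<or> i = q" and C: "corners_le C h"
  shows "norm (h $ i $ m) \<le> 2 * C"
proof -
  have C0: "C \<ge> 0" using C norm_ge_zero order_trans unfolding corners_le_def by blast
  show ?thesis
  proof (cases "m = p \<or> m = q")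
    case True
    then have "norm (h $ i $ m) \<le> C" using i C unfolding corners_le_def by metis
    with C0 show ?thesis by simp
  next
    case False
    have "(norm (h $ i $ m))\<^sup>2 \<le> (\<Sum>m\<in>UNIV - {p, q}. (norm (h $ i $ m))\<^sup>2)"
      using False by (intro member_le_sum) auto
    also have "\<dots> = 2 * inner (h $ i $ p) (h $ i $ q)" by (rule row_norms[OF h i])
    also have "\<dots> \<le> 2 * (norm (h $ i $ p) * norm (h $ i $ q))" by (simp add: norm_cauchy_schwarz)
    also have "\<dots> \<le> 2 * (C * C)"
      using i C C0 by (intro mult_left_mono mult_mono) (auto simp: corners_le_def)
    also have "\<dots> \<le> (2 * C)\<^sup>2" by (simp add: power2_eq_square)
    finally show ?thesis by (rule power2_le_imp_le) (use C0 in simp)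
  qed
qed

lemma adj_corners: "norm (adj h $ p $ p) = norm (h $ q $ q)" "norm (adj h $ p $ q) = norm (h $ p $ q)"
  "norm (adj h $ q $ p) = norm (h $ q $ p)" "norm (adj h $ q $ q) = norm (h $ p $ p)"
  by (simp_all add: adj_nth)

lemma column_entry_le:
  assumes h: "h \<in> carrier S" and j: "j = p \<or> j = q" and C: "corners_le C h"
  shows "norm (h $ m $ j) \<le> 2 * C"
proof -
  have "corners_le C (adj h)" using C by (simp add: corners_le_def adj_corners)
  then have "norm (adj h $ sw j $ sw m) \<le> 2 * C" using j by (intro row_entry_le adj_Sp h) auto
  then show ?thesis by (simp add: adj_nth abs_mult)
qed

text \<open>A row outside p and q has form value 1, so its middle part has squared length 1 plus
  twice the inner product of its entries in columns p and q. These are at most 2 C, and the sum is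
  at most 9 C^2.\<close>

lemma entry_le:
  assumes h: "h \<in> carrier S" and C: "corners_le C h" "C \<ge> 1"
  shows "norm (h $ i $ m) \<le> 3 * C"
proof (cases "i \<in> {p, q} \<or> m \<in> {p, q}")
  case True
  then have "norm (h $ i $ m) \<le> 2 * C" using row_entry_le[OF h _ C(1)] column_entry_le[OF h _ C(1)] by blast
  with C show ?thesis by simp
next
  case False
  have "(\<Sum>m\<in>UNIV. (sg m * sg i) *\<^sub>R (h $ i $ m * qcnj (h $ i $ sw m))) = 1"
    using row_relation[OF h, of i i] False by simp
  then have "(\<Sum>m\<in>UNIV - {p, q}. (sg m * sg i) *\<^sub>R (h $ i $ m * qcnj (h $ i $ sw m)))
      - h $ i $ p * qcnj (h $ i $ q) - h $ i $ q * qcnj (h $ i $ p) = 1"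
    using False by (subst (asm) sum_UNIV_split) simp
  from arg_cong[OF this, of qRe]
  have "(\<Sum>m\<in>UNIV - {p, q}. qRe ((sg m * sg i) *\<^sub>R (h $ i $ m * qcnj (h $ i $ sw m))))
      - inner (h $ i $ p) (h $ i $ q) - inner (h $ i $ q) (h $ i $ p) = 1"
    by (simp add: qRe_sum qRe_mult_qcnj del: quat_times_simps(5))
  moreover have "qRe ((sg m * sg i) *\<^sub>R (h $ i $ m * qcnj (h $ i $ sw m))) = (norm (h $ i $ m))\<^sup>2"
    if "m \<in> UNIV - {p, q}" for m
    using that False by (auto simp: mult_qcnj simp del: quat_times_simps(5) of_real_power)
  ultimately have "(\<Sum>m\<in>UNIV - {p, q}. (norm (h $ i $ m))\<^sup>2) = 1 + 2 * inner (h $ i $ p) (h $ i $ q)"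
    by (simp add: inner_commute)
  also have "\<dots> \<le> 1 + 2 * (norm (h $ i $ p) * norm (h $ i $ q))" by (simp add: norm_cauchy_schwarz)
  also have "\<dots> \<le> C\<^sup>2 + 2 * ((2 * C) * (2 * C))"
    using C column_entry_le[OF h _ C(1)] by (intro add_mono mult_left_mono mult_mono) auto
  also have "\<dots> = (3 * C)\<^sup>2" by (simp add: power2_eq_square)
  finally have "(\<Sum>m\<in>UNIV - {p, q}. (norm (h $ i $ m))\<^sup>2) \<le> (3 * C)\<^sup>2" .
  moreover have "(norm (h $ i $ m))\<^sup>2 \<le> (\<Sum>m\<in>UNIV - {p, q}. (norm (h $ i $ m))\<^sup>2)"
    using False by (intro member_le_sum) auto
  ultimately have "(norm (h $ i $ m))\<^sup>2 \<le> (3 * C)\<^sup>2" by linarith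
  then show ?thesis by (rule power2_le_imp_le) (use C in simp)
qed

lemma norm_adj_entry: "norm (adj h $ i $ j) = norm (h $ sw j $ sw i)"
  by (simp add: adj_nth abs_mult)

text \<open>Isolation of the identity is carried to every h by left translation. Entry bounds on h
  bound its inverse, so the separation is uniform on the bounded part.\<close>

lemma discrete_bounded_finite:
  assumes G: "subgroup G S" and disc: "discrete G"
  shows "finite {h \<in> G. \<forall>i j. norm (h $ i $ j) \<le> C}" (is "finite ?X")
proof (cases "C \<ge> 0")
  case False
  then have "\<not> norm (h $ p $ p) \<le> C" for h :: "quat ^ 'n ^ 'n"
    using norm_ge_zero[of "h $ p $ p"] by linarith
  then have "?X = {}" by blast
  then show ?thesis by (simp only: finite.emptyI)
next
  case C: True
  have "mat 1 \<in> G" using subgroup.one_closed[OF G] by (simp add: one_Sp)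
  then obtain e where e: "e > 0" "\<And>y. y \<in> G \<Longrightarrow> dist (mat 1) y < e \<Longrightarrow> y = mat 1"
    using disc unfolding discrete_def isolated_in_dist_Ex_iff by blast
  define N where "N = real CARD('n)"
  have N: "N \<ge> 1" by (simp add: N_def Suc_leI)
  \<comment> \<open>The Lipschitz constant of multiplication by \<open>adj h\<close>, from three
    entry sums; the added 1 keeps it positive when C = 0.\<close>
  define K where "K = N * (N * (N * C)) + 1"
  have K: "K > 0" using N C by (simp add: K_def add_nonneg_pos)
  show ?thesis
  proof (rule finite_if_separated)
    show "e / K > 0" using e K by simp
    have "norm h \<le> N * (N * C)" if "h \<in> ?X" for h
      unfolding N_def using that by (intro norm_matrix_le) auto
    then show "bounded ?X" by (auto simp: bounded_iff)
    fix h k assume h: "h \<in> ?X" and k: "k \<in> ?X" and d: "dist h k < e / K"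
    have hS: "h \<in> carrier S" and kS: "k \<in> carrier S" using h k subgroup.subset[OF G] by auto
    have "adj h \<in> G" using subgroup.m_inv_closed[OF G, of h] h by (simp add: inv_Sp[OF hS])
    then have "adj h ** k \<in> G" using subgroup.m_closed[OF G, of "adj h" k] k by (simp add: mult_Sp)
    moreover have "dist (mat 1) (adj h ** k) < e"
    proof -
      have "adj h ** (k - h) = adj h ** k - mat 1"
        by (simp add: matrix_diff_distrib_right Sp_adj(1)[OF hS])
      then have "dist (mat 1) (adj h ** k) = norm (adj h ** (k - h))"
        by (simp add: dist_norm norm_minus_commute)
      also have "\<dots> \<le> N * (N * (N * (C * dist h k)))"
        unfolding N_def
      proof (intro norm_matrix_le norm_mult_entry_le C)
        show "norm (adj h $ i $ j) \<le> C" for i j using h by (simp add: norm_adj_entry)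
        show "norm ((k - h) $ i $ j) \<le> dist h k" for i j
          using norm_entry_le[of "k - h" i j] by (simp add: dist_norm norm_minus_commute)
      qed
      also have "\<dots> \<le> K * dist h k" by (simp add: K_def algebra_simps)
      also have "\<dots> < e" using d K by (simp add: field_simps)
      finally show ?thesis .
    qed
    ultimately have "adj h ** k = mat 1" by (rule e)
    then have "h ** (adj h ** k) = h" by simp
    then show "h = k" by (simp add: matrix_mul_assoc Sp_adj[OF hS])
  qed
qed

end

text \<open>Take the least n with u / K^n below \<eta>. One power earlier the quotient is still at
  least \<eta>, and this overshoot by at most K is the reason for the divisor K in the bound on u
  v.\<close>

lemma power_balance:
  fixes u v :: real
  assumes K: "K > 1" and \<eta>: "\<eta> > 0" and u: "u \<ge> 0" and v: "v \<ge> 0" and uv: "u * v < \<eta>\<^sup>2 / K"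
    and ge: "u \<ge> \<eta>"
  shows "\<exists>n. u / K ^ n < \<eta> \<and> v * K ^ n < \<eta>"
proof -
  have "\<exists>n. u / \<eta> < K ^ n" using real_arch_pow[OF K] by blast
  then have ex: "\<exists>n. u / K ^ n < \<eta>" using K \<eta> by (simp add: field_simps)
  define n where "n = (LEAST n. u / K ^ n < \<eta>)"
  have n: "u / K ^ n < \<eta>" unfolding n_def using ex by (rule LeastI_ex)
  have "n \<noteq> 0"
  proof
    assume "n = 0"
    with n ge show False by simp
  qed
  then obtain m where m: "n = Suc m" by (cases n) auto
  have "\<not> u / K ^ m < \<eta>" using not_less_Least[of m "\<lambda>n. u / K ^ n < \<eta>"] m n_def by simp
  then have "\<eta> * K ^ m \<le> u" using K by (simp add: field_simps not_less)
  then have "\<eta> * K ^ m * v \<le> u * v" using v by (rule mult_right_mono)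
  also have "\<dots> < \<eta>\<^sup>2 / K" by (rule uv)
  finally have "\<eta> * (v * K ^ n) < \<eta> * \<eta>" using K by (simp add: m field_simps power2_eq_square)
  with n \<eta> show ?thesis by auto
qed

text \<open>The situation after g has been made diagonal. Discreteness is recorded as
  \<open>G_finite\<close>, the form in which it is used; \<open>cj_group\<close> transfers it to the
  conjugated group.\<close>

locale diag_group = frame p q for p q :: "'n::finite" +
  fixes G :: "(quat ^ 'n ^ 'n) set" and l :: "'n \<Rightarrow> quat"
  assumes G_Sp: "G \<subseteq> carrier S"
    and G_mult: "\<And>h k. h \<in> G \<Longrightarrow> k \<in> G \<Longrightarrow> h ** k \<in> G"
    and G_adj: "\<And>h. h \<in> G \<Longrightarrow> adj h \<in> G"
    and G_finite: "\<And>C. finite {h \<in> G. \<forall>i j. norm (h $ i $ j) \<le> C}"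
    and l_G: "diagonal l \<in> G"
    and l_p: "norm (l p) > 1"
begin

lemma GS: "h \<in> G \<Longrightarrow> h \<in> carrier S" using G_Sp by blast

lemma l_norms: "norm (l q) = 1 / norm (l p)" "i \<noteq> p \<Longrightarrow> i \<noteq> q \<Longrightarrow> norm (l i) = 1"
proof -
  have "norm (l q) * norm (l p) = 1"
    using diagonal_Sp_entries(1)[OF GS[OF l_G]] by (metis norm_mult norm_one norm_qcnj)
  moreover have "norm (l p) \<noteq> 0" using l_p by auto
  ultimately show "norm (l q) = 1 / norm (l p)" by (simp add: field_simps)
qed (rule diagonal_Sp_entries(2)[OF GS[OF l_G]])

lemma l_le: "norm (l i) \<le> norm (l p)"
proof -
  have "1 / norm (l p) \<le> norm (l p)"
    using l_p mult_mono[of 1 "norm (l p)" 1 "norm (l p)"] by (simp add: divide_le_eq)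
  then show ?thesis using l_norms l_p by (cases "i = p"; cases "i = q") auto
qed

lemma corners_finite: "finite {h \<in> G. corners_le C h}"
proof (rule finite_subset[OF _ G_finite[of "3 * max C 1"]])
  show "{h \<in> G. corners_le C h} \<subseteq> {h \<in> G. \<forall>i j. norm (h $ i $ j) \<le> 3 * max C 1}"
  proof safe
    fix h i j assume "h \<in> G" "corners_le C h"
    then show "norm (h $ i $ j) \<le> 3 * max C 1"
      by (intro entry_le GS) (auto simp: corners_le_def)
  qed
qed

lemma conj_corner:
  "norm ((adj (diagonal l) ** h ** diagonal l) $ p $ p) = norm (h $ p $ p)"
    "norm ((adj (diagonal l) ** h ** diagonal l) $ p $ q) = norm (h $ p $ q) / (norm (l p))\<^sup>2"
    "norm ((adj (diagonal l) ** h ** diagonal l) $ q $ p) = norm (h $ q $ p) * (norm (l p))\<^sup>2"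
    "norm ((adj (diagonal l) ** h ** diagonal l) $ q $ q) = norm (h $ q $ q)"
proof -
  have k: "H ((adj (diagonal l) ** h ** diagonal l) *v z) w = H (h *v (diagonal l *v z)) (diagonal l *v w)" for z w
    using herm_adj[of "adj (diagonal l)" "h *v (diagonal l *v z)" w] by (simp flip: matrix_vector_mul_assoc)
  have d: "diagonal l *v axis i 1 = rscale (axis i 1) (l i)" for i by (simp add: diagonal_axis rscale_axis)
  have "norm (l p) \<noteq> 0" using l_p by auto
  then show "norm ((adj (diagonal l) ** h ** diagonal l) $ p $ p) = norm (h $ p $ p)"
    "norm ((adj (diagonal l) ** h ** diagonal l) $ p $ q) = norm (h $ p $ q) / (norm (l p))\<^sup>2"
    "norm ((adj (diagonal l) ** h ** diagonal l) $ q $ p) = norm (h $ q $ p) * (norm (l p))\<^sup>2"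
    "norm ((adj (diagonal l) ** h ** diagonal l) $ q $ q) = norm (h $ q $ q)"
    unfolding norm_entry k d
    by (simp_all add: mat_vec_rscale herm_rscale_left herm_rscale_right norm_mult l_norms power2_eq_square)
qed

lemma conj_corner':
  "norm ((diagonal l ** h ** adj (diagonal l)) $ p $ p) = norm (h $ p $ p)"
    "norm ((diagonal l ** h ** adj (diagonal l)) $ p $ q) = norm (h $ p $ q) * (norm (l p))\<^sup>2"
    "norm ((diagonal l ** h ** adj (diagonal l)) $ q $ p) = norm (h $ q $ p) / (norm (l p))\<^sup>2"
    "norm ((diagonal l ** h ** adj (diagonal l)) $ q $ q) = norm (h $ q $ q)"
proof -
  let ?k = "diagonal l ** h ** adj (diagonal l)"
  have "adj (diagonal l) ** ?k ** diagonal l = (adj (diagonal l) ** diagonal l) ** h ** (adj (diagonal l) ** diagonal l)"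
    by (simp only: matrix_mul_assoc)
  then have h: "adj (diagonal l) ** ?k ** diagonal l = h" by (simp add: Sp_adj[OF GS[OF l_G]])
  from conj_corner[of ?k] have *: "norm (h $ p $ p) = norm (?k $ p $ p)"
    "norm (h $ p $ q) = norm (?k $ p $ q) / (norm (l p))\<^sup>2"
    "norm (h $ q $ p) = norm (?k $ q $ p) * (norm (l p))\<^sup>2"
    "norm (h $ q $ q) = norm (?k $ q $ q)"
    unfolding h by simp_all
  have "norm (l p) \<noteq> 0" using l_p by auto
  then show "norm (?k $ p $ p) = norm (h $ p $ p)" "norm (?k $ p $ q) = norm (h $ p $ q) * (norm (l p))\<^sup>2"
    "norm (?k $ q $ p) = norm (h $ q $ p) / (norm (l p))\<^sup>2" "norm (?k $ q $ q) = norm (h $ q $ q)"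
    unfolding * by simp_all
qed

lemma conj_power:
  assumes h: "h \<in> G"
  shows "\<exists>k\<in>G. norm (k $ p $ p) = norm (h $ p $ p) \<and> norm (k $ q $ q) = norm (h $ q $ q) \<and>
      norm (k $ p $ q) = norm (h $ p $ q) / ((norm (l p))\<^sup>2) ^ n \<and>
      norm (k $ q $ p) = norm (h $ q $ p) * ((norm (l p))\<^sup>2) ^ n"
    "\<exists>k\<in>G. norm (k $ p $ p) = norm (h $ p $ p) \<and> norm (k $ q $ q) = norm (h $ q $ q) \<and>
      norm (k $ p $ q) = norm (h $ p $ q) * ((norm (l p))\<^sup>2) ^ n \<and>
      norm (k $ q $ p) = norm (h $ q $ p) / ((norm (l p))\<^sup>2) ^ n"
proof (induction n)
  case 0
  {
    case 1 from h show ?case by auto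
  next
    case 2 from h show ?case by auto
  }
next
  case (Suc n)
  {
    case 1
    from Suc(1) obtain k where k: "k \<in> G" "norm (k $ p $ p) = norm (h $ p $ p)" "norm (k $ q $ q) = norm (h $ q $ q)"
      "norm (k $ p $ q) = norm (h $ p $ q) / ((norm (l p))\<^sup>2) ^ n"
      "norm (k $ q $ p) = norm (h $ q $ p) * ((norm (l p))\<^sup>2) ^ n" by blast
    then show ?case
      by (intro bexI[of _ "adj (diagonal l) ** k ** diagonal l"] G_mult G_adj l_G) (simp_all add: conj_corner)
  next
    case 2
    from Suc(2) obtain k where k: "k \<in> G" "norm (k $ p $ p) = norm (h $ p $ p)" "norm (k $ q $ q) = norm (h $ q $ q)"
      "norm (k $ p $ q) = norm (h $ p $ q) * ((norm (l p))\<^sup>2) ^ n"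
      "norm (k $ q $ p) = norm (h $ q $ p) / ((norm (l p))\<^sup>2) ^ n" by blast
    then show ?case
      by (intro bexI[of _ "diagonal l ** k ** adj (diagonal l)"] G_mult G_adj l_G) (simp_all add: conj_corner')
  }
qed

text \<open>Conjugating by a power of \<open>diagonal l\<close> balances the two off-diagonal corners without changing
  their product; so if the product is tiny, both can be made smaller than any nonzero corner occurring
  in a finite subset of the group.\<close>

lemma small_ratio_vanishes:
  "\<exists>\<epsilon>>0. \<forall>h\<in>G. norm (h $ p $ p) \<le> C \<longrightarrow> norm (h $ q $ q) \<le> C \<longrightarrow> ratio_x h < \<epsilon> \<longrightarrow>
     h $ p $ q = 0 \<and> h $ q $ p = 0"
proof -
  define F where "F = {h \<in> G. corners_le (max C 1) h}"
  \<comment> \<open>Zero is removed so that the minimum is positive. The inserted 1 keeps the set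
    nonempty and the minimum at most 1, so that corners below it meet the bound defining
    \<open>F\<close>.\<close>
  define V where "V = insert 1 (((\<lambda>h. norm (h $ p $ q)) ` F \<union> (\<lambda>h. norm (h $ q $ p)) ` F) - {0})"
  have finV: "finite V" using corners_finite by (simp add: V_def F_def)
  define \<eta> where "\<eta> = Min V"
  have \<eta>0: "\<eta> > 0" unfolding \<eta>_def using finV by (subst Min_gr_iff) (auto simp: V_def)
  have \<eta>1: "\<eta> \<le> 1" unfolding \<eta>_def using finV by (intro Min_le) (auto simp: V_def)
  have small: "k $ p $ q = 0 \<and> k $ q $ p = 0"
    if k: "k \<in> G" "norm (k $ p $ p) \<le> C" "norm (k $ q $ q) \<le> C" and lt: "norm (k $ p $ q) < \<eta>" "norm (k $ q $ p) < \<eta>" for k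
  proof -
    have "k \<in> F" using k lt \<eta>1 by (auto simp: F_def corners_le_def)
    moreover have "v \<notin> V" if "v < \<eta>" for v
      using that Min_le[OF finV, of v] by (auto simp: \<eta>_def)
    ultimately show ?thesis using lt unfolding V_def by (metis (no_types, lifting) DiffI UnCI image_eqI insertCI norm_eq_zero singletonD)
  qed
  define K where "K = (norm (l p))\<^sup>2"
  have K: "K > 1" using l_p by (simp add: K_def)
  show ?thesis
  \<comment> \<open>Squaring this threshold gives the bound on the corner product that
    \<open>power_balance\<close> asks for.\<close>
  proof (intro exI[of _ "\<eta> / sqrt K"] conjI ballI impI)
    show "\<eta> / sqrt K > 0" using \<eta>0 K by simp
    fix h assume h: "h \<in> G" "norm (h $ p $ p) \<le> C" "norm (h $ q $ q) \<le> C" "ratio_x h < \<eta> / sqrt K"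
    let ?u = "norm (h $ p $ q)" and ?v = "norm (h $ q $ p)"
    have "(ratio_x h)\<^sup>2 < (\<eta> / sqrt K)\<^sup>2" using h(4) ratio_nonneg by (intro power_strict_mono) auto
    then have uv: "?u * ?v < \<eta>\<^sup>2 / K" using K by (simp add: ratio_sq power_divide)
    have "\<exists>k\<in>G. norm (k $ p $ p) = norm (h $ p $ p) \<and> norm (k $ q $ q) = norm (h $ q $ q) \<and>
        norm (k $ p $ q) < \<eta> \<and> norm (k $ q $ p) < \<eta> \<and>
        (k $ p $ q = 0 \<longleftrightarrow> h $ p $ q = 0) \<and> (k $ q $ p = 0 \<longleftrightarrow> h $ q $ p = 0)"
    proof -
      consider "?u \<ge> \<eta>" | "?v \<ge> \<eta>" | "?u < \<eta>" "?v < \<eta>" by linarith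
      then show ?thesis
      proof cases
        case 1
        obtain n where n: "?u / K ^ n < \<eta>" "?v * K ^ n < \<eta>"
          using power_balance[OF K \<eta>0 _ _ uv 1] by auto
        obtain k where k: "k \<in> G" "norm (k $ p $ p) = norm (h $ p $ p)" "norm (k $ q $ q) = norm (h $ q $ q)"
          "norm (k $ p $ q) = ?u / K ^ n" "norm (k $ q $ p) = ?v * K ^ n"
          using conj_power(1)[OF h(1), of n] unfolding K_def by blast
        have "K \<noteq> 0" using K by simp
        then have "norm (k $ p $ q) = 0 \<longleftrightarrow> ?u = 0" "norm (k $ q $ p) = 0 \<longleftrightarrow> ?v = 0"
          unfolding k by simp_all
        moreover have "norm (k $ p $ q) < \<eta>" "norm (k $ q $ p) < \<eta>" unfolding k by (rule n)+
        ultimately show ?thesis using k(1-3) unfolding norm_eq_zero by blast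
      next
        case 2
        obtain n where n: "?v / K ^ n < \<eta>" "?u * K ^ n < \<eta>"
          using power_balance[OF K \<eta>0 _ _ _ 2, of ?u] uv by (auto simp: mult.commute)
        obtain k where k: "k \<in> G" "norm (k $ p $ p) = norm (h $ p $ p)" "norm (k $ q $ q) = norm (h $ q $ q)"
          "norm (k $ p $ q) = ?u * K ^ n" "norm (k $ q $ p) = ?v / K ^ n"
          using conj_power(2)[OF h(1), of n] unfolding K_def by blast
        have "K \<noteq> 0" using K by simp
        then have "norm (k $ p $ q) = 0 \<longleftrightarrow> ?u = 0" "norm (k $ q $ p) = 0 \<longleftrightarrow> ?v = 0"
          unfolding k by simp_all
        moreover have "norm (k $ p $ q) < \<eta>" "norm (k $ q $ p) < \<eta>" unfolding k by (rule n)+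
        ultimately show ?thesis using k(1-3) unfolding norm_eq_zero by blast
      next
        case 3
        with h show ?thesis by blast
      qed
    qed
    then obtain k where k: "k \<in> G" "norm (k $ p $ p) = norm (h $ p $ p)" "norm (k $ q $ q) = norm (h $ q $ q)"
        "norm (k $ p $ q) < \<eta>" "norm (k $ q $ p) < \<eta>"
        "k $ p $ q = 0 \<longleftrightarrow> h $ p $ q = 0" "k $ q $ p = 0 \<longleftrightarrow> h $ q $ p = 0" by blast
    then have "k $ p $ q = 0 \<and> k $ q $ p = 0" using h by (intro small) auto
    with k show "h $ p $ q = 0" "h $ q $ p = 0" by simp_all
  qed
qed

end

section \<open>Joergensen's iteration\<close>

lemma mult_diagonal: "(A ** diagonal l) $ i $ j = A $ i $ j * l j" for A :: "quat ^ 'm::finite ^ 'n"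
proof -
  have "(A ** diagonal l) $ i $ j = (A *v (diagonal l *v axis j 1)) $ i"
    using mat_vec_axis[of "A ** diagonal l" j 1 i] by (simp add: matrix_vector_mul_assoc)
  then show ?thesis by (simp add: diagonal_axis mat_vec_axis)
qed

lemma geometric_below:
  fixes x :: "nat \<Rightarrow> real"
  assumes \<theta>: "0 \<le> \<theta>" "\<theta> < 1" and step: "\<And>k. x (Suc k) \<le> \<theta> * x k" and e: "\<epsilon> > 0"
  shows "\<exists>k. x k < \<epsilon>"
proof -
  have "x k \<le> \<theta> ^ k * x 0" for k
  proof (induction k)
    case (Suc k)
    have "x (Suc k) \<le> \<theta> * x k" by (rule step)
    also have "\<dots> \<le> \<theta> * (\<theta> ^ k * x 0)" using Suc \<theta> by (intro mult_left_mono)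
    finally show ?case by (simp add: mult.assoc)
  qed simp
  moreover have "(\<lambda>k. \<theta> ^ k * x 0) \<longlonglongrightarrow> 0 * x 0"
    using \<theta> by (intro tendsto_intros LIMSEQ_power_zero) simp
  then have "\<forall>\<^sub>F k in sequentially. \<theta> ^ k * x 0 < \<epsilon>" using e by (intro order_tendstoD) simp_all
  then obtain k where "\<theta> ^ k * x 0 < \<epsilon>" by (auto simp: eventually_sequentially)
  ultimately show ?thesis using le_less_trans by blast
qed

context frame
begin

definition conj_diag :: "('n \<Rightarrow> quat) \<Rightarrow> quat ^ 'n ^ 'n \<Rightarrow> quat ^ 'n ^ 'n" where
  "conj_diag l h = h ** diagonal l ** adj h"

lemma conj_diag_entry:
  "conj_diag l h $ i $ j = (\<Sum>m\<in>UNIV. (sg m * sg j) *\<^sub>R (h $ i $ m * l m * qcnj (h $ sw j $ sw m)))"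
  unfolding conj_diag_def
  by (subst matrix_matrix_mult_def) (simp add: mult_diagonal adj_nth)

text \<open>Subtracting the entry of h h^(-1) = 1, which is zero here, turns each l_m into l_m - 1.
  The middle terms are at most \<delta> times the squared middle length of the row, so
  \<open>row_norms\<close> makes their share 2 \<delta>; the two corner terms give the rest of the
  factor.\<close>

lemma conj_diag_off_diagonal:
  assumes h: "h \<in> carrier S" and i: "i = p \<or> i = q"
    and \<delta>0: "\<delta> \<ge> 0" and \<delta>: "\<And>m. m \<noteq> p \<Longrightarrow> m \<noteq> q \<Longrightarrow> norm (l m - 1) \<le> \<delta>"
  shows "norm (conj_diag l h $ i $ sw i)
    \<le> (2 * \<delta> + norm (l p - 1) + norm (l q - 1)) * (norm (h $ i $ p) * norm (h $ i $ q))"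
proof -
  let ?t = "\<lambda>x m. (sg m * sg i) *\<^sub>R (h $ i $ m * x m * qcnj (h $ i $ sw m))"
  have d: "norm (\<Sum>m\<in>UNIV - {p, q}. ?t (\<lambda>m. l m - 1) m) \<le> \<delta> * (\<Sum>m\<in>UNIV - {p, q}. (norm (h $ i $ m))\<^sup>2)"
    unfolding sum_distrib_left
  proof (rule sum_norm_le)
    fix m assume m: "m \<in> UNIV - {p, q}"
    then have "norm (?t (\<lambda>m. l m - 1) m) = norm (l m - 1) * (norm (h $ i $ m))\<^sup>2"
      by (simp add: norm_mult abs_mult power2_eq_square)
    also have "\<dots> \<le> \<delta> * (norm (h $ i $ m))\<^sup>2" using \<delta> m by (intro mult_right_mono) auto
    finally show "norm (?t (\<lambda>m. l m - 1) m) \<le> \<delta> * (norm (h $ i $ m))\<^sup>2" .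
  qed
  have "\<delta> * (\<Sum>m\<in>UNIV - {p, q}. (norm (h $ i $ m))\<^sup>2) \<le> \<delta> * (2 * (norm (h $ i $ p) * norm (h $ i $ q)))"
    unfolding row_norms[OF h i] using \<delta>0 by (intro mult_left_mono) (simp_all add: norm_cauchy_schwarz)
  with d have 1: "norm (\<Sum>m\<in>UNIV - {p, q}. ?t (\<lambda>m. l m - 1) m) \<le> \<delta> * (2 * (norm (h $ i $ p) * norm (h $ i $ q)))"
    by linarith
  have ne: "i \<noteq> sw i" using i pq by auto
  have "conj_diag l h $ i $ sw i = (\<Sum>m\<in>UNIV. ?t l m) - (\<Sum>m\<in>UNIV. ?t (\<lambda>_. 1) m)"
    using row_relation[OF h, of "sw i" i] ne by (simp add: conj_diag_entry)
  also have "\<dots> = (\<Sum>m\<in>UNIV. ?t (\<lambda>m. l m - 1) m)"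
    by (simp add: algebra_simps scaleR_right_diff_distrib flip: sum_subtractf)
  also have "\<dots> = (\<Sum>m\<in>UNIV - {p, q}. ?t (\<lambda>m. l m - 1) m) + ?t (\<lambda>m. l m - 1) p + ?t (\<lambda>m. l m - 1) q"
    by (rule sum_UNIV_split)
  finally have e: "conj_diag l h $ i $ sw i = (\<Sum>m\<in>UNIV - {p, q}. ?t (\<lambda>m. l m - 1) m)
      + ?t (\<lambda>m. l m - 1) p + ?t (\<lambda>m. l m - 1) q" .
  have "norm (a + b + c) \<le> norm a + norm b + norm c" for a b c :: quat
    using norm_triangle_ineq[of "a + b" c] norm_triangle_ineq[of a b] by linarith
  from this[of "\<Sum>m\<in>UNIV - {p, q}. ?t (\<lambda>m. l m - 1) m" "?t (\<lambda>m. l m - 1) p" "?t (\<lambda>m. l m - 1) q"]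
  have "norm (conj_diag l h $ i $ sw i) \<le> norm (\<Sum>m\<in>UNIV - {p, q}. ?t (\<lambda>m. l m - 1) m)
      + norm (?t (\<lambda>m. l m - 1) p) + norm (?t (\<lambda>m. l m - 1) q)"
    unfolding e .
  moreover have "norm (?t (\<lambda>m. l m - 1) p) = norm (l p - 1) * (norm (h $ i $ p) * norm (h $ i $ q))"
    "norm (?t (\<lambda>m. l m - 1) q) = norm (l q - 1) * (norm (h $ i $ p) * norm (h $ i $ q))"
    using i by (auto simp: norm_mult)
  ultimately show ?thesis using 1 by (simp add: algebra_simps)
qed

text \<open>Keeps the diagonal corners of the iterates bounded, as
  \<open>small_ratio_vanishes\<close> requires. The corner terms give x^2 + y^2 and
  \<open>sum_product_bound\<close> supplies 2 x y.\<close>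

lemma conj_diag_diagonal:
  assumes h: "h \<in> carrier S" and i: "i = p \<or> i = q" and L: "\<And>m. norm (l m) \<le> L"
  shows "norm (conj_diag l h $ i $ i) \<le> L * (ratio_x h + ratio_y h)\<^sup>2"
proof -
  have "norm (conj_diag l h $ i $ i) \<le> (\<Sum>m\<in>UNIV. L * (norm (h $ i $ m) * norm (h $ sw i $ sw m)))"
    unfolding conj_diag_entry
  proof (rule sum_norm_le)
    fix m
    have "norm ((sg m * sg i) *\<^sub>R (h $ i $ m * l m * qcnj (h $ sw i $ sw m)))
        = norm (l m) * (norm (h $ i $ m) * norm (h $ sw i $ sw m))"
      by (simp add: norm_mult abs_mult)
    also have "\<dots> \<le> L * (norm (h $ i $ m) * norm (h $ sw i $ sw m))"
      using L by (intro mult_right_mono) auto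
    finally show "norm ((sg m * sg i) *\<^sub>R (h $ i $ m * l m * qcnj (h $ sw i $ sw m)))
        \<le> L * (norm (h $ i $ m) * norm (h $ sw i $ sw m))" .
  qed
  also have "\<dots> = L * ((\<Sum>m\<in>UNIV - {p, q}. norm (h $ p $ m) * norm (h $ q $ m)) + (ratio_y h)\<^sup>2 + (ratio_x h)\<^sup>2)"
    unfolding sum_distrib_left[symmetric] ratio_sq using i
    by (subst sum_UNIV_split) (auto simp: mult.commute algebra_simps)
  also have "\<dots> \<le> L * (2 * (ratio_x h * ratio_y h) + (ratio_y h)\<^sup>2 + (ratio_x h)\<^sup>2)"
    using sum_product_bound[OF h] L norm_ge_zero order_trans
    by (intro mult_left_mono add_right_mono) blast+
  also have "\<dots> = L * (ratio_x h + ratio_y h)\<^sup>2" by (simp add: power2_sum algebra_simps)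
  finally show ?thesis .
qed

lemma ratios_not_both_zero:
  assumes h: "h \<in> carrier S" shows "\<not> (ratio_x h = 0 \<and> ratio_y h = 0)"
proof
  assume z: "ratio_x h = 0 \<and> ratio_y h = 0"
  have "norm (\<Sum>m\<in>UNIV - {p, q}. h $ p $ m * qcnj (h $ q $ m)) \<le> (\<Sum>m\<in>UNIV - {p, q}. norm (h $ p $ m) * norm (h $ q $ m))"
    by (rule sum_norm_le) (simp add: norm_mult)
  also have "\<dots> \<le> 0" using sum_product_bound[OF h] z by simp
  finally have 0: "(\<Sum>m\<in>UNIV - {p, q}. h $ p $ m * qcnj (h $ q $ m)) = 0" by simp
  have "h $ p $ p * qcnj (h $ q $ q) = 0" "h $ p $ q * qcnj (h $ q $ p) = 0"
    using z by (auto simp: ratio_x_def ratio_y_def)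
  from row_product[OF h, unfolded 0 this] show False by simp
qed

text \<open>Two corners suffice: columns p and q of an element of Sp(n, 1) are null, so a vanishing
  corner leaves only one nonzero entry (\<open>column_axis\<close>).\<close>

definition fixes_pair :: "quat ^ 'n ^ 'n \<Rightarrow> bool" where
  "fixes_pair h \<longleftrightarrow> h $ p $ q = 0 \<and> h $ q $ p = 0"

definition swaps_pair :: "quat ^ 'n ^ 'n \<Rightarrow> bool" where
  "swaps_pair h \<longleftrightarrow> h $ p $ p = 0 \<and> h $ q $ q = 0"

lemma column_axis:
  assumes h: "h \<in> carrier S" and j: "j = p \<or> j = q"
  shows "h $ q $ j = 0 \<Longrightarrow> h *v axis j 1 = axis p (h $ p $ j)"
    "h $ p $ j = 0 \<Longrightarrow> h *v axis j 1 = axis q (h $ q $ j)"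
proof -
  have "H (h *v axis j 1) (h *v axis j 1) = 0" using j by (auto simp: Sp_herm[OF h] herm_basis)
  from null_axis[OF this] show "h $ q $ j = 0 \<Longrightarrow> h *v axis j 1 = axis p (h $ p $ j)"
    "h $ p $ j = 0 \<Longrightarrow> h *v axis j 1 = axis q (h $ q $ j)" by (simp_all add: mat_vec_axis)
qed

lemma fixes_pair_axis:
  assumes "h \<in> carrier S" "fixes_pair h"
  shows "h *v axis p 1 = axis p (h $ p $ p)" "h *v axis q 1 = axis q (h $ q $ q)"
  using column_axis[OF assms(1), of p] column_axis[OF assms(1), of q] assms(2)
  by (auto simp: fixes_pair_def)

lemma swaps_pair_axis:
  assumes "h \<in> carrier S" "swaps_pair h"
  shows "h *v axis p 1 = axis q (h $ q $ p)" "h *v axis q 1 = axis p (h $ p $ q)"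
  using column_axis[OF assms(1), of p] column_axis[OF assms(1), of q] assms(2)
  by (auto simp: swaps_pair_def)

text \<open>Passing to the square treats fixing and exchanging the two lines alike, as the descent
  needs.\<close>

lemma square_fixes_axis:
  assumes h: "h \<in> carrier S" and "fixes_pair h \<or> swaps_pair h" and i: "i = p \<or> i = q"
  obtains c where "h *v (h *v axis i 1) = rscale (axis i 1) c"
proof -
  have *: "h *v axis j c = rscale (h *v axis j 1) c" for j c
    by (simp add: rscale_axis flip: mat_vec_rscale)
  from assms(2) have "\<exists>c. h *v (h *v axis i 1) = axis i c"
  proof
    assume "fixes_pair h"
    then show ?thesis using i fixes_pair_axis[OF h] *[of p "h $ p $ p"] *[of q "h $ q $ q"]
      by (auto simp: rscale_axis)
  next
    assume "swaps_pair h"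
    then show ?thesis using i swaps_pair_axis[OF h] *[of q "h $ q $ p"] *[of p "h $ p $ q"]
      by (auto simp: rscale_axis)
  qed
  with that show thesis by (metis axis_eq_rscale)
qed

end

context diag_group
begin

lemma conj_diag_G: "h \<in> G \<Longrightarrow> conj_diag l h \<in> G"
  unfolding conj_diag_def by (intro G_mult G_adj l_G)

text \<open>A common scalar for both coordinates would force |l_p| = |l_q|, but one is greater than
  1 and the other is its reciprocal.\<close>

lemma diagonal_sq_fixed:
  assumes "diagonal l *v (diagonal l *v z) = rscale z c"
  shows "z $ p = 0 \<or> z $ q = 0"
proof (rule ccontr)
  assume "\<not> ?thesis"
  then have z: "z $ p \<noteq> 0" "z $ q \<noteq> 0" by auto
  have "l i * (l i * z $ i) = z $ i * c" for i
    using arg_cong[OF assms, of "\<lambda>v. v $ i"] by (simp add: diagonal_vec)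
  then have "norm (l i * (l i * z $ i)) = norm (z $ i * c)" for i by (rule arg_cong)
  then have *: "norm (l i) * norm (l i) * norm (z $ i) = norm c * norm (z $ i)" for i
    by (simp add: norm_mult mult_ac)
  have "norm (l p) * norm (l p) = norm c" using *[of p] z by simp
  moreover have "norm (l q) * norm (l q) = norm c" using *[of q] z by simp
  ultimately have "(norm (l p))\<^sup>2 = (norm (l q))\<^sup>2" by (simp add: power2_eq_square)
  then have "norm (l p) = norm (l q)" by (rule power2_eq_imp_eq) simp_all
  moreover have "1 / norm (l p) < 1" using l_p by (simp add: divide_less_eq)
  ultimately show False using l_norms(1) l_p by linarith
qed

text \<open>The square of h g h^(-1) fixes the lines of e_p and e_q, so the square of g fixes their
  images under h^(-1). By \<open>diagonal_sq_fixed\<close> each image has a zero coordinate, that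
  is, h has a zero corner in each row. Two zeros in one column are excluded by
  \<open>ratios_not_both_zero\<close>, leaving the two patterns.\<close>

lemma preserves_pair_descent:
  assumes h: "h \<in> G" and k: "fixes_pair (conj_diag l h) \<or> swaps_pair (conj_diag l h)"
  shows "fixes_pair h \<or> swaps_pair h"
proof -
  let ?k = "conj_diag l h"
  have hS: "h \<in> carrier S" and kS: "?k \<in> carrier S" using h conj_diag_G GS by auto
  have dz: "(adj h *v axis i 1) $ p = 0 \<or> (adj h *v axis i 1) $ q = 0" if i: "i = p \<or> i = q" for i
  proof -
    obtain c where c: "?k *v (?k *v axis i 1) = rscale (axis i 1) c" using square_fixes_axis[OF kS k i] .
    have "diagonal l *v (adj h *v z) = adj h *v (?k *v z)" for z
      by (simp add: conj_diag_def Sp_adj_vec[OF hS] flip: matrix_vector_mul_assoc)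
    then have "diagonal l *v (diagonal l *v (adj h *v axis i 1)) = rscale (adj h *v axis i 1) c"
      by (simp add: c mat_vec_rscale)
    then show ?thesis by (rule diagonal_sq_fixed)
  qed
  have "h $ q $ q = 0 \<or> h $ q $ p = 0" using dz[of p] by (simp add: mat_vec_axis adj_nth)
  moreover have "h $ p $ q = 0 \<or> h $ p $ p = 0" using dz[of q] by (simp add: mat_vec_axis adj_nth)
  moreover have "\<not> (h $ q $ q = 0 \<and> h $ p $ q = 0)" "\<not> (h $ q $ p = 0 \<and> h $ p $ p = 0)"
    using ratios_not_both_zero[OF hS] by (auto simp: ratio_x_def ratio_y_def)
  ultimately show ?thesis unfolding fixes_pair_def swaps_pair_def by blast
qed

lemma Joergensen:
  assumes h: "h \<in> G" and \<delta>0: "\<delta> \<ge> 0"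
    and \<delta>: "\<And>m. m \<noteq> p \<Longrightarrow> m \<noteq> q \<Longrightarrow> norm (l m - 1) \<le> \<delta>"
    and M: "M = 2 * \<delta> + norm (l p - 1) + norm (l q - 1)" "0 < M" "M < 1"
    and xy: "M * (ratio_x h * ratio_y h) < (1 - M) / M"
  shows "fixes_pair h \<or> swaps_pair h"
proof -
  define it where "it k = (conj_diag l ^^ k) h" for k
  have it_G: "it k \<in> G" for k unfolding it_def by (induction k) (simp_all add: h conj_diag_G)
  note it_S = GS[OF it_G]
  have it_Suc: "it (Suc k) = conj_diag l (it k)" for k by (simp add: it_def)
  define x where "x k = ratio_x (it k)" for k
  define y where "y k = ratio_y (it k)" for k
  have x0: "x k \<ge> 0" and y0: "y k \<ge> 0" and yx: "y k \<le> 1 + x k" for k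
    using ratio_nonneg ratio_triangle[OF it_S] by (simp_all add: x_def y_def)
  have step: "x (Suc k) \<le> M * (x k * y k)" for k
  proof -
    have "norm (it (Suc k) $ p $ q) \<le> M * (norm (it k $ p $ p) * norm (it k $ p $ q))"
      using conj_diag_off_diagonal[OF it_S, where i = p and l = l and \<delta> = \<delta>] \<delta>0 \<delta> M(1) by (simp add: it_Suc)
    moreover have "norm (it (Suc k) $ q $ p) \<le> M * (norm (it k $ q $ p) * norm (it k $ q $ q))"
      using conj_diag_off_diagonal[OF it_S, where i = q and l = l and \<delta> = \<delta>] \<delta>0 \<delta> M(1) by (simp add: it_Suc)
    ultimately have "(x (Suc k))\<^sup>2 \<le> (M * (norm (it k $ p $ p) * norm (it k $ p $ q))) * (M * (norm (it k $ q $ p) * norm (it k $ q $ q)))"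
      unfolding x_def ratio_sq using M(2) by (intro mult_mono) auto
    also have "\<dots> = (M * (x k * y k))\<^sup>2"
      by (simp add: x_def y_def power_mult_distrib ratio_sq) (simp add: power2_eq_square)
    finally show ?thesis by (rule power2_le_imp_le) (use M(2) x0 y0 in simp)
  qed
  \<comment> \<open>Uses \<open>x 1\<close>, since the hypothesis controls only the product of
    \<open>x 0\<close> and \<open>y 0\<close>; the contraction therefore starts at index 1.\<close>
  define \<theta> where "\<theta> = M * (1 + x 1)"
  have "x 1 \<le> M * (x 0 * y 0)" using step[of 0] by simp
  also have "\<dots> < (1 - M) / M" using xy by (simp add: x_def y_def it_def)
  finally have "M * x 1 < 1 - M" using M(2) by (simp add: field_simps)
  then have \<theta>: "\<theta> < 1" "\<theta> \<ge> 0" using M(2) x0[of 1] by (simp_all add: \<theta>_def algebra_simps)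
  have contract: "x (Suc k) \<le> (M * (1 + x k)) * x k" for k
  proof -
    have "M * (x k * y k) \<le> M * (x k * (1 + x k))"
      using yx x0 M(2) by (intro mult_left_mono) auto
    with step[of k] show ?thesis by (simp add: mult_ac)
  qed
  have le1: "x (Suc k) \<le> x 1" for k
  proof (induction k)
    case (Suc k)
    have "x (Suc (Suc k)) \<le> (M * (1 + x (Suc k))) * x (Suc k)" by (rule contract)
    also have "\<dots> \<le> \<theta> * x (Suc k)" unfolding \<theta>_def using Suc M(2) x0 by (intro mult_right_mono mult_left_mono) auto
    also have "\<dots> \<le> 1 * x (Suc k)" using \<theta> x0 by (intro mult_right_mono) auto
    finally show ?case using Suc by simp
  qed simp
  have dec: "x (Suc (Suc k)) \<le> \<theta> * x (Suc k)" for k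
  proof -
    have "x (Suc (Suc k)) \<le> (M * (1 + x (Suc k))) * x (Suc k)" by (rule contract)
    also have "\<dots> \<le> \<theta> * x (Suc k)" unfolding \<theta>_def using le1 M(2) x0 by (intro mult_right_mono mult_left_mono) auto
    finally show ?thesis .
  qed
  \<comment> \<open>From \<open>conj_diag_diagonal\<close> with x + y at most 1 + 2 x, and x at most
    \<open>x 1\<close> from index 1 on; hence the estimate for iterates with index at least
    2.\<close>
  define C where "C = norm (l p) * (1 + 2 * x 1)\<^sup>2"
  have bound: "norm (it (Suc (Suc k)) $ i $ i) \<le> C" if "i = p \<or> i = q" for i k
  proof -
    have "norm (it (Suc (Suc k)) $ i $ i) \<le> norm (l p) * (x (Suc k) + y (Suc k))\<^sup>2"
      unfolding x_def y_def it_Suc[of "Suc k"] by (intro conj_diag_diagonal it_S that l_le)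
    also have "\<dots> \<le> C"
      unfolding C_def using yx[of "Suc k"] le1[of k] x0 y0
      by (intro mult_left_mono power_mono) (auto simp: add_nonneg_nonneg)
    finally show ?thesis .
  qed
  obtain \<epsilon> where \<epsilon>: "\<epsilon> > 0" "\<And>h. h \<in> G \<Longrightarrow> norm (h $ p $ p) \<le> C \<Longrightarrow> norm (h $ q $ q) \<le> C \<Longrightarrow> ratio_x h < \<epsilon> \<Longrightarrow>
      h $ p $ q = 0 \<and> h $ q $ p = 0"
    using small_ratio_vanishes[of C] by blast
  obtain k where k: "x (Suc (Suc k)) < \<epsilon>"
    using geometric_below[of \<theta> "\<lambda>k. x (Suc (Suc k))" \<epsilon>] \<theta> dec \<epsilon>(1) by blast
  then have last: "fixes_pair (it (Suc (Suc k)))"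
    unfolding fixes_pair_def using \<epsilon>(2)[OF it_G] bound[of p k] bound[of q k] by (simp add: x_def)
  \<comment> \<open>Downward induction to index 0. The exchange alternative must be carried along,
    since the descent may produce it.\<close>
  have "fixes_pair (it m) \<or> swaps_pair (it m)" if "m \<le> Suc (Suc k)" for m
    using that
  proof (induction rule: inc_induct)
    case base
    show ?case using last by blast
  next
    case (step m)
    then show ?case using preserves_pair_descent[OF it_G[of m]] unfolding it_Suc by blast
  qed
  from this[of 0] show ?thesis by (simp add: it_def)
qed

end

section \<open>The stabiliser of the axis\<close>

context frame
begin

lemma entry_axis: "A $ i $ j = (A *v axis j 1) $ i" for A :: "quat ^ 'n ^ 'n"
  by (simp add: mat_vec_axis)

lemma fixes_pair_mult:
  assumes h: "h \<in> carrier S" "fixes_pair h" and k: "k \<in> carrier S" "fixes_pair k"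
  shows "fixes_pair (h ** k)" "(h ** k) $ p $ p = h $ p $ p * k $ p $ p"
    "(h ** k) $ q $ q = h $ q $ q * k $ q $ q"
proof -
  have "(h ** k) *v axis p 1 = rscale (h *v axis p 1) (k $ p $ p)"
    using fixes_pair_axis[OF k] axis_eq_rscale[of p "k $ p $ p"]
    by (simp flip: matrix_vector_mul_assoc mat_vec_rscale)
  then have p: "(h ** k) *v axis p 1 = axis p (h $ p $ p * k $ p $ p)"
    by (simp add: fixes_pair_axis[OF h] rscale_axis)
  have "(h ** k) *v axis q 1 = rscale (h *v axis q 1) (k $ q $ q)"
    using fixes_pair_axis[OF k] axis_eq_rscale[of q "k $ q $ q"]
    by (simp flip: matrix_vector_mul_assoc mat_vec_rscale)
  then have q: "(h ** k) *v axis q 1 = axis q (h $ q $ q * k $ q $ q)"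
    by (simp add: fixes_pair_axis[OF h] rscale_axis)
  show "fixes_pair (h ** k)"
    unfolding fixes_pair_def entry_axis p q using pq qp by (simp add: axis_def)
  show "(h ** k) $ p $ p = h $ p $ p * k $ p $ p" "(h ** k) $ q $ q = h $ q $ q * k $ q $ q"
    unfolding entry_axis[of "h ** k"] p q by (simp_all add: axis_def)
qed

lemma fixes_pair_product:
  assumes "h \<in> carrier S" "fixes_pair h"
  shows "qcnj (h $ q $ q) * h $ p $ p = 1"
proof -
  have "H (rscale (axis p 1) (h $ p $ p)) (rscale (axis q 1) (h $ q $ q)) = - 1"
    using Sp_herm[OF assms(1), of "axis p 1" "axis q 1"] fixes_pair_axis[OF assms]
    by (simp add: rscale_axis herm_basis)
  then show ?thesis by (simp add: herm_rscale_left herm_rscale_right herm_basis)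
qed

lemma swaps_pair_product:
  assumes "h \<in> carrier S" "swaps_pair h"
  shows "qcnj (h $ p $ q) * h $ q $ p = 1"
proof -
  have "H (rscale (axis q 1) (h $ q $ p)) (rscale (axis p 1) (h $ p $ q)) = - 1"
    using Sp_herm[OF assms(1), of "axis p 1" "axis q 1"] swaps_pair_axis[OF assms]
    by (simp add: rscale_axis herm_basis)
  then show ?thesis by (simp add: herm_rscale_left herm_rscale_right herm_basis)
qed

lemma norm_fixes_pair:
  assumes "h \<in> carrier S" "fixes_pair h"
  shows "norm (h $ p $ p) > 0" "norm (h $ q $ q) = 1 / norm (h $ p $ p)"
proof -
  have *: "norm (h $ q $ q) * norm (h $ p $ p) = 1"
    using fixes_pair_product[OF assms] by (metis norm_mult norm_one norm_qcnj)
  then show "norm (h $ p $ p) > 0" by (metis mult_zero_right norm_ge_zero order_le_less zero_neq_one)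
  with * show "norm (h $ q $ q) = 1 / norm (h $ p $ p)" by (simp add: field_simps)
qed

lemma fixes_pair_adj: "fixes_pair h \<Longrightarrow> fixes_pair (adj h)"
  and swaps_pair_adj: "swaps_pair h \<Longrightarrow> swaps_pair (adj h)"
  by (simp_all add: fixes_pair_def swaps_pair_def adj_nth)

text \<open>Positivity of the product makes d a positive real multiple of a, so right scaling brings
  the point into the form of \<open>std_geodesic_alt\<close>.\<close>

lemma std_geodesic_memI:
  assumes "qcnj a * d = of_real t" "t > 0"
  shows "proj (axis p a + axis q d) \<in> std_geodesic"
proof -
  have a: "a \<noteq> 0" using assms by auto
  define r where "r = t / (norm a)\<^sup>2"
  have "(a * qcnj a) * d = a * of_real t" by (simp only: mult.assoc assms)
  then have "of_real ((norm a)\<^sup>2) * d = of_real t * a" by (simp only: mult_qcnj of_real_quat_commute[of t a])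
  then have "(norm a)\<^sup>2 *\<^sub>R d = t *\<^sub>R a" by (simp only: scaleR_conv_of_real)
  then have "(1 / (norm a)\<^sup>2) *\<^sub>R (norm a)\<^sup>2 *\<^sub>R d = (1 / (norm a)\<^sup>2) *\<^sub>R t *\<^sub>R a" by simp
  then have "d = r *\<^sub>R a" using a by (simp add: r_def)
  then have "axis p a + axis q d = rscale (axis p 1 + axis q (of_real r)) a"
    by (simp add: rscale_add rscale_axis scaleR_conv_of_real)
  then have "proj (axis p a + axis q d) = proj (axis p 1 + axis q (of_real r))"
    using a by (simp add: proj_rscale)
  moreover have "r > 0" using assms a by (simp add: r_def)
  ultimately show ?thesis unfolding std_geodesic_alt by blast
qed

lemma std_geodesic_invariant_subset:
  assumes h: "h \<in> carrier S" "fixes_pair h \<or> swaps_pair h"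
  shows "act h ` std_geodesic \<subseteq> std_geodesic"
proof
  fix P assume "P \<in> act h ` std_geodesic"
  then obtain r where r: "r > 0" "P = act h (proj (axis p 1 + axis q (of_real r)))"
    unfolding std_geodesic_alt by blast
  have P: "P = proj (h *v axis p 1 + rscale (h *v axis q 1) (of_real r))"
    by (simp add: r act_proj matrix_vector_right_distrib rscale_axis flip: mat_vec_rscale)
  from h(2) show "P \<in> std_geodesic"
  proof
    assume f: "fixes_pair h"
    have "qcnj (h $ p $ p) * h $ q $ q = 1"
      using arg_cong[OF fixes_pair_product[OF h(1) f], of qcnj] by simp
    then have "qcnj (h $ p $ p) * (h $ q $ q * of_real r) = of_real r" by (simp flip: mult.assoc)
    then show ?thesis
      unfolding P fixes_pair_axis[OF h(1) f] rscale_axis using r(1) by (rule std_geodesic_memI)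
  next
    assume s: "swaps_pair h"
    have "qcnj (h $ p $ q * of_real r) * h $ q $ p = of_real r"
      using swaps_pair_product[OF h(1) s] by (simp add: mult.assoc)
    then show ?thesis
      unfolding P swaps_pair_axis[OF h(1) s] rscale_axis using r(1)
      by (subst add.commute) (rule std_geodesic_memI)
  qed
qed

lemma std_geodesic_invariant:
  assumes h: "h \<in> carrier S" "fixes_pair h \<or> swaps_pair h"
  shows "act h ` std_geodesic = std_geodesic"
proof
  show "act h ` std_geodesic \<subseteq> std_geodesic" using std_geodesic_invariant_subset[OF h] .
  have "act (adj h) ` std_geodesic \<subseteq> std_geodesic"
    using std_geodesic_invariant_subset[OF adj_Sp[OF h(1)]] h(2) fixes_pair_adj swaps_pair_adj by blast
  then have "act h ` act (adj h) ` std_geodesic \<subseteq> act h ` std_geodesic" by (rule image_mono)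
  then show "std_geodesic \<subseteq> act h ` std_geodesic" by (simp add: image_image act_adj[OF h(1)])
qed

abbreviation pw :: "quat ^ 'n ^ 'n \<Rightarrow> nat \<Rightarrow> quat ^ 'n ^ 'n" where "pw h n \<equiv> h [^]\<^bsub>S\<^esub> n"

end

context diag_group
begin

lemma one_G: "mat 1 \<in> G"
  using G_mult[OF G_adj[OF l_G] l_G] Sp_adj[OF GS[OF l_G]] by simp

lemma pw_G: "h \<in> G \<Longrightarrow> pw h n \<in> G"
  by (induction n) (simp_all add: one_Sp mult_Sp one_G G_mult)

lemma pw_fixes_pair:
  assumes h: "h \<in> G" "fixes_pair h"
  shows "fixes_pair (pw h n)" "norm (pw h n $ p $ p) = norm (h $ p $ p) ^ n"
proof (induction n)
  case 0
  {
    case 1 show ?case using pq qp by (simp add: one_Sp fixes_pair_def mat_def)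
  next
    case 2 show ?case by (simp add: one_Sp) (simp add: mat_def)
  }
next
  case (Suc n)
  note m = fixes_pair_mult[OF GS[OF pw_G[OF h(1), of n]] Suc(1) GS[OF h(1)] h(2)]
  {
    case 1 show ?case using m by (simp add: mult_Sp)
  next
    case 2 show ?case using m Suc(2) by (simp add: mult_Sp norm_mult)
  }
qed

text \<open>All powers of h have corners of norm at most 1, so only finitely many differ; two equal
  powers make h a torsion element.\<close>

lemma norm_one_trivial:
  assumes tf: "torsion_free p q G" and h: "h \<in> G" "fixes_pair h" and n: "norm (h $ p $ p) = 1"
  shows "h = mat 1"
proof -
  have "range (pw h) \<subseteq> {h \<in> G. corners_le 1 h}"
  proof safe
    fix m :: nat
    show "pw h m \<in> G" by (rule pw_G[OF h(1)])
    have f: "fixes_pair (pw h m)" by (rule pw_fixes_pair[OF h])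
    have "norm (pw h m $ p $ p) = 1" using pw_fixes_pair(2)[OF h, of m] n by simp
    moreover have "norm (pw h m $ q $ q) = 1"
      using norm_fixes_pair(2)[OF GS[OF pw_G[OF h(1)]] f] \<open>norm (pw h m $ p $ p) = 1\<close> by simp
    ultimately show "corners_le 1 (pw h m)" using f by (simp add: corners_le_def fixes_pair_def)
  qed
  then have "finite (range (pw h))" using corners_finite finite_subset by blast
  then have "\<not> inj (pw h)" using range_inj_infinite by blast
  then obtain i j where ij: "i < j" "pw h i = pw h j" using linorder_injI[of "pw h"] by blast
  interpret group S by (rule group_Sp)
  have hS: "h \<in> carrier S" using h GS by blast
  have "pw h i \<otimes>\<^bsub>S\<^esub> pw h (j - i) = pw h (i + (j - i))" using hS by (rule nat_pow_mult)
  also have "\<dots> = pw h j" using ij(1) by simp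
  also have "\<dots> = pw h i" by (simp only: ij(2))
  finally have "pw h i \<otimes>\<^bsub>S\<^esub> pw h (j - i) = pw h i" .
  then have one: "pw h (j - i) = \<one>\<^bsub>S\<^esub>"
    using hS by (simp only: l_cancel_one nat_pow_closed)
  have "0 < j - i" using ij(1) by (simp only: zero_less_diff)
  with one have "h = \<one>\<^bsub>S\<^esub>" using tf h(1) unfolding torsion_free_def by blast
  then show ?thesis by (simp add: one_Sp)
qed

text \<open>An element exchanging the ends of the axis has an elliptic square.\<close>

lemma no_swap:
  assumes tf: "torsion_free p q G" and h: "h \<in> G"
  shows "\<not> swaps_pair h"
proof
  assume s: "swaps_pair h"
  note hS = GS[OF h]
  note ax = swaps_pair_axis[OF hS s]
  have "(h ** h) *v axis p 1 = rscale (h *v axis q 1) (h $ q $ p)"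
    using ax(1) axis_eq_rscale[of q "h $ q $ p"] by (simp flip: matrix_vector_mul_assoc mat_vec_rscale)
  then have p: "(h ** h) *v axis p 1 = axis p (h $ p $ q * h $ q $ p)" by (simp add: ax(2) rscale_axis)
  have "(h ** h) *v axis q 1 = rscale (h *v axis p 1) (h $ p $ q)"
    using ax(2) axis_eq_rscale[of p "h $ p $ q"] by (simp flip: matrix_vector_mul_assoc mat_vec_rscale)
  then have q: "(h ** h) *v axis q 1 = axis q (h $ q $ p * h $ p $ q)" by (simp add: ax(1) rscale_axis)
  have "fixes_pair (h ** h)"
    unfolding fixes_pair_def entry_axis p q using pq qp by (simp add: axis_def)
  moreover have "norm (h $ p $ q) * norm (h $ q $ p) = 1"
    using swaps_pair_product[OF hS s] by (metis norm_mult norm_one norm_qcnj)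
  then have "norm ((h ** h) $ p $ p) = 1"
    unfolding entry_axis[of "h ** h"] p by (simp add: axis_def norm_mult)
  ultimately have hh: "h ** h = mat 1" using norm_one_trivial[OF tf] G_mult[OF h h] by blast
  have "pw h 2 = mat 1 ** h ** h" by (simp add: numeral_2_eq_2 one_Sp mult_Sp)
  then have "pw h 2 = \<one>\<^bsub>S\<^esub>" using hh by (simp add: one_Sp)
  then have "h = \<one>\<^bsub>S\<^esub>" using tf h unfolding torsion_free_def by (metis zero_less_numeral)
  then have "h $ p $ p = 1" by (simp add: one_Sp mat_def)
  with s show False by (simp add: swaps_pair_def)
qed

lemma l_fixes_pair: "fixes_pair (diagonal l)" "diagonal l $ p $ p = l p"
  using pq qp by (simp_all add: fixes_pair_def diagonal_def)

text \<open>On elements fixing both ends, |h_pp| is multiplicative and takes the value 1 only at the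
  identity. Finitely many values lie in (1, |l_p|], so an element k with the least one generates,
  and primitivity identifies it with \<open>diagonal l\<close>. Since \<open>pw\<close> has natural
  exponents, the inverse covers |h_pp| < 1.\<close>

lemma primitive_generates:
  assumes tf: "torsion_free p q G" and prim: "primitive_in p q G (diagonal l)"
    and h: "h \<in> G" "fixes_pair h"
  shows "\<exists>n. h = pw (diagonal l) n \<or> adj h = pw (diagonal l) n"
proof -
  let ?\<tau> = "\<lambda>h :: quat ^ 'n ^ 'n. norm (h $ p $ p)"
  define F where "F = {h \<in> G. fixes_pair h \<and> 1 < ?\<tau> h \<and> ?\<tau> h \<le> norm (l p)}"
  have "F \<subseteq> {h \<in> G. corners_le (norm (l p)) h}"
  proof safe
    fix h assume h: "h \<in> F"
    then show "h \<in> G" by (simp add: F_def)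
    have "?\<tau> h > 1" using h by (simp add: F_def)
    then have "1 / ?\<tau> h < 1" by (simp add: divide_less_eq)
    moreover have "norm (h $ q $ q) = 1 / ?\<tau> h" using h norm_fixes_pair(2) GS by (simp add: F_def)
    ultimately show "corners_le (norm (l p)) h"
      using h l_p by (simp add: F_def corners_le_def fixes_pair_def)
  qed
  then have "finite F" using corners_finite finite_subset by blast
  then have fin: "finite (?\<tau> ` F)" by simp
  have "diagonal l \<in> F" using l_fixes_pair l_G l_p by (simp add: F_def)
  then have "Min (?\<tau> ` F) \<in> ?\<tau> ` F" using fin by (intro Min_in) auto
  then obtain k where k: "Min (?\<tau> ` F) = ?\<tau> k" "k \<in> F" by (rule imageE)
  have min: "?\<tau> k \<le> ?\<tau> h" if "h \<in> F" for h
    unfolding k(1)[symmetric] using fin that by (intro Min_le) auto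
  have kG: "k \<in> G" "fixes_pair k" and k1: "?\<tau> k > 1" and kl: "?\<tau> k \<le> norm (l p)"
    using k(2) by (auto simp: F_def)
  have pos: "\<exists>n. h = pw k n" if h: "h \<in> G" "fixes_pair h" "?\<tau> h \<ge> 1" for h
  proof -
    have "\<exists>m. ?\<tau> h < ?\<tau> k ^ m" using real_arch_pow[OF k1] by blast
    note ex = LeastI_ex[OF this]
    define m where "m = (LEAST m. ?\<tau> h < ?\<tau> k ^ m)"
    have m: "?\<tau> h < ?\<tau> k ^ m" unfolding m_def by (rule ex)
    have "m \<noteq> 0"
    proof
      assume "m = 0"
      with m h show False by simp
    qed
    then obtain n where n: "m = Suc n" by (cases m) auto
    have "\<not> ?\<tau> h < ?\<tau> k ^ n" using not_less_Least[of n "\<lambda>m. ?\<tau> h < ?\<tau> k ^ m"] n m_def by simp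
    then have le: "?\<tau> k ^ n \<le> ?\<tau> h" by simp
    let ?u = "pw k n"
    have uG: "?u \<in> G" and uf: "fixes_pair ?u" and u\<tau>: "?\<tau> ?u = ?\<tau> k ^ n"
      using pw_G kG pw_fixes_pair[OF kG] by simp_all
    \<comment> \<open>The remainder after dividing by the largest power of k not exceeding h: its
      value lies in [1, |k_pp|), so minimality of k forces it to be 1.\<close>
    define w where "w = adj ?u ** h"
    have wG: "w \<in> G" unfolding w_def by (intro G_mult G_adj uG h)
    have wf: "fixes_pair w" and "w $ p $ p = adj ?u $ p $ p * h $ p $ p"
      unfolding w_def using fixes_pair_mult[OF adj_Sp[OF GS[OF uG]] fixes_pair_adj[OF uf] GS[OF h(1)] h(2)] by auto
    then have "?\<tau> w = norm (?u $ q $ q) * ?\<tau> h" by (simp add: norm_mult adj_corners)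
    also have "\<dots> = ?\<tau> h / ?\<tau> k ^ n" using norm_fixes_pair(2)[OF GS[OF uG] uf] by (simp add: u\<tau>)
    finally have w\<tau>: "?\<tau> w = ?\<tau> h / ?\<tau> k ^ n" .
    have "?\<tau> k > 0" using k1 by linarith
    then have kn: "?\<tau> k ^ n > 0" by (rule zero_less_power)
    have "?\<tau> w \<ge> 1" using le kn unfolding w\<tau> by (simp add: le_divide_eq)
    moreover have "?\<tau> w < ?\<tau> k" using m kn unfolding w\<tau> n by (simp add: divide_less_eq)
    then have "w \<notin> F" using min[of w] by auto
    then have "\<not> 1 < ?\<tau> w" using wG wf \<open>?\<tau> w < ?\<tau> k\<close> kl by (simp add: F_def)
    ultimately have "?\<tau> w = 1" by simp
    then have "w = mat 1" using norm_one_trivial[OF tf wG wf] by blast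
    then have "?u ** (adj ?u ** h) = ?u" by (simp add: w_def)
    then have "h = ?u" by (simp add: matrix_mul_assoc Sp_adj[OF GS[OF uG]])
    then show ?thesis by blast
  qed
  obtain m where m: "diagonal l = pw k m" using pos[OF l_G] l_fixes_pair l_p by auto
  have "m \<noteq> 0"
  proof
    assume "m = 0"
    then have "diagonal l $ p $ p = 1" by (simp add: m one_Sp) (simp add: mat_def)
    with l_fixes_pair l_p show False by simp
  qed
  moreover have "\<not> m \<ge> 2" using prim m kG unfolding primitive_in_def by auto
  ultimately have "m = Suc 0" by linarith
  then have kl: "k = diagonal l" using m by (simp add: one_Sp mult_Sp)
  show ?thesis
  proof (cases "?\<tau> h \<ge> 1")
    case True
    then show ?thesis using pos[OF h] unfolding kl by blast
  next
    case False
    have "norm (h $ q $ q) = 1 / ?\<tau> h" "?\<tau> h > 0" using norm_fixes_pair GS h by auto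
    then have "?\<tau> (adj h) \<ge> 1" using False by (simp add: adj_corners le_divide_eq)
    then show ?thesis using pos[OF G_adj[OF h(1)] fixes_pair_adj[OF h(2)]] unfolding kl by blast
  qed
qed

end

section \<open>Tubes and collars\<close>

context frame
begin

lemma rho_commute: "P \<in> hyp p q \<Longrightarrow> Q \<in> hyp p q \<Longrightarrow> rho p q P Q = rho p q Q P"
proof -
  assume "P \<in> hyp p q" "Q \<in> hyp p q"
  then obtain x y where x: "H x x = - 1" "P = proj x" and y: "H y y = - 1" "Q = proj y"
    using hyp_unit_lift by metis
  have "cosh (rho p q P Q / 2) = cosh (rho p q Q P / 2)"
    unfolding x(2) y(2) rho_proj(2)[OF x(1) y(1)] rho_proj(2)[OF y(1) x(1)] by (rule norm_herm_commute)
  moreover have "rho p q P Q \<ge> 0" "rho p q Q P \<ge> 0" using x y rho_proj(1) by simp_all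
  ultimately show ?thesis by simp
qed

text \<open>The infimum may not be attained; a point strictly within r exists because distances are
  bounded below by 0.\<close>

lemma tubeE:
  assumes x: "x \<in> tube p q \<gamma> r" and \<gamma>: "\<gamma> \<noteq> {}" "\<gamma> \<subseteq> hyp p q"
  obtains y where "x \<in> hyp p q" "y \<in> \<gamma>" "rho p q x y < r"
proof -
  have x: "x \<in> hyp p q" "(INF y\<in>\<gamma>. rho p q x y) < r" using x by (auto simp: tube_def)
  have "bdd_below ((\<lambda>y. rho p q x y) ` \<gamma>)"
    using x(1) \<gamma>(2) rho_nonneg by (intro bdd_belowI2[of _ 0]) blast
  with x(2) \<gamma>(1) obtain y where "y \<in> \<gamma>" "rho p q x y < r"
    by (subst (asm) cINF_less_iff) auto
  with x that show thesis by blast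
qed

lemma tube_overlap:
  assumes h: "h \<in> carrier S" and x: "x \<in> tube p q \<gamma> r" "act h x \<in> tube p q \<gamma> r"
    and \<gamma>: "\<gamma> \<noteq> {}" "\<gamma> \<subseteq> hyp p q"
  obtains y y' where "y \<in> \<gamma>" "y' \<in> \<gamma>" "rho p q (act h y) y' < 2 * r"
proof -
  obtain y where y: "x \<in> hyp p q" "y \<in> \<gamma>" "rho p q x y < r" using tubeE[OF x(1) \<gamma>] .
  obtain y' where y': "y' \<in> \<gamma>" "rho p q (act h x) y' < r" using tubeE[OF x(2) \<gamma>] .
  have hyp: "y \<in> hyp p q" "y' \<in> hyp p q" "act h x \<in> hyp p q" "act h y \<in> hyp p q"
    using y y' \<gamma> Sp_hyp[OF h] by auto
  have "rho p q (act h y) y' \<le> rho p q (act h y) (act h x) + rho p q (act h x) y'"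
    using hyp by (intro rho_triangle)
  also have "rho p q (act h y) (act h x) = rho p q x y"
    using rho_act[OF h, of y x] rho_commute[of x y] y hyp by simp
  finally have "rho p q (act h y) y' < 2 * r" using y y' by linarith
  with y y' that show thesis by blast
qed

lemma orbit_act:
  assumes G: "subgroup G S" and h: "h \<in> G"
  shows "orbit G (act h x) = orbit G x"
proof -
  have hS: "h \<in> carrier S" using h subgroup.subset[OF G] by blast
  have adjG: "adj h \<in> G" using subgroup.m_inv_closed[OF G h] by (simp add: inv_Sp[OF hS])
  have mult: "k ** h' \<in> G" if "k \<in> G" "h' \<in> G" for k h'
    using subgroup.m_closed[OF G that] by (simp add: mult_Sp)
  show ?thesis
  proof (intro equalityI subsetI)
    fix y assume "y \<in> orbit G (act h x)"
    then obtain k where "k \<in> G" "y = act (k ** h) x" by (auto simp: orbit_def act_mult)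
    then show "y \<in> orbit G x" using mult h by (auto simp: orbit_def)
  next
    fix y assume "y \<in> orbit G x"
    then obtain k where k: "k \<in> G" "y = act k x" by (auto simp: orbit_def)
    then have "y = act (k ** adj h) (act h x)" by (simp add: act_mult act_adj[OF hS])
    then show "y \<in> orbit G (act h x)" using mult[OF k(1) adjG] by (auto simp: orbit_def)
  qed
qed

lemma self_in_orbit: "subgroup G S \<Longrightarrow> x \<in> orbit G x"
  using subgroup.one_closed[of G S] by (auto simp: orbit_def one_Sp act_1 intro!: image_eqI[of _ _ "mat 1"])

text \<open>Two points of T in one G-orbit are related by some h that makes T meet its image, so h
  lies in K and the K-orbits agree.\<close>

lemma precisely_invariant_imp_collar_embedded:
  assumes G: "subgroup G S" and K: "subgroup K S" "K \<subseteq> G" and T: "T \<subseteq> hyp p q"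
    and inv: "precisely_invariant G K T"
  shows "collar_embedded p q G K T"
proof -
  have nm: "natural_map G (orbit K x) = orbit G x" for x
  proof -
    have "natural_map G (orbit K x) = (\<Union>k\<in>K. orbit G (act k x))"
      by (simp add: natural_map_def orbit_def)
    also have "\<dots> = (\<Union>k\<in>K. orbit G x)" using orbit_act[OF G] K(2) by (intro SUP_cong refl) blast
    also have "\<dots> = orbit G x" using subgroup.one_closed[OF K(1)] by auto
    finally show ?thesis .
  qed
  show ?thesis
    unfolding collar_embedded_def
  proof
    show "natural_map G ` quotient_by K T \<subseteq> quotient_by G (hyp p q)"
      using T by (auto simp: quotient_by_def nm)
    show "inj_on (natural_map G) (quotient_by K T)"
    proof (rule inj_onI)
      fix c d assume "c \<in> quotient_by K T" "d \<in> quotient_by K T" and eq: "natural_map G c = natural_map G d"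
      then obtain x y where x: "x \<in> T" "c = orbit K x" and y: "y \<in> T" "d = orbit K y"
        by (auto simp: quotient_by_def)
      have "orbit G x = orbit G y" using eq by (simp only: x y nm)
      then have "x \<in> orbit G y" using self_in_orbit[OF G, of x] by simp
      then obtain h where h: "h \<in> G" "x = act h y" by (auto simp: orbit_def)
      then have "act h ` T \<inter> T \<noteq> {}" using x y by blast
      then have "h \<in> K" using inv h by (auto simp: precisely_invariant_def)
      then show "c = d" using orbit_act[OF K(1)] h x y by simp
    qed
  qed
qed

lemma subgroup_stabiliser:
  assumes G: "subgroup G S" shows "subgroup (set_stabiliser G X) S"
proof (rule group.subgroupI[OF group_Sp])
  show "set_stabiliser G X \<subseteq> carrier S" using subgroup.subset[OF G] by (auto simp: set_stabiliser_def)
  have "mat 1 \<in> set_stabiliser G X"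
    using subgroup.one_closed[OF G] by (simp add: set_stabiliser_def one_Sp act_1)
  then show "set_stabiliser G X \<noteq> {}" by blast
  fix h assume h: "h \<in> set_stabiliser G X"
  then have hG: "h \<in> G" "act h ` X = X" by (simp_all add: set_stabiliser_def)
  then have hS: "h \<in> carrier S" using subgroup.subset[OF G] by blast
  have "act (adj h) ` X = act (adj h) ` act h ` X" by (simp only: hG)
  also have "\<dots> = X" by (simp add: image_image act_adj[OF hS])
  finally show "inv\<^bsub>S\<^esub> h \<in> set_stabiliser G X"
    using subgroup.m_inv_closed[OF G hG(1)] by (simp add: inv_Sp[OF hS] set_stabiliser_def)
  fix k assume k: "k \<in> set_stabiliser G X"
  then have "act (h ** k) ` X = X" using hG by (simp add: act_mult set_stabiliser_def flip: image_image)
  then show "h \<otimes>\<^bsub>S\<^esub> k \<in> set_stabiliser G X"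
    using subgroup.m_closed[OF G hG(1), of k] k by (simp add: set_stabiliser_def mult_Sp)
qed

section \<open>Conjugation to diagonal position\<close>

definition cj :: "quat ^ 'n ^ 'n \<Rightarrow> quat ^ 'n ^ 'n \<Rightarrow> quat ^ 'n ^ 'n" where
  "cj A h = A ** h ** adj A"

context
  fixes A assumes A: "A \<in> carrier S"
begin

lemma cj_Sp: "h \<in> carrier S \<Longrightarrow> cj A h \<in> carrier S"
  unfolding cj_def by (intro Sp_mult adj_Sp A)

lemma cj_mult: "cj A (h ** k) = cj A h ** cj A k"
proof -
  have "cj A h ** cj A k = A ** h ** (adj A ** A) ** k ** adj A"
    by (simp only: cj_def matrix_mul_assoc)
  then show ?thesis by (simp add: Sp_adj[OF A] cj_def matrix_mul_assoc)
qed

lemma cj_one: "cj A (mat 1) = mat 1" by (simp add: cj_def Sp_adj[OF A])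

lemma cj_back: "adj A ** cj A h ** A = h"
proof -
  have "adj A ** cj A h ** A = (adj A ** A) ** h ** (adj A ** A)"
    by (simp only: cj_def matrix_mul_assoc)
  then show ?thesis by (simp add: Sp_adj[OF A])
qed

lemma cj_eq_iff: "cj A h = cj A k \<longleftrightarrow> h = k"
proof
  assume "cj A h = cj A k"
  then have "adj A ** cj A h ** A = adj A ** cj A k ** A" by (rule arg_cong)
  then show "h = k" unfolding cj_back .
qed (rule arg_cong)

lemma cj_adj: "h \<in> carrier S \<Longrightarrow> cj A (adj h) = adj (cj A h)"
  using A by (simp add: cj_def adj_mult adj_Sp Sp_mult matrix_mul_assoc)

lemma cj_pw: "cj A (pw h n) = pw (cj A h) n"
  by (induction n) (simp_all add: one_Sp mult_Sp cj_one cj_mult)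

lemma act_cj: "act (cj A h) P = act A (act h (act (adj A) P))"
  by (simp add: cj_def act_mult)

lemma cj_group:
  assumes G: "subgroup G S" and disc: "discrete G" and g: "g \<in> G" "cj A g = diagonal l" and l: "norm (l p) > 1"
  shows "diag_group p q (cj A ` G) l"
proof
  have GS: "h \<in> carrier S" if "h \<in> G" for h using that subgroup.subset[OF G] by blast
  show "cj A ` G \<subseteq> carrier S" using cj_Sp GS by blast
  show "h ** k \<in> cj A ` G" if "h \<in> cj A ` G" "k \<in> cj A ` G" for h k
    using that subgroup.m_closed[OF G] by (auto simp: mult_Sp simp flip: cj_mult)
  show "adj h \<in> cj A ` G" if h: "h \<in> cj A ` G" for h
  proof -
    obtain k where k: "k \<in> G" "h = cj A k" using h by blast
    then have "adj h = cj A (adj k)" using cj_adj GS by simp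
    moreover have "adj k \<in> G" using subgroup.m_inv_closed[OF G k(1)] inv_Sp[OF GS[OF k(1)]] by simp
    ultimately show ?thesis by blast
  qed
  show "diagonal l \<in> cj A ` G" using imageI[OF g(1), of "cj A"] unfolding g(2) .
  show "norm (l p) > 1" by (rule l)
  fix C
  define a where "a = norm A"
  define N where "N = real CARD('n)"
  \<comment> \<open>Bounds the entries of h = \<open>adj A ** cj A h ** A\<close>; the maximum with
    0 keeps the bound for the middle factor nonnegative.\<close>
  define C' where "C' = N * (N * (a * max C 0) * a)"
  have "{h \<in> cj A ` G. \<forall>i j. norm (h $ i $ j) \<le> C} \<subseteq> cj A ` {h \<in> G. \<forall>i j. norm (h $ i $ j) \<le> C'}"
  proof safe
    fix h assume h: "h \<in> G" and le: "\<forall>i j. norm (cj A h $ i $ j) \<le> C"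
    have "norm (h $ i $ j) \<le> C'" for i j
    proof -
      have "norm ((adj A ** cj A h ** A) $ i $ j) \<le> C'"
        unfolding C'_def N_def
      proof (intro norm_mult_entry_le)
        show "norm (adj A $ i $ j) \<le> a" for i j unfolding a_def norm_adj_entry by (rule norm_entry_le)
        show "norm (cj A h $ i $ j) \<le> max C 0" for i j using le by (simp add: le_max_iff_disj)
        show "norm (A $ i $ j) \<le> a" for i j unfolding a_def by (rule norm_entry_le)
      qed (simp_all add: a_def)
      then show ?thesis by (simp only: cj_back)
    qed
    then show "cj A h \<in> cj A ` {h \<in> G. \<forall>i j. norm (h $ i $ j) \<le> C'}" using h by blast
  qed
  then show "finite {h \<in> cj A ` G. \<forall>i j. norm (h $ i $ j) \<le> C}"
    using discrete_bounded_finite[OF G disc] finite_subset by blast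
qed

lemma cj_torsion_free: "torsion_free p q G \<Longrightarrow> torsion_free p q (cj A ` G)"
  unfolding torsion_free_def one_Sp
proof safe
  fix x and m :: nat
  assume tf: "\<forall>x\<in>G. \<forall>m. 0 < m \<and> pw x m = mat 1 \<longrightarrow> x = mat 1" and x: "x \<in> G" and m: "0 < m"
    and "pw (cj A x) m = mat 1"
  then have "cj A (pw x m) = cj A (mat 1)" by (simp only: cj_pw cj_one)
  then have "pw x m = mat 1" by (simp only: cj_eq_iff)
  then have "x = mat 1" using tf x m by blast
  then show "cj A x = mat 1" by (simp add: cj_one)
qed

lemma cj_primitive: "primitive_in p q G g \<Longrightarrow> primitive_in p q (cj A ` G) (cj A g)"
  unfolding primitive_in_def by (auto simp: cj_eq_iff simp flip: cj_pw)

end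

lemma pw_generate: "pw g n \<in> generate S {g}"
proof (induction n)
  case 0
  then show ?case using generate.one[of S "{g}"] by simp
next
  case (Suc n)
  then show ?case using generate.eng[OF Suc generate.incl[of g "{g}"]] by simp
qed

text \<open>The fact \<open>pair\<close> serves both conclusions. What remains is to recognise
  elements that preserve the pair of ends: they stabilise the axis, and if g is primitive they are
  powers of g, since exchanges are excluded.\<close>

lemma collar_theorem:
  assumes G: "subgroup G S" and disc: "discrete G" and tf: "torsion_free p q G"
    and g: "g \<in> G" "loxodromic p q g" and ax: "is_axis p q g \<gamma>" and M: "M_inv p q g < sqrt 3 - 1"
    and r: "r > 0" "cosh (2 * r) = 2 * (1 - M_inv p q g) / (M_inv p q g)\<^sup>2"
  shows "precisely_invariant G (set_stabiliser G \<gamma>) (tube p q \<gamma> r)"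
    "primitive_in p q G g \<Longrightarrow> precisely_invariant G (generate S {g}) (tube p q \<gamma> r)"
proof -
  define l where "l = eigs p q g"
  define M where "M = M_inv p q g"
  define \<delta> where "\<delta> = delta_inv p q g"
  have GS: "h \<in> carrier S" if "h \<in> G" for h using that subgroup.subset[OF G] by blast
  have "diag_form p q g l" unfolding l_def using g(2) by (rule loxodromic_diag_form)
  then obtain A where l: "norm (l p) > 1" "l q = inverse (qcnj (l p))" and A: "A \<in> carrier S" "cj A g = diagonal l"
    by (auto simp: diag_form_def mult_Sp inv_Sp cj_def)
  interpret D: diag_group p q "cj A ` G" l
    using cj_group[OF A(1) G disc g(1) A(2) l(1)] .
  have \<gamma>: "\<gamma> = act (adj A) ` std_geodesic"
    using loxodromic_axis[OF g(2) A(1) _ ax] A(2) by (simp add: cj_def)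
  have std_ne: "std_geodesic \<noteq> {}" unfolding std_geodesic_def using zero_less_one by blast
  have \<gamma>_ne: "\<gamma> \<noteq> {}" using std_ne by (simp add: \<gamma>)
  have \<gamma>_hyp: "\<gamma> \<subseteq> hyp p q" unfolding \<gamma> using std_geodesic_hyp Sp_hyp[OF adj_Sp[OF A(1)]] by blast
  have fin: "finite (insert 0 ((\<lambda>i. norm (l i - 1)) ` (UNIV - {p, q})))" by simp
  have \<delta>: "norm (l m - 1) \<le> \<delta>" if "m \<noteq> p" "m \<noteq> q" for m
    unfolding \<delta>_def delta_inv_def l_def[symmetric] using fin that by (auto intro!: Max_ge)
  have \<delta>0: "\<delta> \<ge> 0" unfolding \<delta>_def delta_inv_def by (rule Max_ge) auto
  have M_eq: "M = 2 * \<delta> + norm (l p - 1) + norm (l q - 1)"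
    by (simp add: M_def M_inv_def \<delta>_def l flip: l_def)
  have "l p \<noteq> 1" using l(1) by auto
  then have M0: "M > 0" unfolding M_eq using \<delta>0 norm_ge_zero[of "l q - 1"] by (simp add: add_nonneg_pos add_pos_nonneg)
  have "sqrt 3 < 2" by (rule real_less_lsqrt) auto
  then have M1: "M < 1" using M by (simp add: M_def)
  have pair: "fixes_pair (cj A h) \<or> swaps_pair (cj A h)"
    if h: "h \<in> G" and meet: "act h ` tube p q \<gamma> r \<inter> tube p q \<gamma> r \<noteq> {}" for h
  proof -
    obtain x where x: "x \<in> tube p q \<gamma> r" "act h x \<in> tube p q \<gamma> r" using meet by blast
    obtain y y' where y: "y \<in> \<gamma>" "y' \<in> \<gamma>" "rho p q (act h y) y' < 2 * r"
      using tube_overlap[OF GS[OF h] x \<gamma>_ne \<gamma>_hyp] .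
    obtain Y Y' where Y: "Y \<in> std_geodesic" "y = act (adj A) Y" "Y' \<in> std_geodesic" "y' = act (adj A) Y'"
      using y unfolding \<gamma> by blast
    have hyp: "act h y \<in> hyp p q" "y' \<in> hyp p q" using y \<gamma>_hyp Sp_hyp[OF GS[OF h]] by auto
    have "rho p q (act (cj A h) Y) Y' = rho p q (act A (act h y)) (act A y')"
      by (simp add: Y act_cj[OF A(1)] act_adj[OF A(1)])
    also have "\<dots> = rho p q (act h y) y'" using hyp by (intro rho_act A(1))
    finally have *: "rho p q (act (cj A h) Y) Y' < 2 * r" using y by simp
    have nn: "rho p q (act (cj A h) Y) Y' \<ge> 0"
      using Y std_geodesic_hyp by (intro rho_nonneg Sp_hyp cj_Sp A(1) GS h) auto
    have "2 * ratio_x (cj A h) * ratio_y (cj A h) \<le> cosh (rho p q (act (cj A h) Y) Y')"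
      using Y by (intro std_geodesic_distance cj_Sp A(1) GS h)
    also have "\<dots> < cosh (2 * r)" using * nn r(1) by (subst cosh_real_nonneg_less_iff) auto
    also have "\<dots> = 2 * (1 - M) / M\<^sup>2" using r(2) by (simp add: M_def)
    \<comment> \<open>The strict bound is 2 x y < 2 (1 - M) / M^2; multiplied by M / 2 it becomes
      the starting condition of \<open>Joergensen\<close>.\<close>
    finally have "M * (ratio_x (cj A h) * ratio_y (cj A h)) < (1 - M) / M"
      using M0 by (simp add: field_simps power2_eq_square)
    then show ?thesis using h M0 M1 M_eq \<delta> \<delta>0 by (intro D.Joergensen[of _ \<delta> M]) auto
  qed
  show "precisely_invariant G (set_stabiliser G \<gamma>) (tube p q \<gamma> r)"
    unfolding precisely_invariant_def
  proof (intro ballI, rule ccontr)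
    fix h assume h: "h \<in> G - set_stabiliser G \<gamma>" and "act h ` tube p q \<gamma> r \<inter> tube p q \<gamma> r \<noteq> {}"
    then have fs: "fixes_pair (cj A h) \<or> swaps_pair (cj A h)" using pair by blast
    have "act h ` \<gamma> = act (adj A) ` act (cj A h) ` std_geodesic"
      by (simp add: \<gamma> image_image act_cj[OF A(1)] act_adj[OF A(1)])
    also have "\<dots> = \<gamma>"
      using std_geodesic_invariant[OF cj_Sp[OF A(1)] fs] h GS by (simp add: \<gamma>)
    finally show False using h by (simp add: set_stabiliser_def)
  qed
  assume prim: "primitive_in p q G g"
  show "precisely_invariant G (generate S {g}) (tube p q \<gamma> r)"
    unfolding precisely_invariant_def
  proof (intro ballI, rule ccontr)
    fix h assume h: "h \<in> G - generate S {g}" and "act h ` tube p q \<gamma> r \<inter> tube p q \<gamma> r \<noteq> {}"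
    then have fs: "fixes_pair (cj A h) \<or> swaps_pair (cj A h)" using pair by blast
    have tf': "torsion_free p q (cj A ` G)" using cj_torsion_free[OF A(1) tf] .
    have hG: "cj A h \<in> cj A ` G" using h by blast
    have f: "fixes_pair (cj A h)" using fs D.no_swap[OF tf' hG] by blast
    obtain n where "cj A h = pw (diagonal l) n \<or> adj (cj A h) = pw (diagonal l) n"
      using D.primitive_generates[OF tf' _ hG f] cj_primitive[OF A(1) prim] A(2) by auto
    then have "cj A h = cj A (pw g n) \<or> cj A (adj h) = cj A (pw g n)"
      using h by (simp only: cj_pw[OF A(1)] A(2) cj_adj[OF A(1) GS] DiffD1)
    then have "h = pw g n \<or> adj h = pw g n" by (simp only: cj_eq_iff[OF A(1)])
    then have "h \<in> generate S {g}"
    proof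
      assume "adj h = pw g n"
      then have "inv\<^bsub>S\<^esub> (adj h) \<in> generate S {g}"
        using group.generate_m_inv_closed[OF group_Sp, of "{g}" "pw g n"] pw_generate GS[OF g(1)] by simp
      then show ?thesis using h GS by (simp add: inv_Sp adj_Sp)
    qed (simp add: pw_generate)
    with h show False by blast
  qed
qed

end

theorem theorem1p3:
  fixes p q :: "'n::finite"
    and G :: "(quat ^ 'n ^ 'n) set"
    and g :: "quat ^ 'n ^ 'n"
    and \<gamma> :: "'n ppoint set"
    and r :: real
  assumes "p \<noteq> q"
    and "subgroup G (Sp p q)"
    and "discrete G"
    and "\<not> elementary p q G"
    and "torsion_free p q G"
    and "g \<in> G"
    and "loxodromic p q g"
    and "is_axis p q g \<gamma>"
    and "M_inv p q g < sqrt 3 - 1"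
    and "r > 0"
    and "cosh (2 * r) = 2 * (1 - M_inv p q g) / (M_inv p q g)\<^sup>2"
  shows "(primitive_in p q G g \<longrightarrow>
            precisely_invariant G (generate (Sp p q) {g}) (tube p q \<gamma> r) \<and>
            collar_embedded p q G (generate (Sp p q) {g}) (tube p q \<gamma> r)) \<and>
         precisely_invariant G (set_stabiliser G \<gamma>) (tube p q \<gamma> r) \<and>
         collar_embedded p q G (set_stabiliser G \<gamma>) (tube p q \<gamma> r)"
proof -
  interpret frame p q using assms(1) by unfold_locales
  note inv = collar_theorem[OF assms(2,3,5-11)]
  have T: "tube p q \<gamma> r \<subseteq> hyp p q" by (auto simp: tube_def)
  have "collar_embedded p q G (set_stabiliser G \<gamma>) (tube p q \<gamma> r)"
    using precisely_invariant_imp_collar_embedded[OF assms(2) subgroup_stabiliser[OF assms(2)] _ T inv(1)]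
    by (auto simp: set_stabiliser_def)
  moreover have "subgroup (generate S {g}) S" "generate S {g} \<subseteq> G"
    using group.generate_is_subgroup[OF group_Sp, of "{g}"]
      group.generate_subgroup_incl[OF group_Sp _ assms(2), of "{g}"] subgroup.subset[OF assms(2)] assms(6)
    by auto
  then have "collar_embedded p q G (generate S {g}) (tube p q \<gamma> r)" if "primitive_in p q G g"
    using precisely_invariant_imp_collar_embedded[OF assms(2) _ _ T inv(2)[OF that]] by blast
  ultimately show ?thesis using inv by (intro conjI impI)
qed

end
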